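(* Let $m_n\to\infty$ be positive integers and let $w_n:\mathcal{Z}\to\mathbb{R}^{m_n}$ be measurable functions with $\int w_n\,dQ=0$ and $\int|w_n|^2\,dQ<\infty$. Suppose that the sequence of matrices $W_n=\int w_nw_n^{\top}\,dQ$ is regular and that $\int|w_n|^r\,dQ=O(m_n^{r/2})$ for some $2<r<4$. If $m_n^{2r/(r-2)}=o(n)$, then $$\frac{-2\log\mathscr{R}_n-m_n}{\sqrt{2m_n}}\Longrightarrow N(0,1)\qquad\text{as } n\to\infty.$$
   Context: $(\mathcal{Z},\mathscr{S})$ is a measurable space; $Z_1,\dots,Z_n$ are independent copies of a $\mathcal{Z}$-valued random variable $Z$ with distribution $Q$ (the same for all $n$). $|\cdot|$ is the Euclidean norm and $\Longrightarrow$ denotes convergence in distribution. A sequence $W_n$ of $m_n\times m_n$ dispersion (covariance) matrices is called regular if $0<\inf_n\inf_{|u|=1}u^{\top}W_nu\le\sup_n\sup_{|u|=1}u^{\top}W_nu<\infty$. With $\mathscr{P}_n=\{\pi\in[0,1]^n:\pi_1+\dots+\pi_n=1\}$, the empirical likelihood is $$\mathscr{R}_n=\sup\Big\{\prod_{j=1}^n n\pi_j:\ \pi\in\mathscr{P}_n,\ \sum_{j=1}^n\pi_jw_n(Z_j)=0\Big\},$$ with the supremum taken in $[0,\infty)$, so that $\sup\emptyset=0$ and $-2\log 0=+\infty$. *)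

theory Defs
  imports "HOL-Probability.Probability" "HOL-Library.Landau_Symbols"
begin

text \<open>
  The dimension varies with the sample size, so a vector of dimension \<open>d\<close> is a function
  \<open>nat \<Rightarrow> real\<close> of which only the coordinates \<open>i < d\<close> are used, and a \<open>d \<times> d\<close> matrix is a
  function \<open>nat \<Rightarrow> nat \<Rightarrow> real\<close> read at indices below \<open>d\<close>.
\<close>

definition enorm :: "nat \<Rightarrow> (nat \<Rightarrow> real) \<Rightarrow> real" where
  "enorm d x = L2_set x {..<d}"

definition quad_form :: "nat \<Rightarrow> (nat \<Rightarrow> nat \<Rightarrow> real) \<Rightarrow> (nat \<Rightarrow> real) \<Rightarrow> real" where
  "quad_form d W u = (\<Sum>i<d. \<Sum>j<d. u i * W i j * u j)"

definition moment_matrix :: "'z measure \<Rightarrow> ('z \<Rightarrow> nat \<Rightarrow> real) \<Rightarrow> nat \<Rightarrow> nat \<Rightarrow> real" where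
  "moment_matrix Q f i j = (\<integral>z. f z i * f z j \<partial>Q)"

text \<open>
  Sequences are indexed by \<open>n \<ge> 1\<close>. Infima and suprema are taken in the extended reals, where
  they always exist.
\<close>

definition regular_matrices :: "(nat \<Rightarrow> nat) \<Rightarrow> (nat \<Rightarrow> nat \<Rightarrow> nat \<Rightarrow> real) \<Rightarrow> bool" where
  "regular_matrices m W \<longleftrightarrow>
     0 < (INF n\<in>{1..}. INF u\<in>{u. enorm (m n) u = 1}. ereal (quad_form (m n) (W n) u)) \<and>
     (SUP n\<in>{1..}. SUP u\<in>{u. enorm (m n) u = 1}. ereal (quad_form (m n) (W n) u)) < \<infinity>"

definition prob_weights :: "nat \<Rightarrow> (nat \<Rightarrow> real) set" where
  "prob_weights n = {\<pi> \<in> {1..n} \<rightarrow>\<^sub>E {0..1}. (\<Sum>j=1..n. \<pi> j) = 1}"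

text \<open>
  Empirical likelihood of the \<open>d\<close>-dimensional vectors \<open>x 1, \<dots>, x n\<close>. In \<open>ennreal\<close> the supremum
  of the empty set is \<open>0\<close>; a nonempty supremum is finite, since the products are at most \<open>n ^ n\<close>.
\<close>

definition emp_lik :: "nat \<Rightarrow> nat \<Rightarrow> (nat \<Rightarrow> nat \<Rightarrow> real) \<Rightarrow> ennreal" where
  "emp_lik n d x =
     (SUP \<pi>\<in>{\<pi> \<in> prob_weights n. \<forall>i<d. (\<Sum>j=1..n. \<pi> j * x j i) = 0}.
        ennreal (\<Prod>j=1..n. real n * \<pi> j))"

definition ext_ln :: "ennreal \<Rightarrow> ereal" where
  "ext_ln x = (if x = 0 then - \<infinity> else if x = \<infinity> then \<infinity> else ereal (ln (enn2real x)))"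

text \<open>
  Convergence in distribution of extended-real random variables to a probability measure on the
  real line, via distribution functions as in \<^const>\<open>weak_conv_m\<close>. Since the limit has no mass at
  infinity, convergence of the distribution functions at real points also forces the
  probabilities of the values \<open>\<plusminus>\<infinity>\<close> to tend to \<open>0\<close>.
\<close>

definition conv_in_distr ::
  "'a measure \<Rightarrow> (nat \<Rightarrow> 'a \<Rightarrow> ereal) \<Rightarrow> real measure \<Rightarrow> bool" where
  "conv_in_distr M X N \<longleftrightarrow>
     (\<forall>n. X n \<in> borel_measurable M) \<and>
     weak_conv (\<lambda>n x. measure (distr M borel (X n)) {..ereal x}) (cdf N)"

end

theory Submission
  imports Defs
begin

text \<open>
  A triangular change of coordinates (Gram--Schmidt for \<open>W\<^sub>n\<close>) leaves the empirical likelihood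
  unchanged and turns \<open>w\<^sub>n\<close> into a vector \<open>y\<close> with identity covariance matrix, whose norm is
  bounded by a multiple of \<open>|w\<^sub>n|\<close>.

  Let \<open>S\<close> be the sum of the \<open>y\<^sub>j\<close>. With probability close to one, \<open>max |y\<^sub>j|\<close> is small
  compared with \<open>(n / m)\<^sup>\<onehalf>\<close>, the empirical second moment matrix is within \<open>o(m\<^sup>-\<^sup>\<onehalf>)\<close> of the
  identity and \<open>\<Sum> |y\<^sub>j|\<^sup>4\<close> is small compared with \<open>n\<^sup>2 / m\<^sup>2\<close>; all three follow from the moment
  condition by truncation. On that event \<open>-2 log R\<^sub>n\<close> is squeezed to \<open>|S|\<^sup>2 / n + o(m\<^sup>\<onehalf>)\<close> by
  evaluating the dual problem at the sample mean and the primal problem at explicit feasible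
  weights.

  It remains to treat \<open>(|S|\<^sup>2 - \<Sum> |y\<^sub>j|\<^sup>2) / n\<close>. Its characteristic function changes by \<open>o(1)\<close> when
  the \<open>y\<^sub>j\<close> are replaced one at a time by standard Gaussian vectors (Lindeberg's method), and for
  Gaussian vectors \<open>|S|\<^sup>2 / n\<close> is chi-square distributed with \<open>m\<close> degrees of freedom, so the
  classical central limit theorem applies.
\<close>


section \<open>Linear algebra in coordinates\<close>

text \<open>The truncation level is \<open>B = \<epsilon> * sqrt (n / m)\<close>. The sample mean
  has norm of order \<open>sqrt (m / n)\<close>, so this level keeps all arguments of the logarithms
  small. Markov's inequality for the sum of the |y_j|^r bounds the failure probability by a multiple
  of \<open>\<epsilon>^(-r) * m^r * n^(1 - r/2)\<close>, and this tends to 0 exactly when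
  m^(2r/(r-2)) = o(n): here the growth condition originates. The second moment matrix is needed to
  precision o(m^(-1/2)) because a relative error \<kappa> moves |S|^2 / n, which is of order m, by
  \<kappa> m, while the fluctuations to be resolved are of order m^(1/2). Only moments of order r <
  4 are available, so |y|^2 need not have a variance and |y| need not have a third moment. Removing
  the diagonal from |S|^2 answers this: the remaining form is linear in each y_j, and replacing one
  y_j costs only a moment of order q = min(r, 3) of y_j times the same moment of the sum of the
  others.\<close>

definition dot :: "nat \<Rightarrow> (nat \<Rightarrow> real) \<Rightarrow> (nat \<Rightarrow> real) \<Rightarrow> real" where
  "dot d x y = (\<Sum>i<d. x i * y i)"

lemma enorm_nonneg [simp]: "0 \<le> enorm d x"
  by (simp add: enorm_def)

lemma enorm_sq: "(enorm d x)\<^sup>2 = (\<Sum>i<d. (x i)\<^sup>2)"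
  by (simp add: enorm_def L2_set_def sum_nonneg)

lemma dot_self: "dot d x x = (enorm d x)\<^sup>2"
  unfolding enorm_sq by (simp add: dot_def power2_eq_square)

lemma dot_commute: "dot d x y = dot d y x"
  by (simp add: dot_def mult.commute)

lemma dot_add_left: "dot d (\<lambda>i. x i + y i) z = dot d x z + dot d y z"
  by (simp add: dot_def algebra_simps sum.distrib)

lemma dot_add_right: "dot d z (\<lambda>i. x i + y i) = dot d z x + dot d z y"
  by (simp add: dot_def algebra_simps sum.distrib)

lemma dot_diff_right: "dot d z (\<lambda>i. x i - y i) = dot d z x - dot d z y"
  by (simp add: dot_def algebra_simps sum_subtractf)

lemma dot_scale_right: "dot d z (\<lambda>i. c * x i) = c * dot d z x"
  by (simp add: dot_def algebra_simps sum_distrib_left)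

lemma dot_sum_right: "dot d z (\<lambda>i. \<Sum>j\<in>J. x j i) = (\<Sum>j\<in>J. dot d z (x j))"
  by (simp add: dot_def sum_distrib_left) (rule sum.swap)

lemma dot_cong: "(\<And>i. i < d \<Longrightarrow> x i = x' i) \<Longrightarrow> (\<And>i. i < d \<Longrightarrow> y i = y' i) \<Longrightarrow> dot d x y = dot d x' y'"
  by (simp add: dot_def)

lemma enorm_cong: "(\<And>i. i < d \<Longrightarrow> x i = y i) \<Longrightarrow> enorm d x = enorm d y"
  by (simp add: enorm_def L2_set_def)

lemma abs_dot_le: "\<bar>dot d x y\<bar> \<le> enorm d x * enorm d y"
proof -
  have "\<bar>dot d x y\<bar> \<le> (\<Sum>i<d. \<bar>x i\<bar> * \<bar>y i\<bar>)"
    unfolding dot_def by (rule order_trans[OF sum_abs]) (simp add: abs_mult)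
  also have "... \<le> enorm d x * enorm d y"
    unfolding enorm_def by (rule L2_set_mult_ineq)
  finally show ?thesis .
qed

lemma enorm_add_sq: "(enorm d (\<lambda>i. x i + y i))\<^sup>2 = (enorm d x)\<^sup>2 + 2 * dot d x y + (enorm d y)\<^sup>2"
  by (simp add: dot_self[symmetric] dot_add_left dot_add_right dot_commute)

lemma enorm_triangle: "enorm d (\<lambda>i. x i + y i) \<le> enorm d x + enorm d y"
  unfolding enorm_def by (rule L2_set_triangle_ineq)

lemma enorm_scale: "enorm d (\<lambda>i. c * x i) = \<bar>c\<bar> * enorm d x"
  by (simp add: enorm_def L2_set_def power_mult_distrib sum_distrib_left[symmetric] real_sqrt_mult)

lemma enorm_diff_le: "enorm d (\<lambda>i. x i - y i) \<le> enorm d x + enorm d y"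
  using enorm_triangle[of d x "\<lambda>i. (-1) * y i"] enorm_scale[of d "-1" y] by simp

lemma enorm_measurable:
  assumes "\<And>i. i < d \<Longrightarrow> (\<lambda>z. f z i) \<in> borel_measurable N"
  shows "(\<lambda>z. enorm d (f z)) \<in> borel_measurable N"
  unfolding enorm_def L2_set_def using assms by measurable

lemma quad_form_eq_dot: "quad_form d W u = dot d u (\<lambda>i. dot d (W i) u)"
  by (simp add: quad_form_def dot_def sum_distrib_left algebra_simps)

text \<open>Forward substitution: row \<open>i\<close> involves only coordinates up to
  \<open>i\<close>, and those below \<open>i\<close> vanish by induction. It serves both to solve
  linear systems and to show that a change of coordinates keeps the moment constraint.\<close>

lemma lower_triangular_injective:
  fixes A :: "nat \<Rightarrow> nat \<Rightarrow> real"
  assumes "\<And>i. i < d \<Longrightarrow> A i i \<noteq> 0" "\<And>i k. i < d \<Longrightarrow> i < k \<Longrightarrow> A i k = 0"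
    and "\<And>i. i < d \<Longrightarrow> dot d (A i) v = 0" and "i < d"
  shows "v i = 0"
  using \<open>i < d\<close>
proof (induction i rule: less_induct)
  case (less i)
  have "0 = dot d (A i) v" using assms(3) less by simp
  also have "... = (\<Sum>k\<in>{i}. A i k * v k)"
    unfolding dot_def
  proof (rule sum.mono_neutral_right)
    show "\<forall>k\<in>{..<d} - {i}. A i k * v k = 0"
    proof
      fix k assume "k \<in> {..<d} - {i}"
      then consider "k < i" | "i < k" by fastforce
      then show "A i k * v k = 0"
        using less assms(2)[of i k] by cases auto
    qed
  qed (use less in auto)
  finally show ?case using assms(1) less by simp
qed

text \<open>Row \<open>i\<close> of \<open>A\<close> holds the coordinates of the \<open>i\<close>-th vector of the Gram--Schmidt basis for the
  inner product given by \<open>W\<close>.\<close>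

lemma gram_schmidt:
  fixes W :: "nat \<Rightarrow> nat \<Rightarrow> real"
  assumes sym: "\<And>i j. i < d \<Longrightarrow> j < d \<Longrightarrow> W i j = W j i"
    and c: "0 < c" and pos: "\<And>u. c * (enorm d u)\<^sup>2 \<le> quad_form d W u"
  obtains A :: "nat \<Rightarrow> nat \<Rightarrow> real"
  where "\<And>i. i < d \<Longrightarrow> A i i \<noteq> 0" "\<And>i k. i < d \<Longrightarrow> i < k \<Longrightarrow> A i k = 0"
    and "\<And>i j. i < d \<Longrightarrow> j < d \<Longrightarrow>
           (\<Sum>k<d. \<Sum>l<d. A i k * W k l * A j l) = (if i = j then 1 else 0)"
proof -
  define B where "B u v = (\<Sum>k<d. \<Sum>l<d. u k * W k l * v l)" for u v :: "nat \<Rightarrow> real"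
  have Bsym: "B u v = B v u" for u v
    unfolding B_def
    by (subst sum.swap) (intro sum.cong refl, use sym in \<open>auto simp: mult_ac\<close>)
  have Blin: "B u (\<lambda>l. a * v l + b * w l) = a * B u v + b * B u w" for u v w a b
    unfolding B_def by (simp add: algebra_simps sum.distrib sum_distrib_left)
  have Bsum: "B u (\<lambda>l. \<Sum>j<e. g j * v j l) = (\<Sum>j<e. g j * B u (v j))" for u g v and e :: nat
  proof (induction e)
    case (Suc e)
    then show ?case using Blin[of u 1 "\<lambda>l. \<Sum>j<e. g j * v j l" "g e" "v e"] by simp
  qed (simp add: B_def)
  have Bpos: "c * (enorm d u)\<^sup>2 \<le> B u u" for u
    using pos[of u] by (simp add: B_def quad_form_def)
  \<comment> \<open>Induction on the number \<open>e\<close> of rows built so far; the triangular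
    shape is carried along because invertibility will be read off the diagonal.\<close>
  have "\<exists>A. (\<forall>i<e. A i i \<noteq> 0) \<and> (\<forall>i<e. \<forall>k>i. A i k = 0) \<and>
          (\<forall>i<e. \<forall>j<e. B (A i) (A j) = (if i = j then 1 else 0))" if "e \<le> d" for e
    using that
  proof (induction e)
    case 0
    then show ?case by simp
  next
    case (Suc e)
    then obtain A where A: "\<And>i. i < e \<Longrightarrow> A i i \<noteq> 0" "\<And>i k. i < e \<Longrightarrow> i < k \<Longrightarrow> A i k = 0"
      "\<And>i j. i < e \<Longrightarrow> j < e \<Longrightarrow> B (A i) (A j) = (if i = j then 1 else 0)" by force
    define u where "u = (\<lambda>k. if k = e then 1 else 0 :: real)"
    define p where "p = (\<lambda>k. \<Sum>i<e. B u (A i) * A i k)"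
    \<comment> \<open>The scalars 1 and -1 are written out so that \<open>Blin\<close> applies; the
      summand \<open>0 * v k\<close> in \<open>A'\<close> below has the same purpose.\<close>
    define v where "v = (\<lambda>k. 1 * u k + (-1) * p k)"
    have ve: "v e = 1" "\<And>k. e < k \<Longrightarrow> v k = 0"
      using A(2) by (auto simp: v_def u_def p_def)
    have vA: "B (A i) v = 0" if "i < e" for i
    proof -
      have "B (A i) p = (\<Sum>j<e. B u (A j) * B (A i) (A j))"
        unfolding p_def by (rule Bsum)
      also have "... = (\<Sum>j<e. if i = j then B u (A j) else 0)"
        using A(3) that by (intro sum.cong) auto
      also have "... = B u (A i)" using that by simp
      finally have "B (A i) p = B (A i) u" using Bsym by simp
      then show ?thesis unfolding v_def Blin by simp
    qed
    \<comment> \<open>\<open>p\<close> has no coordinate at \<open>e\<close>, so coordinate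
      \<open>e\<close> of \<open>v\<close> is 1 and \<open>v\<close> cannot vanish.\<close>
    have "0 < B v v"
    proof -
      have "(1::real) = (v e)\<^sup>2" using ve by simp
      also have "... \<le> (enorm d v)\<^sup>2"
        unfolding enorm_sq using Suc.prems by (intro member_le_sum) auto
      finally have "c * 1 \<le> c * (enorm d v)\<^sup>2" using c by (intro mult_left_mono) auto
      then show ?thesis using Bpos[of v] c by linarith
    qed
    define s where "s = 1 / sqrt (B v v)"
    have s: "s > 0" "s * s * B v v = 1"
      using \<open>0 < B v v\<close> by (auto simp: s_def)
    define A' where "A' = A(e := (\<lambda>k. s * v k + 0 * v k))"
    have B1: "B x (\<lambda>k. s * v k + 0 * v k) = s * B x v" for x
      using Blin[of x s v 0 v] by simp
    have B2: "B (\<lambda>k. s * v k + 0 * v k) x = s * B v x" for x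
      using B1[of x] Bsym by metis
    have "B (A' i) (A' j) = (if i = j then 1 else 0)" if ij: "i < Suc e" "j < Suc e" for i j
    proof -
      consider "i < e" "j < e" | "i < e" "j = e" | "i = e" "j < e" | "i = e" "j = e"
        using ij by (auto simp: less_Suc_eq)
      then show ?thesis
      proof cases
        case 1 then show ?thesis using A(3) by (simp add: A'_def)
      next
        case 2 then show ?thesis using vA[of i] B1[of "A i"] by (simp add: A'_def)
      next
        case 3 then show ?thesis using vA[of j] B2[of "A j"] Bsym[of v "A j"] by (simp add: A'_def)
      next
        case 4
        then have "B (A' i) (A' j) = s * (s * B v v)" unfolding A'_def using B1 B2 by simp
        then show ?thesis using 4 s by simp
      qed
    qed
    moreover have "A' i i \<noteq> 0" if "i < Suc e" for i
      using A(1) that ve s by (auto simp: A'_def less_Suc_eq)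
    moreover have "A' i k = 0" if "i < Suc e" "i < k" for i k
      using A(2) that ve by (auto simp: A'_def less_Suc_eq)
    ultimately show ?case by blast
  qed
  from this[of d] obtain A where "\<And>i. i < d \<Longrightarrow> A i i \<noteq> 0" "\<And>i k. i < d \<Longrightarrow> i < k \<Longrightarrow> A i k = 0"
      "\<And>i j. i < d \<Longrightarrow> j < d \<Longrightarrow> B (A i) (A j) = (if i = j then 1 else 0)" by force
  then show thesis using that unfolding B_def by blast
qed

lemma quad_form_expand_rows:
  "(\<Sum>i<d. \<Sum>j<d. u i * u j * (\<Sum>k<d. \<Sum>l<d. A i k * W k l * A j l)) =
   quad_form d W (\<lambda>k. \<Sum>i<d. A i k * u i)"
proof -
  have "quad_form d W (\<lambda>k. \<Sum>i<d. A i k * u i) =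
      (\<Sum>k<d. \<Sum>l<d. \<Sum>i<d. \<Sum>j<d. u i * u j * (A i k * W k l * A j l))"
    unfolding quad_form_def by (simp add: sum_distrib_left sum_distrib_right algebra_simps)
  also have "... = (\<Sum>k<d. \<Sum>i<d. \<Sum>l<d. \<Sum>j<d. u i * u j * (A i k * W k l * A j l))"
    by (intro sum.cong refl sum.swap)
  also have "... = (\<Sum>i<d. \<Sum>k<d. \<Sum>l<d. \<Sum>j<d. u i * u j * (A i k * W k l * A j l))"
    by (rule sum.swap)
  also have "... = (\<Sum>i<d. \<Sum>k<d. \<Sum>j<d. \<Sum>l<d. u i * u j * (A i k * W k l * A j l))"
    by (intro sum.cong refl sum.swap)
  also have "... = (\<Sum>i<d. \<Sum>j<d. \<Sum>k<d. \<Sum>l<d. u i * u j * (A i k * W k l * A j l))"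
    by (intro sum.cong refl sum.swap)
  finally show ?thesis by (simp add: sum_distrib_left)
qed

lemma dot_transpose: "dot d u (\<lambda>i. dot d (A i) x) = dot d (\<lambda>k. \<Sum>i<d. A i k * u i) x"
proof -
  have "dot d u (\<lambda>i. dot d (A i) x) = (\<Sum>i<d. \<Sum>k<d. A i k * u i * x k)"
    by (simp add: dot_def sum_distrib_left algebra_simps)
  also have "... = (\<Sum>k<d. \<Sum>i<d. A i k * u i * x k)" by (rule sum.swap)
  finally show ?thesis by (simp add: dot_def sum_distrib_right)
qed

text \<open>The operator norm of \<open>A\<close> is bounded through that of its transpose:
  \<open>c |A\<^sup>T u|\<^sup>2 \<le> u\<^sup>T A W A\<^sup>T u = |u|\<^sup>2\<close>.\<close>

lemma whitening_norm_le:
  fixes W A :: "nat \<Rightarrow> nat \<Rightarrow> real"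
  assumes c: "0 < c" and pos: "\<And>u. c * (enorm d u)\<^sup>2 \<le> quad_form d W u"
    and A: "\<And>i j. i < d \<Longrightarrow> j < d \<Longrightarrow>
           (\<Sum>k<d. \<Sum>l<d. A i k * W k l * A j l) = (if i = j then 1 else 0)"
  shows "enorm d (\<lambda>i. dot d (A i) x) \<le> enorm d x / sqrt c"
proof -
  define u where "u = (\<lambda>i. dot d (A i) x)"
  define t where "t = (\<lambda>k. \<Sum>i<d. A i k * u i)"
  have "quad_form d W t = (\<Sum>i<d. \<Sum>j<d. u i * u j * (\<Sum>k<d. \<Sum>l<d. A i k * W k l * A j l))"
    unfolding t_def by (rule quad_form_expand_rows[symmetric])
  also have "... = (\<Sum>i<d. \<Sum>j<d. if i = j then u i * u j else 0)"
    using A by (intro sum.cong refl) auto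
  also have "... = (enorm d u)\<^sup>2" unfolding enorm_sq by (simp add: power2_eq_square)
  finally have "c * (enorm d t)\<^sup>2 \<le> (enorm d u)\<^sup>2" using pos[of t] by simp
  then have "(sqrt c * enorm d t)\<^sup>2 \<le> (enorm d u)\<^sup>2" using c by (simp add: power_mult_distrib)
  then have t: "sqrt c * enorm d t \<le> enorm d u" by (rule power2_le_imp_le) simp
  \<comment> \<open>\<open>u\<close> is \<open>A x\<close> and \<open>t\<close> is the transpose of
    \<open>A\<close> applied to \<open>u\<close>; pairing \<open>t\<close> with \<open>x\<close>
    transfers the bound, and one factor |u| cancels at the end.\<close>
  have "(enorm d u)\<^sup>2 = dot d t x"
    unfolding dot_self[symmetric] t_def dot_transpose[symmetric] by (simp add: u_def)
  also have "... \<le> enorm d t * enorm d x" using abs_dot_le[of d t x] by linarith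
  finally have "sqrt c * (enorm d u)\<^sup>2 \<le> (sqrt c * enorm d t) * enorm d x"
    using c by (simp add: mult.assoc)
  also have "... \<le> enorm d u * enorm d x" using t by (intro mult_right_mono) auto
  finally have *: "enorm d u * (sqrt c * enorm d u) \<le> enorm d u * enorm d x"
    by (simp add: power2_eq_square mult_ac)
  have "sqrt c * enorm d u \<le> enorm d x"
  proof (cases "enorm d u = 0")
    case False
    then have "0 < enorm d u" using enorm_nonneg[of d u] by linarith
    then show ?thesis using * by simp
  qed simp
  then show ?thesis using c by (simp add: u_def field_simps)
qed

text \<open>Since \<open>A W A^T = I\<close> for the Gram-Schmidt matrix \<open>A\<close>, the
  inverse of \<open>W\<close> is \<open>A^T A\<close>, which gives the solution
  \<open>A^T A b\<close>. The residual is mapped to 0 by \<open>A\<close> and hence vanishes by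
  triangularity.\<close>

lemma posdef_solvable:
  fixes W :: "nat \<Rightarrow> nat \<Rightarrow> real"
  assumes sym: "\<And>i j. i < d \<Longrightarrow> j < d \<Longrightarrow> W i j = W j i"
    and c: "0 < c" and pos: "\<And>u. c * (enorm d u)\<^sup>2 \<le> quad_form d W u"
  obtains \<mu> where "\<And>i. i < d \<Longrightarrow> dot d (W i) \<mu> = b i"
proof -
  obtain A where A: "\<And>i. i < d \<Longrightarrow> A i i \<noteq> 0" "\<And>i k. i < d \<Longrightarrow> i < k \<Longrightarrow> A i k = 0"
    "\<And>i j. i < d \<Longrightarrow> j < d \<Longrightarrow>
           (\<Sum>k<d. \<Sum>l<d. A i k * W k l * A j l) = (if i = j then 1 else 0)"
    using gram_schmidt[OF sym c pos] by blast
  define \<mu> where "\<mu> = (\<lambda>l. \<Sum>j<d. A j l * dot d (A j) b)"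
  define v where "v = (\<lambda>i. dot d (W i) \<mu> - b i)"
  have "dot d (A i) v = 0" if "i < d" for i
  proof -
    have "dot d (A i) (\<lambda>k. dot d (W k) \<mu>) =
       (\<Sum>k<d. \<Sum>l<d. \<Sum>j<d. dot d (A j) b * (A i k * W k l * A j l))"
      unfolding dot_def[of d "A i"] dot_def[of d "W _"] \<mu>_def
      by (simp add: sum_distrib_left algebra_simps)
    also have "... = (\<Sum>k<d. \<Sum>j<d. \<Sum>l<d. dot d (A j) b * (A i k * W k l * A j l))"
      by (intro sum.cong refl sum.swap)
    also have "... = (\<Sum>j<d. \<Sum>k<d. \<Sum>l<d. dot d (A j) b * (A i k * W k l * A j l))"
      by (rule sum.swap)
    also have "... = (\<Sum>j<d. dot d (A j) b * (\<Sum>k<d. \<Sum>l<d. A i k * W k l * A j l))"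
      by (simp add: sum_distrib_left)
    also have "... = (\<Sum>j<d. if i = j then dot d (A j) b else 0)"
      using A(3) that by (intro sum.cong) auto
    also have "... = dot d (A i) b" using that by simp
    finally show ?thesis unfolding v_def dot_diff_right by simp
  qed
  then have "v i = 0" if "i < d" for i
    using lower_triangular_injective[of d A v] A that by blast
  then show thesis using that[of \<mu>] by (simp add: v_def)
qed


section \<open>Deterministic expansion of the empirical likelihood\<close>

declare One_nat_def [simp del]

text \<open>The difference of the two sides vanishes at 0 and is monotone on either side of 0. For
  negative arguments the bound -1/2 makes \<open>1 / (1 + x)\<close> at most 2, which the 3 coming
  from the cubic term absorbs.\<close>

lemma ln_add_one_ge_cubic:
  fixes t :: real
  assumes "\<bar>t\<bar> \<le> 1/2"
  shows "t - t\<^sup>2 / 2 - \<bar>t\<bar> ^ 3 \<le> ln (1 + t)"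
proof (cases "t \<ge> 0")
  case True
  let ?f = "\<lambda>t. ln (1 + t) - t + t\<^sup>2 / 2 + t ^ 3 :: real"
  have "?f 0 \<le> ?f t"
  proof (rule DERIV_nonneg_imp_nondecreasing[OF True])
    fix x :: real assume "0 \<le> x" "x \<le> t"
    then have "(?f has_real_derivative x\<^sup>2 / (1 + x) + 3 * x\<^sup>2) (at x)"
      by (auto intro!: derivative_eq_intros simp: field_simps power2_eq_square)
    moreover have "0 \<le> x\<^sup>2 / (1 + x) + 3 * x\<^sup>2" using \<open>0 \<le> x\<close> by simp
    ultimately show "\<exists>y. (?f has_real_derivative y) (at x) \<and> 0 \<le> y" by blast
  qed
  then show ?thesis using True by simp
next
  case False
  let ?f = "\<lambda>t. ln (1 + t) - t + t\<^sup>2 / 2 - t ^ 3 :: real"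
  have "?f t \<ge> ?f 0"
  proof (rule DERIV_nonpos_imp_nonincreasing[of t 0 ?f])
    show "t \<le> 0" using False by simp
    fix x :: real assume "t \<le> x" "x \<le> 0"
    with assms have x: "x \<ge> -1/2" by linarith
    then have "(?f has_real_derivative x\<^sup>2 * (1 / (1 + x) - 3)) (at x)"
      by (auto intro!: derivative_eq_intros simp: field_simps power2_eq_square)
    moreover have "x\<^sup>2 * (1 / (1 + x) - 3) \<le> 0"
      using x by (intro mult_nonneg_nonpos) (auto simp: field_simps)
    ultimately show "\<exists>y. (?f has_real_derivative y) (at x) \<and> y \<le> 0" by blast
  qed
  then show ?thesis using False by (simp add: abs_if power3_eq_cube)
qed

text \<open>Weak duality through \<open>a \<le> exp (a - 1)\<close>: the constraint removes the term
  linear in \<open>u\<close>, so the numbers \<open>n * \<pi> j * (1 + dot d u (x j))\<close> sum to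
  \<open>n\<close> and their product is at most 1.\<close>

lemma emp_lik_le_dual:
  assumes "n \<ge> 1" and pos: "\<And>j. j \<in> {1..n} \<Longrightarrow> 0 < 1 + dot d u (x j)"
  shows "emp_lik n d x \<le> ennreal (exp (- (\<Sum>j=1..n. ln (1 + dot d u (x j)))))"
  unfolding emp_lik_def
proof (rule SUP_least)
  fix \<pi> assume "\<pi> \<in> {\<pi> \<in> prob_weights n. \<forall>i<d. (\<Sum>j=1..n. \<pi> j * x j i) = 0}"
  then have \<pi>: "\<And>j. j \<in> {1..n} \<Longrightarrow> 0 \<le> \<pi> j" "(\<Sum>j=1..n. \<pi> j) = 1"
    "\<And>i. i < d \<Longrightarrow> (\<Sum>j=1..n. \<pi> j * x j i) = 0"
    by (auto simp: prob_weights_def PiE_def Pi_def)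
  define a where "a j = real n * \<pi> j * (1 + dot d u (x j))" for j
  have "(\<Sum>j=1..n. \<pi> j * dot d u (x j)) = (\<Sum>i<d. u i * (\<Sum>j=1..n. \<pi> j * x j i))"
    unfolding dot_def sum_distrib_left by (subst sum.swap) (simp add: mult_ac)
  then have "(\<Sum>j=1..n. \<pi> j * dot d u (x j)) = 0" using \<pi>(3) by simp
  then have sa: "(\<Sum>j=1..n. a j) = real n"
    using \<pi>(2) by (simp add: a_def mult.assoc sum_distrib_left[symmetric] distrib_left sum.distrib)
  have "(\<Prod>j=1..n. a j) \<le> (\<Prod>j=1..n. exp (a j - 1))"
    using \<pi>(1) pos exp_ge_add_one_self[of "a _ - 1"]
    by (intro prod_mono) (auto simp: a_def less_imp_le)
  also have "... = exp (\<Sum>j=1..n. (a j - 1))" by (simp add: exp_sum)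
  also have "... = 1" using sa by (simp add: sum_subtractf)
  finally have le1: "(\<Prod>j=1..n. a j) \<le> 1" .
  have "(\<Prod>j=1..n. real n * \<pi> j) * (\<Prod>j=1..n. 1 + dot d u (x j)) = (\<Prod>j=1..n. a j)"
    by (simp add: a_def prod.distrib)
  moreover have P: "(\<Prod>j=1..n. 1 + dot d u (x j)) = exp (\<Sum>j=1..n. ln (1 + dot d u (x j)))"
    unfolding exp_sum[OF finite_atLeastAtMost] using pos by (intro prod.cong) auto
  ultimately have "(\<Prod>j=1..n. real n * \<pi> j) \<le> exp (- (\<Sum>j=1..n. ln (1 + dot d u (x j))))"
    using le1 by (simp add: exp_minus field_simps)
  then show "ennreal (\<Prod>j=1..n. real n * \<pi> j) \<le> ennreal (exp (- (\<Sum>j=1..n. ln (1 + dot d u (x j)))))"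
    by (rule ennreal_leI)
qed

text \<open>Uniform weights tilted by \<open>s\<close>: the zero sum of \<open>s\<close> keeps the
  total mass at 1, and the upper bound 1 on each weight then follows from nonnegativity.\<close>

lemma emp_lik_ge_weights:
  assumes n: "n \<ge> 1" and s: "\<And>j. j \<in> {1..n} \<Longrightarrow> s j < 1" "(\<Sum>j=1..n. s j) = 0"
    and 0: "\<And>i. i < d \<Longrightarrow> (\<Sum>j=1..n. (1 - s j) * x j i) = 0"
  shows "ennreal (exp (\<Sum>j=1..n. ln (1 - s j))) \<le> emp_lik n d x"
proof -
  define \<pi> where "\<pi> = (\<lambda>j\<in>{1..n}. (1 - s j) / real n)"
  have nonneg: "0 \<le> \<pi> j" if "j \<in> {1..n}" for j
    using s(1)[OF that] that by (simp add: \<pi>_def)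
  have "(\<Sum>j=1..n. \<pi> j) = (\<Sum>j=1..n. 1 - s j) / real n"
    unfolding sum_divide_distrib by (intro sum.cong) (auto simp: \<pi>_def)
  also have "... = 1" using s(2) n by (simp add: sum_subtractf)
  finally have sum1: "(\<Sum>j=1..n. \<pi> j) = 1" .
  have "\<pi> j \<le> 1" if "j \<in> {1..n}" for j
    unfolding sum1[symmetric] using that nonneg by (intro member_le_sum) auto
  with nonneg sum1 have "\<pi> \<in> prob_weights n"
    by (auto simp: prob_weights_def \<pi>_def)
  moreover have "(\<Sum>j=1..n. \<pi> j * x j i) = 0" if "i < d" for i
  proof -
    have "(\<Sum>j=1..n. \<pi> j * x j i) = (\<Sum>j=1..n. (1 - s j) * x j i) / real n"
      unfolding sum_divide_distrib by (intro sum.cong) (auto simp: \<pi>_def)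
    then show ?thesis using 0[OF that] by simp
  qed
  ultimately have "ennreal (\<Prod>j=1..n. real n * \<pi> j) \<le> emp_lik n d x"
    unfolding emp_lik_def by (intro SUP_upper) auto
  moreover have "(\<Prod>j=1..n. real n * \<pi> j) = exp (\<Sum>j=1..n. ln (1 - s j))"
    unfolding exp_sum[OF finite_atLeastAtMost] using s(1) n
    by (intro prod.cong) (auto simp: \<pi>_def)
  ultimately show ?thesis by simp
qed

text \<open>Young's inequality with a free parameter. It trades the cubic remainder of the logarithm
  for a fraction of the quadratic term plus fourth powers, and fourth powers are what truncation
  controls.\<close>

lemma abs_cube_le_weighted:
  fixes s h :: real
  assumes "h > 0"
  shows "2 * \<bar>s\<bar> ^ 3 \<le> h * s\<^sup>2 + s ^ 4 / h"
proof -
  have "0 \<le> (h - \<bar>s\<bar>)\<^sup>2 * s\<^sup>2 / h" using assms by simp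
  also have "... = h * s\<^sup>2 + s ^ 4 / h - 2 * \<bar>s\<bar> ^ 3"
    using assms by (cases "s \<ge> 0") (simp_all add: field_simps power2_eq_square power3_eq_cube power4_eq_xxxx)
  finally show ?thesis by simp
qed

lemma power4_add_le:
  fixes a b :: real
  shows "(a + b) ^ 4 \<le> 8 * (a ^ 4 + b ^ 4)"
proof -
  have sq: "(u + v)\<^sup>2 \<le> 2 * (u\<^sup>2 + v\<^sup>2)" for u v :: real
    using zero_le_power2[of "u - v"] by (simp add: power2_eq_square algebra_simps)
  have "(a + b) ^ 4 = ((a + b)\<^sup>2)\<^sup>2" by simp
  also have "... \<le> (2 * (a\<^sup>2 + b\<^sup>2))\<^sup>2" using sq[of a b] by (intro power_mono) auto
  also have "... = 4 * (a\<^sup>2 + b\<^sup>2)\<^sup>2" unfolding power_mult_distrib by simp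
  also have "... \<le> 4 * (2 * ((a\<^sup>2)\<^sup>2 + (b\<^sup>2)\<^sup>2))" using sq[of "a\<^sup>2" "b\<^sup>2"] by simp
  finally show ?thesis by simp
qed

text \<open>Weak duality with multiplier \<open>xb\<close> bounds the likelihood from above; the feasible weights
  \<open>(1 - \<mu> \<bullet> (x\<^sub>j - xb)) / n\<close>, where the covariance matrix maps \<open>\<mu>\<close> to \<open>xb\<close>, bound it from below.
  Both bounds agree to second order, so the exact Lagrange multiplier is never needed.\<close>

lemma emp_lik_expansion:
  fixes x :: "nat \<Rightarrow> nat \<Rightarrow> real" and n d :: nat
  defines "xb \<equiv> \<lambda>i. (\<Sum>j=1..n. x j i) / real n"
  assumes n: "n \<ge> 1" and \<kappa>: "0 \<le> \<kappa>" "\<kappa> \<le> 1/8"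
    and qf: "\<And>u. \<bar>(\<Sum>j=1..n. (dot d u (x j))\<^sup>2) - real n * (enorm d u)\<^sup>2\<bar> \<le> \<kappa> * (real n * (enorm d u)\<^sup>2)"
    and small: "\<And>j. j \<in> {1..n} \<Longrightarrow> enorm d xb * enorm d (x j) \<le> 1/8" "(enorm d xb)\<^sup>2 \<le> \<kappa>"
    and F: "(\<Sum>j=1..n. enorm d (x j) ^ 4) \<le> F" "real n * enorm d xb ^ 4 \<le> F"
    and h: "h > 0"
  obtains v where "- 2 * ext_ln (emp_lik n d x) = ereal v"
    and "\<bar>v - real n * (enorm d xb)\<^sup>2\<bar> \<le>
      (4 * \<kappa> + 2 * h) * (real n * (enorm d xb)\<^sup>2) + 256 * enorm d xb ^ 4 * F / h"
proof -
  define N where "N = real n * (enorm d xb)\<^sup>2"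
  define E where "E = enorm d xb ^ 4 * F / h"
  have N0: "0 \<le> N" by (simp add: N_def)
  have F0: "0 \<le> F" by (rule order_trans[OF _ F(1)]) (simp add: sum_nonneg)
  have E0: "0 \<le> E" using F0 h by (simp add: E_def)
  have sx: "(\<Sum>j=1..n. x j i) = real n * xb i" for i using n by (simp add: xb_def)
  have sdot: "(\<Sum>j=1..n. dot d u (x j)) = real n * dot d u xb" for u
  proof -
    have "(\<Sum>j=1..n. dot d u (x j)) = dot d u (\<lambda>i. \<Sum>j=1..n. x j i)" by (simp add: dot_sum_right)
    also have "... = dot d u (\<lambda>i. real n * xb i)" by (simp only: sx)
    finally show ?thesis by (simp only: dot_scale_right)
  qed

  \<comment> \<open>Upper bound on the likelihood, with the sample mean as multiplier: the
    \<open>t j\<close> sum to \<open>N\<close> and their squares to about \<open>N\<close>, so twice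
    the sum of \<open>ln (1 + t j)\<close> is about \<open>2 * N - N\<close>.\<close>
  define t where "t j = dot d xb (x j)" for j
  have tb: "\<bar>t j\<bar> \<le> 1/8" if "j \<in> {1..n}" for j
    using abs_dot_le[of d xb "x j"] small(1)[OF that] by (simp add: t_def)
  have t1: "(\<Sum>j=1..n. t j) = N" by (simp add: t_def sdot dot_self N_def)
  have t2: "(\<Sum>j=1..n. (t j)\<^sup>2) \<le> (1 + \<kappa>) * N"
    using qf[of xb] by (simp add: t_def N_def algebra_simps abs_le_iff)
  have "(\<Sum>j=1..n. t j ^ 4) \<le> (\<Sum>j=1..n. enorm d xb ^ 4 * enorm d (x j) ^ 4)"
  proof (rule sum_mono)
    fix j
    have "t j ^ 4 = \<bar>t j\<bar> ^ 4" by simp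
    also have "... \<le> (enorm d xb * enorm d (x j)) ^ 4"
      unfolding t_def by (intro power_mono abs_dot_le) simp
    finally show "t j ^ 4 \<le> enorm d xb ^ 4 * enorm d (x j) ^ 4" by (simp add: power_mult_distrib)
  qed
  also have "... \<le> enorm d xb ^ 4 * F"
    unfolding sum_distrib_left[symmetric] using F(1) by (intro mult_left_mono) auto
  finally have t4: "(\<Sum>j=1..n. t j ^ 4) / h \<le> E" using h by (simp add: E_def divide_right_mono)
  define v1 where "v1 = 2 * (\<Sum>j=1..n. ln (1 + t j))"
  have up: "emp_lik n d x \<le> ennreal (exp (- v1 / 2))"
  proof -
    have "emp_lik n d x \<le> ennreal (exp (- (\<Sum>j=1..n. ln (1 + dot d xb (x j)))))"
      using tb by (intro emp_lik_le_dual n) (fastforce simp: t_def abs_le_iff)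
    then show ?thesis by (simp add: v1_def t_def)
  qed
  have "2 * (\<Sum>j=1..n. t j) - (\<Sum>j=1..n. (t j)\<^sup>2) - (\<Sum>j=1..n. h * (t j)\<^sup>2 + t j ^ 4 / h) \<le> v1"
    unfolding v1_def sum_distrib_left sum_subtractf[symmetric]
  proof (rule sum_mono)
    fix j assume "j \<in> {1..n}"
    then have "\<bar>t j\<bar> \<le> 1/2" using tb by fastforce
    from ln_add_one_ge_cubic[OF this] abs_cube_le_weighted[OF h, of "t j"]
    show "2 * t j - (t j)\<^sup>2 - (h * (t j)\<^sup>2 + t j ^ 4 / h) \<le> 2 * ln (1 + t j)" by linarith
  qed
  also have "2 * (\<Sum>j=1..n. t j) - (\<Sum>j=1..n. (t j)\<^sup>2) - (\<Sum>j=1..n. h * (t j)\<^sup>2 + t j ^ 4 / h)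
     = 2 * N - (1 + h) * (\<Sum>j=1..n. (t j)\<^sup>2) - (\<Sum>j=1..n. t j ^ 4) / h"
    by (simp add: t1 sum.distrib sum_distrib_left[symmetric] sum_divide_distrib[symmetric] algebra_simps)
  finally have "2 * N - (1 + h) * ((1 + \<kappa>) * N) - E \<le> v1"
    using t4 mult_left_mono[OF t2, of "1 + h"] h by linarith
  moreover have "h * (\<kappa> * N) \<le> h * (1 * N)"
    using \<kappa> h N0 by (intro mult_left_mono mult_right_mono) auto
  moreover have "0 \<le> \<kappa> * N" using \<kappa> N0 by simp
  ultimately have lower: "N - 4 * (\<kappa> * N) - 2 * (h * N) - E \<le> v1"
    by (simp add: algebra_simps)

  \<comment> \<open>Lower bound on the likelihood. The vectors are centred at the sample mean so
    that a tilt linear in \<open>y j\<close> preserves the total mass; \<open>S\<close> is the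
    empirical covariance matrix.\<close>
  define y where "y j = (\<lambda>i. x j i - xb i)" for j
  define S where "S i k = (\<Sum>j=1..n. y j i * y j k) / real n" for i k
  have sy: "(\<Sum>j=1..n. y j i) = 0" for i by (simp add: y_def sum_subtractf sx)
  have S_dot: "dot d (S i) u = (\<Sum>j=1..n. y j i * dot d u (y j)) / real n" for i u
    unfolding S_def dot_def
    by (simp add: sum_distrib_left sum_distrib_right sum_divide_distrib[symmetric])
       (subst sum.swap, simp add: mult_ac)
  have S_quad: "quad_form d S u = (\<Sum>j=1..n. (dot d u (y j))\<^sup>2) / real n" for u
  proof -
    have "quad_form d S u = (\<Sum>i<d. \<Sum>j=1..n. u i * y j i * dot d u (y j)) / real n"
      unfolding quad_form_eq_dot S_dot unfolding dot_def[of d u "\<lambda>i. _ i / real n"]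
      by (simp add: sum_distrib_left sum_divide_distrib mult_ac)
    also have "(\<Sum>i<d. \<Sum>j=1..n. u i * y j i * dot d u (y j)) = (\<Sum>j=1..n. \<Sum>i<d. u i * y j i * dot d u (y j))"
      by (rule sum.swap)
    also have "... = (\<Sum>j=1..n. (dot d u (y j))\<^sup>2)"
      by (simp add: sum_distrib_right[symmetric] power2_eq_square) (simp add: dot_def)
    finally show ?thesis .
  qed
  have S_quad': "quad_form d S u = (\<Sum>j=1..n. (dot d u (x j))\<^sup>2) / real n - (dot d u xb)\<^sup>2" for u
  proof -
    have "(\<Sum>j=1..n. (dot d u (y j))\<^sup>2) =
      (\<Sum>j=1..n. (dot d u (x j))\<^sup>2) - 2 * dot d u xb * (\<Sum>j=1..n. dot d u (x j)) + real n * (dot d u xb)\<^sup>2"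
      by (simp add: y_def dot_diff_right power2_diff sum.distrib sum_subtractf sum_distrib_left
           sum_distrib_right mult_ac)
    then show ?thesis unfolding S_quad using n by (simp add: sdot field_simps power2_eq_square)
  qed
  \<comment> \<open>One \<open>\<kappa>\<close> is the deviation of the second moment matrix from
    the identity; the other pays for subtracting the mean, whose squared norm is at most
    \<open>\<kappa>\<close> by \<open>small(2)\<close>.\<close>
  have S_pos: "(1 - 2 * \<kappa>) * (enorm d u)\<^sup>2 \<le> quad_form d S u" for u
  proof -
    have "(dot d u xb)\<^sup>2 \<le> (enorm d u * enorm d xb)\<^sup>2"
      using abs_dot_le[of d u xb] by (simp add: abs_le_square_iff[symmetric])
    also have "... \<le> (enorm d u)\<^sup>2 * \<kappa>"
      unfolding power_mult_distrib using small(2) by (intro mult_left_mono) auto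
    finally have 1: "(dot d u xb)\<^sup>2 \<le> (enorm d u)\<^sup>2 * \<kappa>" .
    have "(1 - \<kappa>) * (real n * (enorm d u)\<^sup>2) \<le> (\<Sum>j=1..n. (dot d u (x j))\<^sup>2)"
      using qf[of u] by (simp add: abs_le_iff algebra_simps)
    then have "(1 - \<kappa>) * (enorm d u)\<^sup>2 \<le> (\<Sum>j=1..n. (dot d u (x j))\<^sup>2) / real n"
      using n by (simp add: field_simps)
    then show ?thesis unfolding S_quad' using 1 by (simp add: algebra_simps)
  qed
  have k1: "0 < 1 - 2 * \<kappa>" using \<kappa> by simp
  \<comment> \<open>With this \<open>\<mu>\<close> the sum of \<open>s j * x j i\<close> is
    \<open>real n * xb i\<close>, which cancels the mean exactly and makes the weights
    feasible.\<close>
  obtain \<mu> where \<mu>: "\<And>i. i < d \<Longrightarrow> dot d (S i) \<mu> = xb i"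
    using posdef_solvable[of d S "1 - 2 * \<kappa>" xb] k1 S_pos by (auto simp: S_def mult.commute)
  define q where "q = dot d \<mu> xb"
  have q: "quad_form d S \<mu> = q"
    unfolding quad_form_eq_dot q_def using \<mu> by (auto intro!: dot_cong)
  define s where "s j = dot d \<mu> (y j)" for j
  have s2: "(\<Sum>j=1..n. (s j)\<^sup>2) = real n * q"
    using S_quad[of \<mu>] n by (simp add: q s_def)
  have s1: "(\<Sum>j=1..n. s j) = 0"
    unfolding s_def dot_sum_right[symmetric] sy by (simp add: dot_def)
  have "(1 - 2 * \<kappa>) * (enorm d \<mu>)\<^sup>2 \<le> q" using S_pos[of \<mu>] q by simp
  also have qle: "q \<le> enorm d \<mu> * enorm d xb" using abs_dot_le[of d \<mu> xb] by (simp add: q_def)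
  finally have "enorm d \<mu> * ((1 - 2 * \<kappa>) * enorm d \<mu>) \<le> enorm d \<mu> * enorm d xb"
    by (simp add: power2_eq_square mult_ac)
  then have \<mu>1: "(1 - 2 * \<kappa>) * enorm d \<mu> \<le> enorm d xb"
    using enorm_nonneg[of d \<mu>] by (cases "enorm d \<mu> = 0") (auto simp: mult_le_cancel_left)
  \<comment> \<open>\<open>1 + 4 * \<kappa>\<close> is a linear bound for the reciprocal of
    \<open>1 - 2 * \<kappa>\<close>, valid because \<open>\<kappa>\<close> is at most 1/8.\<close>
  have \<mu>2: "enorm d \<mu> \<le> (1 + 4 * \<kappa>) * enorm d xb"
  proof -
    have "enorm d \<mu> \<le> ((1 + 4 * \<kappa>) * (1 - 2 * \<kappa>)) * enorm d \<mu>"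
    proof -
      have "\<kappa> * \<kappa> \<le> 1/8 * \<kappa>" using \<kappa> by (intro mult_right_mono) auto
      then have "1 \<le> (1 + 4 * \<kappa>) * (1 - 2 * \<kappa>)" using \<kappa> by (simp add: algebra_simps)
      then show ?thesis using mult_right_mono[of 1 _ "enorm d \<mu>"] by simp
    qed
    also have "... \<le> (1 + 4 * \<kappa>) * enorm d xb"
      unfolding mult.assoc using \<mu>1 \<kappa> by (intro mult_left_mono) auto
    finally show ?thesis .
  qed
  have \<mu>3: "enorm d \<mu> \<le> 2 * enorm d xb"
    using \<mu>2 mult_right_mono[of "1 + 4 * \<kappa>" 2 "enorm d xb"] \<kappa> by simp
  have q1: "real n * q \<le> (1 + 4 * \<kappa>) * N"
  proof -
    have "q \<le> ((1 + 4 * \<kappa>) * enorm d xb) * enorm d xb"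
      using qle mult_right_mono[OF \<mu>2, of "enorm d xb"] by simp
    then have "real n * q \<le> real n * (((1 + 4 * \<kappa>) * enorm d xb) * enorm d xb)"
      by (intro mult_left_mono) auto
    then show ?thesis by (simp add: N_def power2_eq_square mult_ac)
  qed
  have sle: "\<bar>s j\<bar> \<le> 2 * enorm d xb * (enorm d (x j) + enorm d xb)" for j
  proof -
    have "\<bar>s j\<bar> \<le> enorm d \<mu> * enorm d (y j)" unfolding s_def by (rule abs_dot_le)
    also have "... \<le> (2 * enorm d xb) * (enorm d (x j) + enorm d xb)"
      unfolding y_def using \<mu>3 by (intro mult_mono enorm_diff_le) auto
    finally show ?thesis .
  qed
  have sb: "\<bar>s j\<bar> \<le> 1/2" if "j \<in> {1..n}" for j
    using sle[of j] small(1)[OF that] small(2) \<kappa>(2) by (simp add: algebra_simps power2_eq_square)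
  \<comment> \<open>128 is 16, the fourth power of the factor 2, times the 8 of
    \<open>power4_add_le\<close>; bounding both sums of fourth powers by \<open>F\<close> doubles it
    to 256.\<close>
  have "(\<Sum>j=1..n. s j ^ 4) \<le> (\<Sum>j=1..n. 128 * enorm d xb ^ 4 * (enorm d (x j) ^ 4 + enorm d xb ^ 4))"
  proof (rule sum_mono)
    fix j
    have "s j ^ 4 = \<bar>s j\<bar> ^ 4" by simp
    also have "... \<le> (2 * enorm d xb * (enorm d (x j) + enorm d xb)) ^ 4"
      by (intro power_mono sle) simp
    also have "... = 16 * enorm d xb ^ 4 * (enorm d (x j) + enorm d xb) ^ 4"
      by (simp add: power_mult_distrib)
    also have "... \<le> 16 * enorm d xb ^ 4 * (8 * (enorm d (x j) ^ 4 + enorm d xb ^ 4))"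
      by (intro mult_left_mono power4_add_le) auto
    finally show "s j ^ 4 \<le> 128 * enorm d xb ^ 4 * (enorm d (x j) ^ 4 + enorm d xb ^ 4)"
      by (simp add: algebra_simps)
  qed
  also have "... = 128 * enorm d xb ^ 4 * ((\<Sum>j=1..n. enorm d (x j) ^ 4) + real n * enorm d xb ^ 4)"
    by (simp add: sum_distrib_left[symmetric] sum.distrib)
  also have "... \<le> 128 * enorm d xb ^ 4 * (F + F)"
    using F by (intro mult_left_mono add_mono) auto
  finally have s4: "(\<Sum>j=1..n. s j ^ 4) / h \<le> 256 * E"
    using h by (simp add: E_def field_simps)
  define v2 where "v2 = - 2 * (\<Sum>j=1..n. ln (1 - s j))"
  have lo: "ennreal (exp (- v2 / 2)) \<le> emp_lik n d x"
  proof -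
    have "ennreal (exp (\<Sum>j=1..n. ln (1 - s j))) \<le> emp_lik n d x"
    proof (rule emp_lik_ge_weights[OF n _ s1])
      fix j assume "j \<in> {1..n}"
      then show "s j < 1" using sb[of j] by (simp add: abs_le_iff)
    next
      fix i assume i: "i < d"
      have "(\<Sum>j=1..n. s j * x j i) = (\<Sum>j=1..n. y j i * s j) + xb i * (\<Sum>j=1..n. s j)"
        by (simp add: y_def algebra_simps sum.distrib[symmetric] sum_distrib_left)
      also have "... = real n * xb i"
        using \<mu>[OF i] n unfolding S_dot s1 by (simp add: s_def field_simps)
      finally show "(\<Sum>j=1..n. (1 - s j) * x j i) = 0"
        by (simp add: algebra_simps sum_subtractf sx)
    qed
    then show ?thesis by (simp add: v2_def)
  qed
  have "v2 \<le> 2 * (\<Sum>j=1..n. s j) + (\<Sum>j=1..n. (s j)\<^sup>2) + (\<Sum>j=1..n. h * (s j)\<^sup>2 + s j ^ 4 / h)"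
    unfolding v2_def sum_distrib_left sum.distrib[symmetric]
  proof (rule sum_mono)
    fix j assume "j \<in> {1..n}"
    then have "\<bar>- s j\<bar> \<le> 1/2" using sb by simp
    from ln_add_one_ge_cubic[OF this] abs_cube_le_weighted[OF h, of "s j"]
    show "- 2 * ln (1 - s j) \<le> 2 * s j + (s j)\<^sup>2 + (h * (s j)\<^sup>2 + s j ^ 4 / h)" by simp
  qed
  also have "... = (1 + h) * (real n * q) + (\<Sum>j=1..n. s j ^ 4) / h"
    by (simp add: s1 s2 sum.distrib sum_distrib_left[symmetric]
        sum_divide_distrib[symmetric] distrib_right)
  finally have "v2 \<le> (1 + h) * ((1 + 4 * \<kappa>) * N) + 256 * E"
    using s4 mult_left_mono[OF q1, of "1 + h"] h by linarith
  moreover have "h * (\<kappa> * N) \<le> h * (1/4 * N)"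
    using \<kappa> h N0 by (intro mult_left_mono mult_right_mono) auto
  ultimately have upper: "v2 \<le> N + 4 * (\<kappa> * N) + 2 * (h * N) + 256 * E"
    by (simp add: algebra_simps)

  \<comment> \<open>The likelihood lies between two positive reals, so the extended logarithm is an
    ordinary one here.\<close>
  define R where "R = enn2real (emp_lik n d x)"
  have fin: "emp_lik n d x < \<infinity>" using up by (rule le_less_trans) simp
  then have R: "emp_lik n d x = ennreal R" by (simp add: R_def less_top)
  have R1: "R \<le> exp (- v1 / 2)" using up unfolding R by (simp add: R_def ennreal_le_iff)
  have R2: "exp (- v2 / 2) \<le> R" using lo unfolding R by (simp add: R_def ennreal_le_iff)
  have R0: "0 < R" using R2 by (rule less_le_trans[rotated]) simp
  have "ext_ln (emp_lik n d x) = ereal (ln R)"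
    using R0 by (simp add: ext_ln_def R)
  then have 1: "- 2 * ext_ln (emp_lik n d x) = ereal (- 2 * ln R)" by simp
  have "ln R \<le> - v1 / 2" using R0 R1 by (metis exp_gt_zero ln_exp ln_le_cancel_iff)
  moreover have "- v2 / 2 \<le> ln R" using R0 R2 by (metis exp_gt_zero ln_exp ln_le_cancel_iff)
  ultimately have "\<bar>- 2 * ln R - N\<bar> \<le> (4 * \<kappa> + 2 * h) * N + 256 * E"
    using lower upper E0 by (simp add: abs_le_iff algebra_simps)
  with 1 show thesis using that by (simp add: N_def E_def)
qed

declare One_nat_def [simp]


section \<open>Measurability of the empirical likelihood\<close>

text \<open>Penalising the constraint turns the supremum into one over a countable set, hence a measurable
  function of the data.\<close>

lemma SUP_constrained_eq_INF_SUP: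
  fixes P T :: "'p::metric_space set" and F G :: "'p \<Rightarrow> real"
  assumes P: "compact P" and T: "T \<subseteq> P" "P \<subseteq> closure T"
    and F: "continuous_on P F" and G: "continuous_on P G" "\<And>\<pi>. \<pi> \<in> P \<Longrightarrow> 0 \<le> G \<pi>"
  shows "(SUP \<pi>\<in>{\<pi>\<in>P. G \<pi> = 0}. ennreal (F \<pi>)) = (INF K::nat. SUP \<pi>\<in>T. ennreal (F \<pi> - real K * G \<pi>))"
    (is "?s = ?I")
proof (rule antisym)
  show "?s \<le> ?I"
  proof (intro INF_greatest SUP_least)
    fix K :: nat and \<pi> assume \<pi>: "\<pi> \<in> {\<pi>\<in>P. G \<pi> = 0}"
    then obtain t where t: "\<And>k. t k \<in> T" "t \<longlonglongrightarrow> \<pi>"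
      using T(2) by (auto simp: subset_eq closure_sequential)
    have "continuous_on P (\<lambda>\<pi>. F \<pi> - real K * G \<pi>)"
      by (intro continuous_intros F G)
    then have "(\<lambda>k. F (t k) - real K * G (t k)) \<longlonglongrightarrow> F \<pi> - real K * G \<pi>"
      by (rule continuous_on_tendsto_compose) (use t T \<pi> in \<open>auto intro!: always_eventually\<close>)
    then have "(\<lambda>k. ennreal (F (t k) - real K * G (t k))) \<longlonglongrightarrow> ennreal (F \<pi> - real K * G \<pi>)"
      by (rule tendsto_ennrealI)
    then have "ennreal (F \<pi> - real K * G \<pi>) \<le> (SUP \<pi>\<in>T. ennreal (F \<pi> - real K * G \<pi>))"
      by (rule LIMSEQ_le_const2) (auto intro!: SUP_upper t)
    then show "ennreal (F \<pi>) \<le> (SUP \<pi>\<in>T. ennreal (F \<pi> - real K * G \<pi>))"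
      using \<pi> by simp
  qed
next
  show "?I \<le> ?s"
  proof (rule ccontr)
    assume "\<not> ?I \<le> ?s"
    \<comment> \<open>A value strictly between the two sides provides near-maximisers
      \<open>p K\<close> of the penalised objectives; a limit point of them will be feasible with
      value at least \<open>c\<close>.\<close>
    then obtain c where c: "?s < c" "c < ?I" using dense[of ?s ?I] by (auto simp: not_le)
    have "c < top" by (rule less_le_trans[OF c(2) top_greatest])
    then obtain c' where c': "c = ennreal c'" "0 \<le> c'" by (cases c) auto
    have "\<exists>\<pi>\<in>T. c < ennreal (F \<pi> - real K * G \<pi>)" for K :: nat
      using less_le_trans[OF c(2) INF_lower[of K]] by (simp add: less_SUP_iff)
    then obtain p where p: "\<And>K. p K \<in> T" "\<And>K. c < ennreal (F (p K) - real K * G (p K))" by metis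
    have p': "c' < F (p K) - real K * G (p K)" for K
      using p(2)[of K] c' by (simp add: ennreal_less_iff)
    have pP: "p k \<in> P" for k using p(1) T(1) by auto
    obtain \<pi> r where r: "\<pi> \<in> P" "strict_mono (r :: nat \<Rightarrow> nat)" "(p \<circ> r) \<longlonglongrightarrow> \<pi>"
      using P pP unfolding compact_eq_seq_compact_metric seq_compact_def by metis
    obtain B where B: "\<And>\<pi>. \<pi> \<in> P \<Longrightarrow> \<bar>F \<pi>\<bar> \<le> B"
      using compact_imp_bounded[OF compact_continuous_image[OF F P]] by (auto simp: bounded_iff)
    have r3: "(\<lambda>k. p (r k)) \<longlonglongrightarrow> \<pi>" using r(3) by (simp add: comp_def)
    have F\<pi>: "(\<lambda>k. F (p (r k))) \<longlonglongrightarrow> F \<pi>" and G\<pi>: "(\<lambda>k. G (p (r k))) \<longlonglongrightarrow> G \<pi>"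
      by (rule continuous_on_tendsto_compose[OF F r3] continuous_on_tendsto_compose[OF G(1) r3];
          use r(1) pP in simp)+
    have "c' \<le> F \<pi>"
    proof (rule LIMSEQ_le_const[OF F\<pi>], intro exI allI impI)
      fix k
      have "0 \<le> real (r k) * G (p (r k))" using G(2) pP by simp
      then show "c' \<le> F (p (r k))" using p'[of "r k"] by linarith
    qed
    \<comment> \<open>As \<open>F\<close> is bounded, staying above a nonnegative level under
      penalty weight \<open>r k\<close>, which is at least \<open>k\<close>, forces the constraint
      violation below \<open>B / k\<close>.\<close>
    moreover have "G \<pi> \<le> 0"
    proof (rule LIMSEQ_le[OF G\<pi>])
      show "(\<lambda>k. B / real k) \<longlonglongrightarrow> 0" by (rule lim_const_over_n)
      show "\<exists>N. \<forall>k\<ge>N. G (p (r k)) \<le> B / real k"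
      proof (intro exI[of _ 1] allI impI)
        fix k :: nat assume k: "1 \<le> k"
        have "real k * G (p (r k)) \<le> real (r k) * G (p (r k))"
          using seq_suble[OF r(2), of k] G(2) pP by (intro mult_right_mono) auto
        also have "... \<le> B" using p'[of "r k"] B[OF pP, of "r k"] c'(2) by linarith
        finally show "G (p (r k)) \<le> B / real k" using k by (simp add: field_simps)
      qed
    qed
    ultimately have "c \<le> ennreal (F \<pi>)" "G \<pi> = 0"
      using G(2)[OF r(1)] c' by (auto intro: ennreal_leI)
    moreover have "ennreal (F \<pi>) \<le> ?s" using r(1) \<open>G \<pi> = 0\<close> by (intro SUP_upper) auto
    ultimately show False using c(1) by (meson leD le_less_trans)
  qed
qed

text \<open>Weights are extensional functions on all of the naturals. Allowing only the point
  \<open>undefined\<close> outside \<open>{1..n}\<close> makes the cube a full product of compact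
  sets, so Tychonoff's theorem applies.\<close>

lemma compact_prob_weights: "compact (prob_weights n)"
proof -
  define S where "S i = (if i \<in> {1..n} then {0..1} else {undefined :: real})" for i
  have "compactin (product_topology (\<lambda>_::nat. euclidean :: real topology) UNIV) (Pi\<^sub>E UNIV S)"
    unfolding compactin_PiE by (auto simp: S_def)
  then have "compact (Pi\<^sub>E UNIV S)" by (simp add: euclidean_product_topology)
  moreover have "closed {\<pi> :: nat \<Rightarrow> real. (\<Sum>j=1..n. \<pi> j) = 1}"
    by (intro closed_Collect_eq continuous_intros continuous_on_product_coordinates)
  ultimately have "compact (Pi\<^sub>E UNIV S \<inter> {\<pi>. (\<Sum>j=1..n. \<pi> j) = 1})" by (rule compact_Int_closed)
  moreover have "Pi\<^sub>E UNIV S = ({1..n} \<rightarrow>\<^sub>E {0..1})"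
    by (auto simp: S_def PiE_def Pi_def extensional_def split: if_splits)
  ultimately show ?thesis by (simp add: prob_weights_def Int_def)
qed

text \<open>The dense countable set \<open>T\<close> of weights is the same for all sample points,
  and for each fixed weight vector the penalised objective is a measurable function of the data;
  only countable suprema and infima remain.\<close>

lemma emp_lik_measurable:
  assumes [measurable]: "\<And>j i. j \<in> {1..n} \<Longrightarrow> i < d \<Longrightarrow> (\<lambda>\<omega>. x \<omega> j i) \<in> borel_measurable M"
  shows "(\<lambda>\<omega>. emp_lik n d (x \<omega>)) \<in> borel_measurable M"
proof -
  define P where "P = prob_weights n"
  define F where "F \<pi> = (\<Prod>j=1..n. real n * \<pi> j)" for \<pi> :: "nat \<Rightarrow> real"
  define G where "G \<omega> \<pi> = (\<Sum>i<d. \<bar>\<Sum>j=1..n. \<pi> j * x \<omega> j i\<bar>)" for \<omega> and \<pi> :: "nat \<Rightarrow> real"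
  obtain T where T: "countable T" "T \<subseteq> P" "P \<subseteq> closure T" using separable[of P] by metis
  have coord: "continuous_on P (\<lambda>\<pi>. \<pi> j)" for j
    by (rule continuous_on_subset[OF continuous_on_product_coordinates]) simp
  have "emp_lik n d (x \<omega>) = (INF K::nat. SUP \<pi>\<in>T. ennreal (F \<pi> - real K * G \<omega> \<pi>))" for \<omega>
  proof -
    have "G \<omega> \<pi> = 0 \<longleftrightarrow> (\<forall>i<d. (\<Sum>j=1..n. \<pi> j * x \<omega> j i) = 0)" for \<pi>
      unfolding G_def by (subst sum_nonneg_eq_0_iff) auto
    then have "emp_lik n d (x \<omega>) = (SUP \<pi>\<in>{\<pi>\<in>P. G \<omega> \<pi> = 0}. ennreal (F \<pi>))"
      by (simp add: emp_lik_def P_def F_def)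
    also have "... = (INF K::nat. SUP \<pi>\<in>T. ennreal (F \<pi> - real K * G \<omega> \<pi>))"
    proof (rule SUP_constrained_eq_INF_SUP)
      show "compact P" unfolding P_def by (rule compact_prob_weights)
      show "continuous_on P F" unfolding F_def by (intro continuous_intros coord)
      show "continuous_on P (G \<omega>)" unfolding G_def by (intro continuous_intros coord)
    qed (use T in \<open>auto simp: G_def sum_nonneg\<close>)
    finally show ?thesis .
  qed
  moreover have [measurable]: "(\<lambda>\<omega>. G \<omega> \<pi>) \<in> borel_measurable M" for \<pi>
    unfolding G_def by measurable
  then have "(\<lambda>\<omega>. INF K::nat. SUP \<pi>\<in>T. ennreal (F \<pi> - real K * G \<omega> \<pi>)) \<in> borel_measurable M"
    using T(1) by measurable
  ultimately show ?thesis by simp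
qed

lemma ext_ln_measurable [measurable]: "ext_ln \<in> borel_measurable borel"
  unfolding ext_ln_def by measurable


section \<open>Isotropic laws and one-step estimates\<close>

text \<open>Integrability is listed next to each integral because the integral of a non-integrable
  function is 0 by convention, which would pass for a zero mean.\<close>

definition isotropic :: "nat \<Rightarrow> (nat \<Rightarrow> real) measure \<Rightarrow> bool" where
  "isotropic d \<nu> \<longleftrightarrow> prob_space \<nu> \<and> sets \<nu> = sets (PiM {..<d} (\<lambda>_. borel)) \<and>
     (\<forall>i<d. integrable \<nu> (\<lambda>y. y i) \<and> (\<integral>y. y i \<partial>\<nu>) = 0) \<and>
     (\<forall>i<d. \<forall>j<d. integrable \<nu> (\<lambda>y. y i * y j) \<and> (\<integral>y. y i * y j \<partial>\<nu>) = (if i = j then 1 else 0))"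

lemma isotropic_prob_space: "isotropic d \<nu> \<Longrightarrow> prob_space \<nu>"
  by (simp add: isotropic_def)

lemma isotropic_coord_measurable:
  assumes "isotropic d \<nu>" "i < d"
  shows "(\<lambda>y. y i) \<in> borel_measurable \<nu>"
proof -
  have "(\<lambda>y. y i) \<in> borel_measurable (PiM {..<d} (\<lambda>_. borel))"
    using assms(2) by (intro measurable_component_singleton) auto
  then show ?thesis using assms(1) by (simp add: isotropic_def cong: measurable_cong_sets)
qed

lemma isotropic_dot_measurable:
  assumes "isotropic d \<nu>"
  shows "dot d u \<in> borel_measurable \<nu>"
  unfolding dot_def[abs_def] using isotropic_coord_measurable[OF assms] by measurable

lemma isotropic_enorm_measurable:
  assumes "isotropic d \<nu>"
  shows "enorm d \<in> borel_measurable \<nu>"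
  using enorm_measurable[of d "\<lambda>y. y" \<nu>] isotropic_coord_measurable[OF assms] by simp

lemma isotropic_dot:
  assumes "isotropic d \<nu>"
  shows "integrable \<nu> (dot d u)" "(\<integral>y. dot d u y \<partial>\<nu>) = 0"
  using assms unfolding dot_def[abs_def] isotropic_def
  by (auto simp: Bochner_Integration.integral_sum)

lemma integral_double_sum:
  fixes f :: "nat \<Rightarrow> nat \<Rightarrow> 'b \<Rightarrow> real"
  assumes "\<And>i j. i < d \<Longrightarrow> j < d \<Longrightarrow> integrable N (f i j)"
  shows "integrable N (\<lambda>x. \<Sum>i<d. \<Sum>j<d. f i j x)"
    and "(\<integral>x. (\<Sum>i<d. \<Sum>j<d. f i j x) \<partial>N) = (\<Sum>i<d. \<Sum>j<d. \<integral>x. f i j x \<partial>N)"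
proof -
  show "integrable N (\<lambda>x. \<Sum>i<d. \<Sum>j<d. f i j x)"
    by (intro Bochner_Integration.integrable_sum assms) auto
  have "(\<integral>x. (\<Sum>i<d. \<Sum>j<d. f i j x) \<partial>N) = (\<Sum>i<d. \<integral>x. (\<Sum>j<d. f i j x) \<partial>N)"
    by (intro Bochner_Integration.integral_sum Bochner_Integration.integrable_sum assms) auto
  also have "... = (\<Sum>i<d. \<Sum>j<d. \<integral>x. f i j x \<partial>N)"
    by (intro sum.cong refl Bochner_Integration.integral_sum assms) auto
  finally show "(\<integral>x. (\<Sum>i<d. \<Sum>j<d. f i j x) \<partial>N) = (\<Sum>i<d. \<Sum>j<d. \<integral>x. f i j x \<partial>N)" .
qed

lemma isotropic_dot_sq:
  assumes "isotropic d \<nu>"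
  shows "integrable \<nu> (\<lambda>y. (dot d u y)\<^sup>2)" "(\<integral>y. (dot d u y)\<^sup>2 \<partial>\<nu>) = (enorm d u)\<^sup>2"
proof -
  have eq: "(dot d u y)\<^sup>2 = (\<Sum>i<d. \<Sum>j<d. (u i * u j) * (y i * y j))" for y
    by (simp add: dot_def power2_eq_square sum_product mult_ac)
  have int: "integrable \<nu> (\<lambda>y. (u i * u j) * (y i * y j))" if "i < d" "j < d" for i j
    using assms that by (auto simp: isotropic_def)
  show "integrable \<nu> (\<lambda>y. (dot d u y)\<^sup>2)"
    unfolding eq by (rule integral_double_sum(1)[OF int])
  have "(\<integral>y. (dot d u y)\<^sup>2 \<partial>\<nu>) = (\<Sum>i<d. \<Sum>j<d. \<integral>y. (u i * u j) * (y i * y j) \<partial>\<nu>)"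
    unfolding eq by (rule integral_double_sum(2)[OF int])
  also have "... = (\<Sum>i<d. \<Sum>j<d. (u i * u j) * (\<integral>y. y i * y j \<partial>\<nu>))"
    by simp
  also have "... = (\<Sum>i<d. \<Sum>j<d. if i = j then u i * u j else 0)"
    using assms by (intro sum.cong) (auto simp: isotropic_def)
  also have "... = (enorm d u)\<^sup>2"
    unfolding enorm_sq by (simp add: power2_eq_square)
  finally show "(\<integral>y. (dot d u y)\<^sup>2 \<partial>\<nu>) = (enorm d u)\<^sup>2" .
qed

lemma isotropic_enorm_sq:
  assumes "isotropic d \<nu>"
  shows "integrable \<nu> (\<lambda>y. (enorm d y)\<^sup>2)" "(\<integral>y. (enorm d y)\<^sup>2 \<partial>\<nu>) = real d"
  using assms unfolding enorm_sq isotropic_def unfolding power2_eq_square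
  by (auto simp: Bochner_Integration.integral_sum)

section \<open>Moment growth when an independent centred vector is added\<close>

lemma powr_one_plus_le_quadratic:
  fixes p t :: real
  assumes "1 \<le> p" "p \<le> 2" "-1 \<le> t"
  shows "(1 + t) powr p \<le> 1 + p * t + (p - 1) * t\<^sup>2"
proof (cases "t = -1")
  case True
  then show ?thesis by simp
next
  case False
  then have t: "0 < 1 + t" using assms by simp
  \<comment> \<open>Bernoulli's inequality for the exponent \<open>p - 1\<close> between 0 and 1;
    multiplying by \<open>1 + t\<close> gives the quadratic bound.\<close>
  have "(1 + t) powr (p - 1) \<le> 1 + (p - 1) * t"
    using Youngs_inequality_0[of "p - 1" "2 - p" "1 + t" 1] assms t by (simp add: algebra_simps)
  then have "(1 + t) * (1 + t) powr (p - 1) \<le> (1 + t) * (1 + (p - 1) * t)"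
    using t by (intro mult_left_mono) auto
  also have "(1 + t) * (1 + t) powr (p - 1) = (1 + t) powr p"
    using t by (simp add: powr_mult_base)
  finally show ?thesis by (simp add: algebra_simps power2_eq_square)
qed

lemma powr_split_sq:
  fixes e q :: real
  assumes "0 \<le> e" "q > 2"
  shows "e powr q = e powr (q - 2) * e\<^sup>2"
proof (cases "e = 0")
  case False
  have "e powr q = e powr (q - 2) * e powr 2" by (subst powr_add[symmetric]) simp
  then show ?thesis using assms False by simp
qed simp

text \<open>The first-order term is kept since it integrates to zero against a centred law; this makes the
  moments of sums grow at the rate of the central limit theorem.\<close>

lemma enorm_add_powr_le:
  assumes q: "2 < q" "q \<le> 3"
  shows "enorm d (\<lambda>i. a i + b i) powr q \<le>
    enorm d a powr q + q * enorm d a powr (q - 2) * dot d a b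
      + 11 * (enorm d a powr (q - 2) * (enorm d b)\<^sup>2 + enorm d b powr q)"
proof -
  define e f g where "e = enorm d a" and "f = enorm d b" and "g = dot d a b"
  have ef: "0 \<le> e" "0 \<le> f" "\<bar>g\<bar> \<le> e * f" using abs_dot_le by (auto simp: e_def f_def g_def)
  have s2: "(enorm d (\<lambda>i. a i + b i))\<^sup>2 = e\<^sup>2 + 2 * g + f\<^sup>2"
    by (simp add: enorm_add_sq e_def f_def g_def)
  show ?thesis
  proof (cases "e < f \<or> e = 0")
    \<comment> \<open>When \<open>b\<close> dominates, everything is a multiple of |b|^q: 8 bounds
      2^q and 3 bounds the first-order term, together 11.\<close>
    case True
    then have "e \<le> f" using ef by auto
    have "enorm d (\<lambda>i. a i + b i) powr q \<le> (2 * f) powr q"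
      using enorm_triangle[of d a b] \<open>e \<le> f\<close> q by (intro powr_mono2) (auto simp: e_def f_def)
    also have "... = 2 powr q * f powr q" using ef by (simp add: powr_mult)
    also have "... \<le> 2 powr 3 * f powr q" using q by (intro mult_right_mono powr_mono) auto
    finally have 1: "enorm d (\<lambda>i. a i + b i) powr q \<le> 8 * f powr q" by simp
    have "q * e powr (q - 2) * \<bar>g\<bar> \<le> 3 * f powr (q - 2) * f\<^sup>2"
    proof (intro mult_mono)
      show "e powr (q - 2) \<le> f powr (q - 2)" using \<open>e \<le> f\<close> ef q by (intro powr_mono2) auto
      have "\<bar>g\<bar> \<le> e * f" using ef by simp
      also have "... \<le> f * f" using \<open>e \<le> f\<close> ef by (intro mult_right_mono) auto
      finally show "\<bar>g\<bar> \<le> f\<^sup>2" by (simp add: power2_eq_square)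
    qed (use q in auto)
    also have "... = 3 * f powr q" using powr_split_sq[of f q] ef q by simp
    finally have "q * e powr (q - 2) * \<bar>g\<bar> \<le> 3 * f powr q" .
    moreover have "- (q * e powr (q - 2) * g) \<le> q * e powr (q - 2) * \<bar>g\<bar>"
      using mult_left_mono[of "- g" "\<bar>g\<bar>" "q * e powr (q - 2)"] q by simp
    ultimately have 2: "- (q * e powr (q - 2) * g) \<le> 3 * f powr q" by linarith
    have "0 \<le> e powr q" "0 \<le> e powr (q - 2) * f\<^sup>2" by auto
    with 1 2 have "enorm d (\<lambda>i. a i + b i) powr q \<le>
      e powr q + q * e powr (q - 2) * g + (11 * (e powr (q - 2) * f\<^sup>2) + 11 * f powr q)" by linarith
    then show ?thesis by (simp add: e_def f_def g_def distrib_left)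
  next
    case False
    then have e: "0 < e" "f \<le> e" using ef by auto
    \<comment> \<open>When \<open>a\<close> dominates, |a + b|^2 is |a|^2 (1 + t), and the power
      q/2, which lies between 1 and 3/2, is expanded to second order in \<open>t\<close>.\<close>
    define v where "v = 2 * g + f\<^sup>2"
    define t where "t = v / e\<^sup>2"
    have "0 \<le> e\<^sup>2 + v" using s2 zero_le_power2[of "enorm d (\<lambda>i. a i + b i)"] by (simp add: v_def)
    then have t: "-1 \<le> t" using e by (simp add: t_def field_simps)
    have f2: "f\<^sup>2 \<le> e * f" using e ef by (simp add: power2_eq_square mult_right_mono)
    have "\<bar>v\<bar> \<le> 3 * (e * f)" using ef f2 zero_le_power2[of f] unfolding v_def abs_le_iff by linarith
    then have "v\<^sup>2 \<le> (3 * (e * f))\<^sup>2" by (metis abs_ge_zero power2_abs power_mono)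
    then have v2: "e\<^sup>2 * t\<^sup>2 \<le> 9 * f\<^sup>2"
      using e by (simp add: t_def power_mult_distrib power2_eq_square field_simps)
    have et: "e\<^sup>2 * t = v" using e by (simp add: t_def)
    have "enorm d (\<lambda>i. a i + b i) powr q = ((enorm d (\<lambda>i. a i + b i))\<^sup>2) powr (q / 2)"
      by (simp add: powr_powr powr_numeral[symmetric] del: powr_numeral)
    also have "... = (e\<^sup>2 * (1 + t)) powr (q / 2)"
      unfolding s2 using et by (simp add: v_def algebra_simps)
    also have "... = e powr q * (1 + t) powr (q / 2)"
      using e t by (simp add: powr_mult powr_powr powr_numeral[symmetric] del: powr_numeral)
    also have "... \<le> e powr q * (1 + q / 2 * t + (q / 2 - 1) * t\<^sup>2)"
      using q t by (intro mult_left_mono powr_one_plus_le_quadratic) auto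
    also have "... = e powr q + e powr (q - 2) * (q / 2 * (e\<^sup>2 * t) + (q / 2 - 1) * (e\<^sup>2 * t\<^sup>2))"
      unfolding powr_split_sq[of e q, OF ef(1) q(1)] by (simp add: algebra_simps)
    also have "... \<le> e powr q + e powr (q - 2) * (q * g + 11 * f\<^sup>2)"
    proof (intro add_left_mono mult_left_mono)
      have "(q / 2 - 1) * (e\<^sup>2 * t\<^sup>2) \<le> (1/2) * (9 * f\<^sup>2)"
        by (rule mult_mono[OF _ v2]) (use q in auto)
      moreover have "q / 2 * f\<^sup>2 \<le> (3/2) * f\<^sup>2" using q by (intro mult_right_mono) auto
      moreover have "q / 2 * (e\<^sup>2 * t) = q * g + q / 2 * f\<^sup>2" unfolding et v_def by (simp add: algebra_simps)
      moreover have "0 \<le> f\<^sup>2" by simp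
      ultimately show "q / 2 * (e\<^sup>2 * t) + (q / 2 - 1) * (e\<^sup>2 * t\<^sup>2) \<le> q * g + 11 * f\<^sup>2" by linarith
    qed simp
    also have "... \<le> e powr q + q * e powr (q - 2) * g + 11 * (e powr (q - 2) * f\<^sup>2 + f powr q)"
      by (simp add: algebra_simps)
    finally show ?thesis unfolding e_def f_def g_def .
  qed
qed

text \<open>The first-order term of \<open>enorm_add_powr_le\<close> integrates to 0 because the law
  is centred, and the squared norm integrates to \<open>d\<close>. With a nonnegative integral on
  the left, the bound can be iterated over the summands without integrability proofs.\<close>

lemma isotropic_moment_step:
  assumes \<nu>: "isotropic d \<nu>" and q: "2 < q" "q \<le> 3"
    and K: "integrable \<nu> (\<lambda>y. enorm d y powr q)" "(\<integral>y. enorm d y powr q \<partial>\<nu>) \<le> K"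
  shows "(\<integral>\<^sup>+y. ennreal (enorm d (\<lambda>i. a i + y i) powr q) \<partial>\<nu>)
     \<le> ennreal (enorm d a powr q + 11 * (enorm d a powr (q - 2) * real d + K))"
proof -
  interpret prob_space \<nu> using \<nu> by (rule isotropic_prob_space)
  define g where "g y = enorm d a powr q + q * enorm d a powr (q - 2) * dot d a y
      + 11 * (enorm d a powr (q - 2) * (enorm d y)\<^sup>2 + enorm d y powr q)" for y
  have g: "enorm d (\<lambda>i. a i + y i) powr q \<le> g y" for y
    unfolding g_def by (rule enorm_add_powr_le[OF q])
  have int: "integrable \<nu> g" unfolding g_def
    using isotropic_dot(1)[OF \<nu>, of a] isotropic_enorm_sq(1)[OF \<nu>] K(1) by auto
  have "(\<integral>y. g y \<partial>\<nu>) = enorm d a powr q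
      + 11 * (enorm d a powr (q - 2) * real d + (\<integral>y. enorm d y powr q \<partial>\<nu>))"
    unfolding g_def
    using isotropic_dot[OF \<nu>, of a] isotropic_enorm_sq[OF \<nu>] K(1) by (simp add: prob_space)
  also have "... \<le> enorm d a powr q + 11 * (enorm d a powr (q - 2) * real d + K)"
    using K(2) by simp
  finally have le: "(\<integral>y. g y \<partial>\<nu>) \<le> enorm d a powr q + 11 * (enorm d a powr (q - 2) * real d + K)" .
  have "(\<integral>\<^sup>+y. ennreal (enorm d (\<lambda>i. a i + y i) powr q) \<partial>\<nu>) \<le> (\<integral>\<^sup>+y. ennreal (g y) \<partial>\<nu>)"
    by (intro nn_integral_mono ennreal_leI g)
  also have "... = ennreal (\<integral>y. g y \<partial>\<nu>)"
    by (intro nn_integral_eq_integral int AE_I2) (rule order_trans[OF _ g], simp)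
  finally show ?thesis using ennreal_leI[OF le] by (rule order_trans)
qed

section \<open>Second-order expansion of characteristic functions\<close>

lemma iexp_second_order:
  fixes x q :: real
  assumes "2 < q" "q \<le> 3"
  shows "cmod (iexp x - (1 + \<i> * x - x\<^sup>2 / 2)) \<le> \<bar>x\<bar> powr q"
proof -
  have s: "(\<Sum>k\<le>2. (\<i> * complex_of_real x) ^ k / fact k) = 1 + \<i> * x - x\<^sup>2 / 2"
    by (simp add: numeral_2_eq_2 power2_eq_square algebra_simps)
  \<comment> \<open>The cubic Taylor remainder is used for small arguments and the quadratic one for
    large arguments; in its own range each is at most |x|^q.\<close>
  show ?thesis
  proof (cases "\<bar>x\<bar> \<le> 1")
    case True
    have "cmod (iexp x - (1 + \<i> * x - x\<^sup>2 / 2)) \<le> \<bar>x\<bar> ^ 3 / 6"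
      using iexp_approx1[of x 2] unfolding s by (simp add: eval_nat_numeral)
    also have "... \<le> \<bar>x\<bar> ^ 3" by simp
    also have "... \<le> \<bar>x\<bar> powr q"
      using True assms powr_mono'[of q 3 "\<bar>x\<bar>"] by (cases "x = 0") (simp_all add: powr_numeral)
    finally show ?thesis .
  next
    case False
    have "cmod (iexp x - (1 + \<i> * x - x\<^sup>2 / 2)) \<le> 2 * \<bar>x\<bar> ^ 2 / 2"
      using iexp_approx2[of x 2] unfolding s by (simp add: eval_nat_numeral)
    also have "... = \<bar>x\<bar> powr 2" using False by (simp add: powr_numeral)
    also have "... \<le> \<bar>x\<bar> powr q" using False assms by (intro powr_mono) auto
    finally show ?thesis .
  qed
qed

text \<open>The main term depends on \<open>\<nu>\<close> only through mean and covariance, which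
  all isotropic laws share. This makes two such laws interchangeable up to an error of order
  \<open>q\<close>.\<close>

lemma isotropic_char_step:
  fixes a \<theta> q K :: real
  assumes \<nu>: "isotropic d \<nu>" and q: "2 < q" "q \<le> 3"
    and K: "integrable \<nu> (\<lambda>y. enorm d y powr q)" "(\<integral>y. enorm d y powr q \<partial>\<nu>) \<le> K"
  shows "cmod ((\<integral>y. iexp (a + \<theta> * dot d R y) \<partial>\<nu>) - iexp a * (1 - (\<theta>\<^sup>2 * (enorm d R)\<^sup>2 / 2 :: real)))
     \<le> (\<bar>\<theta>\<bar> * enorm d R) powr q * K"
proof -
  interpret prob_space \<nu> using \<nu> by (rule isotropic_prob_space)
  note [measurable] = isotropic_dot_measurable[OF \<nu>]
  define x where "x y = \<theta> * dot d R y" for y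
  define h where "h y = 1 + \<i> * x y - complex_of_real ((x y)\<^sup>2 / 2)" for y
  have x1: "integrable \<nu> x" "(\<integral>y. x y \<partial>\<nu>) = 0"
    unfolding x_def using isotropic_dot[OF \<nu>, of R] by auto
  have x2: "integrable \<nu> (\<lambda>y. (x y)\<^sup>2)" "(\<integral>y. (x y)\<^sup>2 \<partial>\<nu>) = \<theta>\<^sup>2 * (enorm d R)\<^sup>2"
    unfolding x_def power_mult_distrib using isotropic_dot_sq[OF \<nu>, of R] by auto
  have x_meas[measurable]: "x \<in> borel_measurable \<nu>" unfolding x_def by measurable
  have int_h: "integrable \<nu> h"
    unfolding h_def using x1(1) x2(1) by (intro Bochner_Integration.integrable_diff
      Bochner_Integration.integrable_add integrable_mult_right integrable_of_real) auto
  have z: "integrable \<nu> (\<lambda>y. (x y)\<^sup>2 / 2)" using x2(1) by simp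
  have "(\<integral>y. h y \<partial>\<nu>) = (\<integral>y. 1 + \<i> * complex_of_real (x y) \<partial>\<nu>) - (\<integral>y. complex_of_real ((x y)\<^sup>2 / 2) \<partial>\<nu>)"
    unfolding h_def using x1(1)
    by (intro Bochner_Integration.integral_diff integrable_of_real[OF z]) (auto intro!: integrable_of_real)
  also have "(\<integral>y. 1 + \<i> * complex_of_real (x y) \<partial>\<nu>) = 1 + \<i> * (\<integral>y. x y \<partial>\<nu>)"
    using x1(1) by (subst Bochner_Integration.integral_add) (auto simp: prob_space)
  also have "(\<integral>y. complex_of_real ((x y)\<^sup>2 / 2) \<partial>\<nu>) = complex_of_real (\<integral>y. (x y)\<^sup>2 / 2 \<partial>\<nu>)"
    by (rule integral_complex_of_real)
  finally have "(\<integral>y. h y \<partial>\<nu>) = 1 + \<i> * (\<integral>y. x y \<partial>\<nu>) - complex_of_real (\<integral>y. (x y)\<^sup>2 / 2 \<partial>\<nu>)" .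
  then have h1: "(\<integral>y. h y \<partial>\<nu>) = 1 - (\<theta>\<^sup>2 * (enorm d R)\<^sup>2 / 2 :: real)"
    using x1 x2 by simp
  have int_e: "integrable \<nu> (\<lambda>y. iexp (x y))"
    by (rule integrable_const_bound[where B=1]) auto
  have "(\<integral>y. iexp (a + \<theta> * dot d R y) \<partial>\<nu>) = iexp a * (\<integral>y. iexp (x y) \<partial>\<nu>)"
    by (simp add: x_def exp_add distrib_left integral_mult_right_zero[symmetric] del: integral_mult_right_zero)
  then have "cmod ((\<integral>y. iexp (a + \<theta> * dot d R y) \<partial>\<nu>) - iexp a * (1 - (\<theta>\<^sup>2 * (enorm d R)\<^sup>2 / 2 :: real)))
     = cmod (iexp a * ((\<integral>y. iexp (x y) \<partial>\<nu>) - (\<integral>y. h y \<partial>\<nu>)))"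
    unfolding h1 by (simp add: algebra_simps)
  also have "... = cmod (\<integral>y. iexp (x y) - h y \<partial>\<nu>)"
    using int_e int_h by (simp add: norm_mult)
  also have "... \<le> (\<integral>y. (\<bar>\<theta>\<bar> * enorm d R) powr q * enorm d y powr q \<partial>\<nu>)"
  proof (rule order_trans[OF integral_norm_bound integral_mono])
    fix y
    have "cmod (iexp (x y) - h y) \<le> \<bar>x y\<bar> powr q"
      unfolding h_def using iexp_second_order[OF q, of "x y"] by simp
    also have "... \<le> (\<bar>\<theta>\<bar> * (enorm d R * enorm d y)) powr q"
      unfolding x_def abs_mult using q by (intro powr_mono2 mult_left_mono abs_dot_le) auto
    also have "... = (\<bar>\<theta>\<bar> * enorm d R) powr q * enorm d y powr q"
      by (simp add: powr_mult mult.assoc)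
    finally show "cmod (iexp (x y) - h y) \<le> (\<bar>\<theta>\<bar> * enorm d R) powr q * enorm d y powr q" .
  qed (use int_e int_h K(1) in auto)
  also have "... \<le> (\<bar>\<theta>\<bar> * enorm d R) powr q * K"
    using K by (auto intro: mult_left_mono)
  finally show ?thesis .
qed


section \<open>Replacing the summands one at a time\<close>

definition psum :: "nat set \<Rightarrow> (nat \<Rightarrow> nat \<Rightarrow> real) \<Rightarrow> nat \<Rightarrow> real" where
  "psum I \<xi> = (\<lambda>i. \<Sum>k\<in>I. \<xi> k i)"

text \<open>For finite \<open>I\<close> this is the sum of the inner products of
  \<open>\<xi> k\<close> and \<open>\<xi> l\<close> over ordered pairs of distinct indices, a
  degenerate quadratic form in the vectors.\<close>

definition offdiag :: "nat \<Rightarrow> nat set \<Rightarrow> (nat \<Rightarrow> nat \<Rightarrow> real) \<Rightarrow> real" where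
  "offdiag d I \<xi> = (enorm d (psum I \<xi>))\<^sup>2 - (\<Sum>k\<in>I. (enorm d (\<xi> k))\<^sup>2)"

lemma psum_insert_upd:
  assumes "finite I" "k \<notin> I"
  shows "psum (insert k I) (\<xi>(k := y)) = (\<lambda>i. psum I \<xi> i + y i)"
proof
  fix i
  have "(\<Sum>l\<in>I. (\<xi>(k := y)) l i) = (\<Sum>l\<in>I. \<xi> l i)" using assms by (intro sum.cong) auto
  then show "psum (insert k I) (\<xi>(k := y)) i = psum I \<xi> i + y i"
    using assms by (simp add: psum_def)
qed

text \<open>The squared norm of \<open>y\<close> inside the norm of the sum cancels against its
  diagonal term, so a new summand enters linearly. One replacement step therefore only involves a
  linear form in \<open>y\<close>.\<close>

lemma offdiag_insert_upd:
  assumes "finite I" "k \<notin> I"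
  shows "offdiag d (insert k I) (\<xi>(k := y)) = offdiag d I \<xi> + 2 * dot d (psum I \<xi>) y"
proof -
  have "(\<Sum>l\<in>I. (enorm d ((\<xi>(k := y)) l))\<^sup>2) = (\<Sum>l\<in>I. (enorm d (\<xi> l))\<^sup>2)"
    using assms by (intro sum.cong) auto
  then show ?thesis
    using assms unfolding offdiag_def psum_insert_upd[OF assms] enorm_add_sq by simp
qed

lemma isotropic_PiM_coord_measurable:
  assumes "\<And>k. isotropic d (\<rho> k)" "k \<in> I" "i < d"
  shows "(\<lambda>\<xi>. \<xi> k i) \<in> borel_measurable (PiM I \<rho>)"
  by (rule measurable_compose[OF measurable_component_singleton[OF assms(2)]
        isotropic_coord_measurable[OF assms(1,3)]])

lemma isotropic_PiM_measurable:
  assumes "\<And>k. isotropic d (\<rho> k)"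
  shows "i < d \<Longrightarrow> (\<lambda>\<xi>. psum I \<xi> i) \<in> borel_measurable (PiM I \<rho>)"
    and "(\<lambda>\<xi>. enorm d (psum I \<xi>)) \<in> borel_measurable (PiM I \<rho>)"
    and "offdiag d I \<in> borel_measurable (PiM I \<rho>)"
proof -
  note [measurable] = isotropic_PiM_coord_measurable[OF assms]
  show 1: "(\<lambda>\<xi>. psum I \<xi> i) \<in> borel_measurable (PiM I \<rho>)" if "i < d" for i
    unfolding psum_def using that by measurable
  show 2: "(\<lambda>\<xi>. enorm d (psum I \<xi>)) \<in> borel_measurable (PiM I \<rho>)"
    by (rule enorm_measurable[OF 1])
  have 3: "(\<lambda>\<xi>. enorm d (\<xi> k)) \<in> borel_measurable (PiM I \<rho>)" if "k \<in> I" for k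
    by (rule enorm_measurable[OF isotropic_PiM_coord_measurable[OF assms that]])
  show "offdiag d I \<in> borel_measurable (PiM I \<rho>)"
    unfolding offdiag_def[abs_def]
    by (intro borel_measurable_diff borel_measurable_power borel_measurable_sum 2 3)
qed

lemma isotropic_product_sigma_finite:
  assumes "\<And>k. isotropic d (\<rho> k)"
  shows "product_sigma_finite \<rho>"
  using isotropic_prob_space[OF assms]
  by (simp add: product_sigma_finite_def prob_space_imp_sigma_finite)

lemma isotropic_prob_space_PiM:
  assumes "\<And>k. isotropic d (\<rho> k)"
  shows "prob_space (PiM I \<rho>)"
  using isotropic_prob_space[OF assms] by (intro prob_space_PiM)

section \<open>Moments of sums of independent isotropic vectors\<close>

lemma nn_integral_psum_sq:
  assumes \<rho>: "\<And>k. isotropic d (\<rho> k)" and "finite I"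
  shows "(\<integral>\<^sup>+\<xi>. ennreal ((enorm d (psum I \<xi>))\<^sup>2) \<partial>PiM I \<rho>) = ennreal (real (card I) * real d)"
  using \<open>finite I\<close>
proof (induction I rule: finite_induct)
  case empty
  have "enorm d (psum {} \<xi>) = 0" for \<xi> by (simp add: psum_def enorm_def L2_set_def)
  then show ?case by simp
next
  case (insert k I)
  interpret product_sigma_finite \<rho> by (rule isotropic_product_sigma_finite[OF \<rho>])
  interpret k: prob_space "\<rho> k" by (rule isotropic_prob_space[OF \<rho>])
  interpret P: prob_space "PiM I \<rho>" by (rule isotropic_prob_space_PiM[OF \<rho>])
  note [measurable] = isotropic_PiM_measurable(2)[OF \<rho>]
  have inner: "(\<integral>\<^sup>+y. ennreal ((enorm d (\<lambda>i. a i + y i))\<^sup>2) \<partial>\<rho> k) = ennreal ((enorm d a)\<^sup>2) + ennreal (real d)" for a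
  proof -
    have int: "integrable (\<rho> k) (\<lambda>y. (enorm d (\<lambda>i. a i + y i))\<^sup>2)"
      and "(\<integral>y. (enorm d (\<lambda>i. a i + y i))\<^sup>2 \<partial>\<rho> k) = (enorm d a)\<^sup>2 + real d"
      unfolding enorm_add_sq using isotropic_dot[OF \<rho>, of k a] isotropic_enorm_sq[OF \<rho>, of k]
      by (auto simp: k.prob_space)
    then show ?thesis by (simp add: nn_integral_eq_integral)
  qed
  have "(\<integral>\<^sup>+\<xi>. ennreal ((enorm d (psum (insert k I) \<xi>))\<^sup>2) \<partial>PiM (insert k I) \<rho>)
      = (\<integral>\<^sup>+\<xi>. ennreal ((enorm d (psum I \<xi>))\<^sup>2) + ennreal (real d) \<partial>PiM I \<rho>)"
    by (subst product_nn_integral_insert[OF insert.hyps])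
       (simp_all add: psum_insert_upd[OF insert.hyps] inner)
  also have "... = ennreal (real (card I) * real d) + ennreal (real d)"
    using insert.IH by (simp add: nn_integral_add P.emeasure_space_1)
  also have "... = ennreal (real (card (insert k I)) * real d)"
    using insert.hyps by (simp add: ennreal_plus[symmetric] algebra_simps del: ennreal_plus)
  finally show ?case .
qed

text \<open>Up to \<open>s\<close> the constant term suffices; beyond \<open>s\<close> the ratio
  exceeds 1 and raising the exponent to 2 only helps. A moment of order \<open>p\<close> is thereby
  reduced to a second moment at the natural scale \<open>s\<close>.\<close>

lemma powr_le_scaled_quadratic:
  fixes e s p :: real
  assumes "0 \<le> e" "0 < s" "0 \<le> p" "p \<le> 2"
  shows "e powr p \<le> s powr p * (1 + e\<^sup>2 / s\<^sup>2)"
proof (cases "e \<le> s")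
  case True
  then have "e powr p \<le> s powr p * 1" using assms by (simp add: powr_mono2)
  also have "... \<le> s powr p * (1 + e\<^sup>2 / s\<^sup>2)" by (intro mult_left_mono) auto
  finally show ?thesis .
next
  case False
  have "e powr p = (s * (e / s)) powr p" using assms by simp
  also have "... = s powr p * (e / s) powr p" using assms by (intro powr_mult) 
  also have "... \<le> s powr p * (e / s) powr 2"
    using False assms by (intro mult_left_mono powr_mono) auto
  also have "(e / s) powr 2 = e\<^sup>2 / s\<^sup>2" using False assms by (simp add: power_divide)
  also have "s powr p * (e\<^sup>2 / s\<^sup>2) \<le> s powr p * (1 + e\<^sup>2 / s\<^sup>2)" by (intro mult_left_mono) auto
  finally show ?thesis .
qed

text \<open>Write S for the current sum. A new summand adds at most
  \<open>11 * (E|S|^(q-2) * d + K)\<close> to E|S|^q, and E|S|^(q-2) is at most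
  \<open>2 * s powr (q - 2)\<close> because E|S|^2, being \<open>card I * d\<close>, never exceeds
  the square of \<open>s\<close>.\<close>

lemma nn_integral_psum_powr_le:
  fixes q K s :: real
  assumes \<rho>: "\<And>k. isotropic d (\<rho> k)" and q: "2 < q" "q \<le> 3"
    and K: "\<And>k. integrable (\<rho> k) (\<lambda>y. enorm d y powr q)" "\<And>k. (\<integral>y. enorm d y powr q \<partial>\<rho> k) \<le> K"
    and s: "0 < s" "real n * real d \<le> s\<^sup>2" and I: "finite I" "card I \<le> n"
  shows "(\<integral>\<^sup>+\<xi>. ennreal (enorm d (psum I \<xi>) powr q) \<partial>PiM I \<rho>)
     \<le> ennreal (real (card I) * (11 * (2 * s powr (q - 2) * real d + K)))"
  using I
proof (induction I rule: finite_induct)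
  case empty
  have "enorm d (psum {} \<xi>) = 0" for \<xi> by (simp add: psum_def enorm_def L2_set_def)
  then show ?case by simp
next
  case (insert k I)
  interpret product_sigma_finite \<rho> by (rule isotropic_product_sigma_finite[OF \<rho>])
  interpret P: prob_space "PiM I \<rho>" by (rule isotropic_prob_space_PiM[OF \<rho>])
  note [measurable] = isotropic_PiM_measurable(2)[OF \<rho>]
  have K0: "0 \<le> K" by (rule order_trans[OF _ K(2)[of 0]]) simp
  define S where "S = s powr (q - 2)"
  have S0: "0 \<le> S" by (simp add: S_def)
  let ?e = "\<lambda>\<xi>. enorm d (psum I \<xi>)"
  have "(\<integral>\<^sup>+\<xi>. ennreal (enorm d (psum (insert k I) \<xi>) powr q) \<partial>PiM (insert k I) \<rho>)
      = (\<integral>\<^sup>+\<xi>. \<integral>\<^sup>+y. ennreal (enorm d (\<lambda>i. psum I \<xi> i + y i) powr q) \<partial>\<rho> k \<partial>PiM I \<rho>)"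
    by (subst product_nn_integral_insert[OF insert.hyps])
       (simp_all add: psum_insert_upd[OF insert.hyps])
  also have "... \<le> (\<integral>\<^sup>+\<xi>. ennreal (?e \<xi> powr q) + (ennreal (11 * (S * real d + K)) + ennreal (11 * (S * real d) / s\<^sup>2) * ennreal ((?e \<xi>)\<^sup>2)) \<partial>PiM I \<rho>)"
  proof (rule nn_integral_mono)
    fix \<xi>
    have "?e \<xi> powr (q - 2) \<le> S * (1 + (?e \<xi>)\<^sup>2 / s\<^sup>2)"
      unfolding S_def using s q by (intro powr_le_scaled_quadratic) auto
    then have "?e \<xi> powr (q - 2) * real d \<le> S * (1 + (?e \<xi>)\<^sup>2 / s\<^sup>2) * real d"
      by (rule mult_right_mono) simp
    then have "?e \<xi> powr q + 11 * (?e \<xi> powr (q - 2) * real d + K)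
      \<le> ?e \<xi> powr q + 11 * (S * (1 + (?e \<xi>)\<^sup>2 / s\<^sup>2) * real d + K)"
      by simp
    also have "... = ?e \<xi> powr q + (11 * (S * real d + K) + 11 * (S * real d) / s\<^sup>2 * (?e \<xi>)\<^sup>2)"
      by (simp add: algebra_simps add_divide_distrib)
    finally have "?e \<xi> powr q + 11 * (?e \<xi> powr (q - 2) * real d + K)
      \<le> ?e \<xi> powr q + (11 * (S * real d + K) + 11 * (S * real d) / s\<^sup>2 * (?e \<xi>)\<^sup>2)" .
    then have "ennreal (?e \<xi> powr q + 11 * (?e \<xi> powr (q - 2) * real d + K))
      \<le> ennreal (?e \<xi> powr q) + (ennreal (11 * (S * real d + K)) + ennreal (11 * (S * real d) / s\<^sup>2) * ennreal ((?e \<xi>)\<^sup>2))"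
      using S0 K0 by (simp add: ennreal_mult[symmetric] ennreal_plus[symmetric] del: ennreal_plus)
    then show "(\<integral>\<^sup>+y. ennreal (enorm d (\<lambda>i. psum I \<xi> i + y i) powr q) \<partial>\<rho> k)
      \<le> ennreal (?e \<xi> powr q) + (ennreal (11 * (S * real d + K)) + ennreal (11 * (S * real d) / s\<^sup>2) * ennreal ((?e \<xi>)\<^sup>2))"
      using isotropic_moment_step[OF \<rho> q K, of k "psum I \<xi>"] by (rule order_trans[rotated])
  qed
  also have "... = (\<integral>\<^sup>+\<xi>. ennreal (?e \<xi> powr q) \<partial>PiM I \<rho>)
      + (ennreal (11 * (S * real d + K)) + ennreal (11 * (S * real d) / s\<^sup>2) * ennreal (real (card I) * real d))"
    using nn_integral_psum_sq[OF \<rho> insert.hyps(1)]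
    by (simp add: nn_integral_add nn_integral_cmult P.emeasure_space_1)
  also have "... \<le> ennreal (real (card I) * (11 * (2 * S * real d + K)))
      + (ennreal (11 * (S * real d + K)) + ennreal (11 * (S * real d)))"
  proof (intro add_mono order_refl)
    show "(\<integral>\<^sup>+\<xi>. ennreal (?e \<xi> powr q) \<partial>PiM I \<rho>) \<le> ennreal (real (card I) * (11 * (2 * S * real d + K)))"
      unfolding S_def using insert by (intro insert.IH) auto
    have "real (card I) * real d \<le> real n * real d"
      using insert.prems insert.hyps by (intro mult_right_mono) auto
    then have c: "real (card I) * real d \<le> s\<^sup>2" using s by linarith
    have "11 * (S * real d) / s\<^sup>2 * (real (card I) * real d) \<le> 11 * (S * real d) / s\<^sup>2 * s\<^sup>2"
      using c S0 by (intro mult_left_mono) auto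
    also have "... = 11 * (S * real d)" using s by simp
    finally show "ennreal (11 * (S * real d) / s\<^sup>2) * ennreal (real (card I) * real d) \<le> ennreal (11 * (S * real d))"
      using S0 by (simp add: ennreal_mult[symmetric] ennreal_leI)
  qed
  also have "... = ennreal (real (card (insert k I)) * (11 * (2 * S * real d + K)))"
    using insert.hyps S0 K0 by (simp add: ennreal_plus[symmetric] algebra_simps del: ennreal_plus)
  finally show ?case by (simp add: S_def)
qed

text \<open>Integrating out one coordinate leaves, up to the third-order error, an expression that depends
  on the law of that coordinate only through its first two moments.\<close>

lemma char_offdiag_integrate_out:
  fixes q K L \<tau> :: real
  assumes \<rho>: "\<And>k. isotropic d (\<rho> k)" and q: "2 < q" "q \<le> 3"
    and K: "integrable (\<rho> k) (\<lambda>y. enorm d y powr q)" "(\<integral>y. enorm d y powr q \<partial>\<rho> k) \<le> K"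
    and I: "finite I" "k \<notin> I"
    and L: "(\<integral>\<^sup>+\<xi>. ennreal (enorm d (psum I \<xi>) powr q) \<partial>PiM I \<rho>) \<le> ennreal L" "0 \<le> L"
  shows "cmod ((\<integral>\<xi>. iexp (\<tau> * offdiag d (insert k I) \<xi>) \<partial>PiM (insert k I) \<rho>)
      - (\<integral>\<xi>. iexp (\<tau> * offdiag d I \<xi>) * (1 - ((2 * \<tau>)\<^sup>2 * (enorm d (psum I \<xi>))\<^sup>2 / 2 :: real)) \<partial>PiM I \<rho>))
      \<le> (2 * \<bar>\<tau>\<bar>) powr q * K * L"
proof -
  interpret product_sigma_finite \<rho> by (rule isotropic_product_sigma_finite[OF \<rho>])
  interpret P: prob_space "PiM I \<rho>" by (rule isotropic_prob_space_PiM[OF \<rho>])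
  interpret P': prob_space "PiM (insert k I) \<rho>" by (rule isotropic_prob_space_PiM[OF \<rho>])
  interpret k: prob_space "\<rho> k" by (rule isotropic_prob_space[OF \<rho>])
  note [measurable] = isotropic_PiM_measurable[OF \<rho>] isotropic_coord_measurable[OF \<rho>]
  have K0: "0 \<le> K" by (rule order_trans[OF _ K(2)]) simp
  let ?R = "\<lambda>\<xi>. psum I \<xi>"
  \<comment> \<open>The inner integral over coordinate \<open>k\<close> with the others held fixed;
    by \<open>offdiag_insert_upd\<close> the phase is affine in that coordinate.\<close>
  define f where "f \<xi> = (\<integral>y. iexp (\<tau> * offdiag d I \<xi> + 2 * \<tau> * dot d (?R \<xi>) y) \<partial>\<rho> k)" for \<xi>
  define g where "g \<xi> = iexp (\<tau> * offdiag d I \<xi>) * (1 - ((2 * \<tau>)\<^sup>2 * (enorm d (?R \<xi>))\<^sup>2 / 2 :: real))" for \<xi>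
  have "integrable (PiM (insert k I) \<rho>) (\<lambda>\<xi>. iexp (\<tau> * offdiag d (insert k I) \<xi>))"
    by (rule P'.integrable_const_bound[where B=1]) auto
  then have eq: "(\<integral>\<xi>. iexp (\<tau> * offdiag d (insert k I) \<xi>) \<partial>PiM (insert k I) \<rho>) = (\<integral>\<xi>. f \<xi> \<partial>PiM I \<rho>)"
    unfolding f_def
    by (subst product_integral_insert[OF I]) (simp_all add: offdiag_insert_upd[OF I] algebra_simps)
  have f_int: "integrable (PiM I \<rho>) f"
  proof (rule P.integrable_const_bound[where B=1])
    show "f \<in> borel_measurable (PiM I \<rho>)"
      unfolding f_def dot_def by measurable
    have "cmod (f \<xi>) \<le> 1" for \<xi>
    proof -
      have "cmod (f \<xi>) \<le> (\<integral>y. cmod (iexp (\<tau> * offdiag d I \<xi> + 2 * \<tau> * dot d (?R \<xi>) y)) \<partial>\<rho> k)"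
        unfolding f_def by (rule integral_norm_bound)
      then show ?thesis by (simp add: k.prob_space)
    qed
    then show "AE \<xi> in PiM I \<rho>. cmod (f \<xi>) \<le> 1" by simp
  qed
  have R2: "integrable (PiM I \<rho>) (\<lambda>\<xi>. (enorm d (?R \<xi>))\<^sup>2)"
    by (rule integrableI_nonneg) (use nn_integral_psum_sq[OF \<rho> I(1)] in auto)
  have g_int: "integrable (PiM I \<rho>) g"
  proof (rule Bochner_Integration.integrable_bound)
    show "integrable (PiM I \<rho>) (\<lambda>\<xi>. 1 + (2 * \<tau>)\<^sup>2 * (enorm d (?R \<xi>))\<^sup>2 / 2)" using R2 by simp
    show "g \<in> borel_measurable (PiM I \<rho>)" unfolding g_def by measurable
    have "norm (g \<xi>) \<le> norm (1 + (2 * \<tau>)\<^sup>2 * (enorm d (?R \<xi>))\<^sup>2 / 2)" for \<xi>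
    proof -
      define z where "z = (2 * \<tau>)\<^sup>2 * (enorm d (?R \<xi>))\<^sup>2 / 2"
      have "0 \<le> z" by (simp add: z_def)
      have "g \<xi> = iexp (\<tau> * offdiag d I \<xi>) * complex_of_real (1 - z)"
        by (simp add: g_def z_def)
      then have "norm (g \<xi>) = \<bar>1 - z\<bar>" by (simp only: norm_mult norm_exp_i_times norm_of_real mult_1_left)
      then have "norm (g \<xi>) \<le> norm (1 + z)" using \<open>0 \<le> z\<close> by simp
      then show ?thesis by (simp only: z_def)
    qed
    then show "AE \<xi> in PiM I \<rho>. norm (g \<xi>) \<le> norm (1 + (2 * \<tau>)\<^sup>2 * (enorm d (?R \<xi>))\<^sup>2 / 2)" by simp
  qed
  have Rq: "integrable (PiM I \<rho>) (\<lambda>\<xi>. enorm d (?R \<xi>) powr q)"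
    by (rule integrableI_nonneg) (use L in \<open>auto intro: le_less_trans\<close>)
  have Rq': "(\<integral>\<xi>. enorm d (?R \<xi>) powr q \<partial>PiM I \<rho>) \<le> L"
    using L nn_integral_eq_integral[OF Rq] by simp
  have "cmod ((\<integral>\<xi>. f \<xi> \<partial>PiM I \<rho>) - (\<integral>\<xi>. g \<xi> \<partial>PiM I \<rho>)) = cmod (\<integral>\<xi>. f \<xi> - g \<xi> \<partial>PiM I \<rho>)"
    using f_int g_int by simp
  also have "... \<le> (\<integral>\<xi>. (2 * \<bar>\<tau>\<bar>) powr q * K * enorm d (?R \<xi>) powr q \<partial>PiM I \<rho>)"
  proof (rule order_trans[OF integral_norm_bound integral_mono])
    fix \<xi>
    show "cmod (f \<xi> - g \<xi>) \<le> (2 * \<bar>\<tau>\<bar>) powr q * K * enorm d (?R \<xi>) powr q"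
      unfolding f_def g_def
      using isotropic_char_step[OF \<rho> q K, where a="\<tau> * offdiag d I \<xi>" and \<theta>="2 * \<tau>" and R="?R \<xi>"]
      by (simp add: abs_mult powr_mult mult_ac)
  qed (use f_int g_int Rq in auto)
  also have "... \<le> (2 * \<bar>\<tau>\<bar>) powr q * K * L"
    using Rq' K0 by (auto intro: mult_left_mono)
  finally show ?thesis unfolding eq g_def .
qed

text \<open>Telescoping over hybrid product laws. Neighbouring hybrids differ in one coordinate and,
  once it is integrated out, are both close to the same integral \<open>J\<close>; hence a factor 2
  for each of the \<open>n\<close> steps.\<close>

lemma char_offdiag_swap:
  fixes q K L \<tau> :: real
  assumes \<nu>: "isotropic d \<nu>" "integrable \<nu> (\<lambda>y. enorm d y powr q)" "(\<integral>y. enorm d y powr q \<partial>\<nu>) \<le> K"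
    and \<gamma>: "isotropic d \<gamma>" "integrable \<gamma> (\<lambda>y. enorm d y powr q)" "(\<integral>y. enorm d y powr q \<partial>\<gamma>) \<le> K"
    and q: "2 < q" "q \<le> 3"
    and s: "0 < s" "real n * real d \<le> s\<^sup>2"
  defines "L \<equiv> real n * (11 * (2 * s powr (q - 2) * real d + K))"
  shows "cmod ((\<integral>\<xi>. iexp (\<tau> * offdiag d {1..n} \<xi>) \<partial>PiM {1..n} (\<lambda>_. \<nu>))
      - (\<integral>\<xi>. iexp (\<tau> * offdiag d {1..n} \<xi>) \<partial>PiM {1..n} (\<lambda>_. \<gamma>)))
      \<le> real n * (2 * ((2 * \<bar>\<tau>\<bar>) powr q * K * L))"
proof -
  define \<rho> where "\<rho> l k = (if k \<le> l then \<gamma> else \<nu>)" for l k :: nat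
  have \<rho>: "isotropic d (\<rho> l k)" "integrable (\<rho> l k) (\<lambda>y. enorm d y powr q)"
    "(\<integral>y. enorm d y powr q \<partial>\<rho> l k) \<le> K" for l k
    using \<nu> \<gamma> by (auto simp: \<rho>_def)
  have K0: "0 \<le> K" by (rule order_trans[OF _ \<nu>(3)]) simp
  have L0: "0 \<le> L" using K0 by (simp add: L_def)
  define \<Phi> where "\<Phi> l = (\<integral>\<xi>. iexp (\<tau> * offdiag d {1..n} \<xi>) \<partial>PiM {1..n} (\<rho> l))" for l
  define E where "E = (2 * \<bar>\<tau>\<bar>) powr q * K * L"
  have step: "cmod (\<Phi> l - \<Phi> (Suc l)) \<le> 2 * E" if "l < n" for l
  proof -
    define I where "I = {1..n} - {Suc l}"
    have I: "finite I" "Suc l \<notin> I" "insert (Suc l) I = {1..n}" "card I \<le> n"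
      using that by (auto simp: I_def card_Diff_singleton_if)
    have PiM_eq: "PiM I (\<rho> (Suc l)) = PiM I (\<rho> l)"
      by (intro PiM_cong) (auto simp: \<rho>_def I_def le_Suc_eq)
    define J where "J = (\<integral>\<xi>. iexp (\<tau> * offdiag d I \<xi>) * (1 - ((2 * \<tau>)\<^sup>2 * (enorm d (psum I \<xi>))\<^sup>2 / 2 :: real)) \<partial>PiM I (\<rho> l))"
    have m: "(\<integral>\<^sup>+\<xi>. ennreal (enorm d (psum I \<xi>) powr q) \<partial>PiM I (\<rho> l)) \<le> ennreal L"
    proof -
      have "(\<integral>\<^sup>+\<xi>. ennreal (enorm d (psum I \<xi>) powr q) \<partial>PiM I (\<rho> l))
          \<le> ennreal (real (card I) * (11 * (2 * s powr (q - 2) * real d + K)))"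
        by (rule nn_integral_psum_powr_le[OF \<rho>(1) q \<rho>(2,3) s I(1,4)])
      also have "... \<le> ennreal L"
        unfolding L_def using I(4) K0 by (intro ennreal_leI mult_right_mono) auto
      finally show ?thesis .
    qed
    have 1: "cmod (\<Phi> l - J) \<le> E"
      using char_offdiag_integrate_out[OF \<rho>(1) q \<rho>(2,3) I(1,2) m L0, of \<tau>]
      unfolding \<Phi>_def J_def E_def I(3) .
    have 2: "cmod (\<Phi> (Suc l) - J) \<le> E"
      using char_offdiag_integrate_out[OF \<rho>(1) q \<rho>(2,3) I(1,2) m[folded PiM_eq] L0, of \<tau>]
      unfolding \<Phi>_def J_def E_def I(3) PiM_eq .
    show ?thesis using norm_triangle_ineq4[of "\<Phi> l - J" "\<Phi> (Suc l) - J"] 1 2 by simp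
  qed
  have "cmod (\<Phi> 0 - \<Phi> l) \<le> real l * (2 * E)" if "l \<le> n" for l
    using that
  proof (induction l)
    case (Suc l)
    then have "cmod (\<Phi> 0 - \<Phi> (Suc l)) \<le> cmod (\<Phi> 0 - \<Phi> l) + cmod (\<Phi> l - \<Phi> (Suc l))"
      using norm_triangle_ineq[of "\<Phi> 0 - \<Phi> l" "\<Phi> l - \<Phi> (Suc l)"] by simp
    with Suc step[of l] show ?case by (simp add: algebra_simps)
  qed simp
  from this[of n] have "cmod (\<Phi> 0 - \<Phi> n) \<le> real n * (2 * E)" by simp
  moreover have "PiM {1..n} (\<rho> 0) = PiM {1..n} (\<lambda>_. \<nu>)" "PiM {1..n} (\<rho> n) = PiM {1..n} (\<lambda>_. \<gamma>)"
    by (intro PiM_cong; simp add: \<rho>_def)+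
  ultimately show ?thesis by (simp add: \<Phi>_def E_def)
qed


section \<open>Gaussian vectors\<close>

abbreviation std_gauss :: "nat \<Rightarrow> (nat \<Rightarrow> real) measure" where
  "std_gauss d \<equiv> PiM {..<d} (\<lambda>_. std_normal_distribution)"

lemma prob_space_std_normal: "prob_space std_normal_distribution"
  by (rule prob_space_normal_density) simp

lemma std_normal_even_moments:
  "(\<integral>x. x\<^sup>2 \<partial>std_normal_distribution) = 1" "(\<integral>x. x ^ 4 \<partial>std_normal_distribution) = 3"
  using std_normal_distribution_even_moments(1)[of 1] std_normal_distribution_even_moments(1)[of 2]
  by (simp_all add: fact_numeral)

lemma std_normal_mean: "(\<integral>x. x \<partial>std_normal_distribution) = 0"
  using integral_std_normal_distribution_moment_odd[of 1] by simp

lemma std_gauss_monomial: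
  fixes a b :: nat
  assumes "i < d" "j < d"
  shows "integrable (std_gauss d) (\<lambda>y. y i ^ a * y j ^ b)"
    and "(\<integral>y. y i ^ a * y j ^ b \<partial>std_gauss d) =
      (if i = j then (\<integral>x. x ^ (a + b) \<partial>std_normal_distribution)
       else (\<integral>x. x ^ a \<partial>std_normal_distribution) * (\<integral>x. x ^ b \<partial>std_normal_distribution))"
proof -
  interpret N: prob_space std_normal_distribution by (rule prob_space_std_normal)
  interpret product_sigma_finite "\<lambda>_::nat. std_normal_distribution"
    by (simp add: product_sigma_finite_def N.sigma_finite_measure_axioms)
  \<comment> \<open>The exponents spread the monomial over all coordinates, so that its integral
    factorises; coordinates with exponent 0 contribute 1. Equal and distinct indices are treated
    together.\<close>
  define e where "e k = (if k = i then a else 0) + (if k = j then b else 0)" for k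
  have eq: "y i ^ a * y j ^ b = (\<Prod>k<d. y k ^ e k)" for y :: "nat \<Rightarrow> real"
  proof -
    have 1: "(\<Prod>k<d. y k ^ (if k = i then a else 0)) = y i ^ a"
      if "i < d" for i and a :: nat
    proof -
      have "(\<Prod>k<d. y k ^ (if k = i then a else 0)) = (\<Prod>k<d. if k = i then y k ^ a else 1)"
        by (intro prod.cong) auto
      then show ?thesis using that by simp
    qed
    show ?thesis unfolding e_def power_add prod.distrib using 1 assms by simp
  qed
  show "integrable (std_gauss d) (\<lambda>y. y i ^ a * y j ^ b)"
    unfolding eq by (intro product_integrable_prod integrable_std_normal_distribution_moment) auto
  have N1: "measure std_normal_distribution UNIV = 1" using N.prob_space by simp
  have "(\<integral>y. y i ^ a * y j ^ b \<partial>std_gauss d) = (\<Prod>k<d. \<integral>x. x ^ e k \<partial>std_normal_distribution)"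
    unfolding eq by (intro product_integral_prod integrable_std_normal_distribution_moment) auto
  also have "... = (\<Prod>k\<in>{i, j}. \<integral>x. x ^ e k \<partial>std_normal_distribution)"
    using assms by (intro prod.mono_neutral_right) (auto simp: e_def N1)
  also have "... = (if i = j then (\<integral>x. x ^ (a + b) \<partial>std_normal_distribution)
       else (\<integral>x. x ^ a \<partial>std_normal_distribution) * (\<integral>x. x ^ b \<partial>std_normal_distribution))"
    by (auto simp: e_def)
  finally show "(\<integral>y. y i ^ a * y j ^ b \<partial>std_gauss d) =
      (if i = j then (\<integral>x. x ^ (a + b) \<partial>std_normal_distribution)
       else (\<integral>x. x ^ a \<partial>std_normal_distribution) * (\<integral>x. x ^ b \<partial>std_normal_distribution))" .
qed

lemma isotropic_std_gauss: "isotropic d (std_gauss d)"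
  unfolding isotropic_def
proof (intro conjI allI impI)
  show "prob_space (std_gauss d)" by (intro prob_space_PiM prob_space_std_normal)
  show "sets (std_gauss d) = sets (PiM {..<d} (\<lambda>_. borel))" by (intro sets_PiM_cong) auto
  fix i assume i: "i < d"
  show "integrable (std_gauss d) (\<lambda>y. y i)" "(\<integral>y. y i \<partial>std_gauss d) = 0"
    using std_gauss_monomial[OF i i, of 1 0] std_normal_mean by simp_all
  fix j assume j: "j < d"
  show "integrable (std_gauss d) (\<lambda>y. y i * y j)"
    "(\<integral>y. y i * y j \<partial>std_gauss d) = (if i = j then 1 else 0)"
    using std_gauss_monomial[OF i j, of 1 1] std_normal_mean std_normal_even_moments
    by (simp_all add: numeral_2_eq_2)
qed

text \<open>Each mixed moment of two squared coordinates is 1 or 3; bounding all of them by 3 keeps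
  the right order in \<open>d\<close>.\<close>

lemma std_gauss_fourth_moment:
  "integrable (std_gauss d) (\<lambda>y. enorm d y ^ 4)"
  "(\<integral>y. enorm d y ^ 4 \<partial>std_gauss d) \<le> 3 * (real d)\<^sup>2"
proof -
  have eq: "enorm d y ^ 4 = (\<Sum>i<d. \<Sum>j<d. y i ^ 2 * y j ^ 2)" for y
  proof -
    have "enorm d y ^ 4 = ((enorm d y)\<^sup>2)\<^sup>2" by simp
    also have "... = (\<Sum>i<d. \<Sum>j<d. y i ^ 2 * y j ^ 2)"
      unfolding enorm_sq by (simp only: power2_eq_square[of "sum _ _"] sum_product)
    finally show ?thesis .
  qed
  show "integrable (std_gauss d) (\<lambda>y. enorm d y ^ 4)"
    unfolding eq by (intro integral_double_sum(1) std_gauss_monomial(1))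
  have "(\<integral>y. enorm d y ^ 4 \<partial>std_gauss d) = (\<Sum>i<d. \<Sum>j<d. \<integral>y. y i ^ 2 * y j ^ 2 \<partial>std_gauss d)"
    unfolding eq by (intro integral_double_sum(2) std_gauss_monomial(1))
  also have "... \<le> (\<Sum>i<d. \<Sum>j<d. 3)"
    by (intro sum_mono) (simp add: std_gauss_monomial(2) std_normal_even_moments)
  also have "... = 3 * (real d)\<^sup>2" by (simp add: power2_eq_square)
  finally show "(\<integral>y. enorm d y ^ 4 \<partial>std_gauss d) \<le> 3 * (real d)\<^sup>2" .
qed

text \<open>\<open>powr_le_scaled_quadratic\<close>, applied to the squared norm at its natural
  scale \<open>d\<close>, reduces the moment to the fourth one; 4 is \<open>1 + 3\<close> with the 3
  of \<open>std_gauss_fourth_moment\<close>.\<close>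

lemma std_gauss_moment_le:
  assumes q: "0 \<le> q" "q \<le> 4" and d: "d \<ge> 1"
  shows "integrable (std_gauss d) (\<lambda>y. enorm d y powr q)"
    and "(\<integral>y. enorm d y powr q \<partial>std_gauss d) \<le> 4 * real d powr (q / 2)"
proof -
  interpret prob_space "std_gauss d" by (rule isotropic_prob_space[OF isotropic_std_gauss])
  have [measurable]: "enorm d \<in> borel_measurable (std_gauss d)"
    by (rule isotropic_enorm_measurable[OF isotropic_std_gauss])
  define g where "g y = real d powr (q / 2) * (1 + enorm d y ^ 4 / (real d)\<^sup>2)" for y
  have le: "enorm d y powr q \<le> g y" for y
  proof -
    have "enorm d y powr q = ((enorm d y)\<^sup>2) powr (q / 2)"
      by (simp add: powr_powr powr_numeral[symmetric] del: powr_numeral)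
    also have "... \<le> real d powr (q / 2) * (1 + ((enorm d y)\<^sup>2)\<^sup>2 / (real d)\<^sup>2)"
      using q d by (intro powr_le_scaled_quadratic) auto
    finally show ?thesis by (simp add: g_def)
  qed
  have g: "integrable (std_gauss d) g"
    unfolding g_def using std_gauss_fourth_moment(1) by auto
  show int: "integrable (std_gauss d) (\<lambda>y. enorm d y powr q)"
    by (rule Bochner_Integration.integrable_bound[OF g])
       (auto intro!: AE_I2 order_trans[OF le abs_ge_self])
  have "(\<integral>y. enorm d y powr q \<partial>std_gauss d) \<le> (\<integral>y. g y \<partial>std_gauss d)"
    by (intro integral_mono int g le)
  also have "... = real d powr (q / 2) * (1 + (\<integral>y. enorm d y ^ 4 \<partial>std_gauss d) / (real d)\<^sup>2)"
    unfolding g_def using std_gauss_fourth_moment(1) by (simp add: prob_space)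
  also have "... \<le> real d powr (q / 2) * (1 + 3)"
    using std_gauss_fourth_moment(2)[of d] d
    by (intro mult_left_mono add_left_mono) (auto simp: divide_le_eq)
  finally show "(\<integral>y. enorm d y powr q \<partial>std_gauss d) \<le> 4 * real d powr (q / 2)" by simp
qed

section \<open>Sums of independent scalars and Gaussian arrays\<close>

lemma nn_integral_sum_sq_PiM:
  fixes f :: "'b \<Rightarrow> real"
  assumes \<rho>: "prob_space \<rho>" and f: "integrable \<rho> f" "(\<integral>y. f y \<partial>\<rho>) = 0" "integrable \<rho> (\<lambda>y. (f y)\<^sup>2)"
    and "finite I"
  shows "(\<integral>\<^sup>+\<xi>. ennreal ((\<Sum>k\<in>I. f (\<xi> k))\<^sup>2) \<partial>PiM I (\<lambda>_. \<rho>)) = ennreal (real (card I) * (\<integral>y. (f y)\<^sup>2 \<partial>\<rho>))"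
  using \<open>finite I\<close>
proof (induction I rule: finite_induct)
  case (insert k I)
  interpret \<rho>: prob_space \<rho> by fact
  interpret product_sigma_finite "\<lambda>_. \<rho>"
    by (simp add: product_sigma_finite_def \<rho>.sigma_finite_measure_axioms)
  interpret P: prob_space "PiM I (\<lambda>_. \<rho>)" by (intro prob_space_PiM \<rho>)
  have [measurable]: "f \<in> borel_measurable \<rho>" using f(1) by auto
  have comp: "(\<lambda>\<xi>. f (\<xi> l)) \<in> borel_measurable (PiM J (\<lambda>_. \<rho>))" if "l \<in> J" for l J
    using that by measurable
  have meas: "(\<lambda>\<xi>. (\<Sum>l\<in>J. f (\<xi> l))) \<in> borel_measurable (PiM J (\<lambda>_. \<rho>))" for J
    by (intro borel_measurable_sum comp)
  have upd: "(\<Sum>l\<in>insert k I. f ((\<xi>(k := y)) l)) = (\<Sum>l\<in>I. f (\<xi> l)) + f y" for \<xi> y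
  proof -
    have "(\<Sum>l\<in>I. f ((\<xi>(k := y)) l)) = (\<Sum>l\<in>I. f (\<xi> l))"
      using insert.hyps by (intro sum.cong) auto
    then show ?thesis using insert.hyps by simp
  qed
  have inner: "(\<integral>\<^sup>+y. ennreal ((a + f y)\<^sup>2) \<partial>\<rho>) = ennreal (a\<^sup>2) + ennreal (\<integral>y. (f y)\<^sup>2 \<partial>\<rho>)" for a
  proof -
    have "integrable \<rho> (\<lambda>y. (a + f y)\<^sup>2)" "(\<integral>y. (a + f y)\<^sup>2 \<partial>\<rho>) = a\<^sup>2 + (\<integral>y. (f y)\<^sup>2 \<partial>\<rho>)"
      unfolding power2_sum using f by (auto simp: \<rho>.prob_space)
    then show ?thesis by (simp add: nn_integral_eq_integral)
  qed
  have "(\<integral>\<^sup>+\<xi>. ennreal ((\<Sum>k\<in>insert k I. f (\<xi> k))\<^sup>2) \<partial>PiM (insert k I) (\<lambda>_. \<rho>))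
     = (\<integral>\<^sup>+\<xi>. ennreal ((\<Sum>l\<in>I. f (\<xi> l))\<^sup>2) + ennreal (\<integral>y. (f y)\<^sup>2 \<partial>\<rho>) \<partial>PiM I (\<lambda>_. \<rho>))"
    by (subst product_nn_integral_insert[OF insert.hyps])
       (auto simp only: upd inner intro!: measurable_compose[OF _ measurable_ennreal] borel_measurable_power meas)
  also have "... = ennreal (real (card I) * (\<integral>y. (f y)\<^sup>2 \<partial>\<rho>)) + ennreal (\<integral>y. (f y)\<^sup>2 \<partial>\<rho>)"
    using insert.IH meas[of I] by (simp add: nn_integral_add P.emeasure_space_1)
  also have "... = ennreal (real (card (insert k I)) * (\<integral>y. (f y)\<^sup>2 \<partial>\<rho>))"
    using insert.hyps by (simp add: ennreal_plus[symmetric] algebra_simps del: ennreal_plus)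
  finally show ?case .
qed simp

text \<open>The index type stays polymorphic, named through \<open>dummy\<close>, because the space
  is used twice: with pairs for Gaussian arrays and with naturals for the chi-square limit.\<close>

lemma indep_vars_coordinates_std_normal:
  fixes dummy :: "'i itself"
  defines "\<Omega> \<equiv> PiM (UNIV :: 'i set) (\<lambda>_. std_normal_distribution)"
  shows "prob_space.indep_vars \<Omega> (\<lambda>_. borel) (\<lambda>p \<omega>. \<omega> p) UNIV"
    and "distr \<Omega> borel (\<lambda>\<omega>. \<omega> p) = std_normal_distribution"
proof -
  interpret prob_space \<Omega> unfolding \<Omega>_def by (intro prob_space_PiM prob_space_std_normal)
  have m: "(\<lambda>\<omega>. \<omega> p) \<in> borel_measurable \<Omega>" for p
  proof -
    have "(\<lambda>\<omega>. \<omega> p) \<in> measurable \<Omega> std_normal_distribution"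
      unfolding \<Omega>_def by (intro measurable_component_singleton) simp
    then show ?thesis by simp
  qed
  show d: "distr \<Omega> borel (\<lambda>\<omega>. \<omega> p) = std_normal_distribution" for p
  proof -
    have "distr \<Omega> borel (\<lambda>\<omega>. \<omega> p) = distr \<Omega> std_normal_distribution (\<lambda>\<omega>. \<omega> p)"
      by (intro distr_cong) auto
    also have "... = std_normal_distribution"
      unfolding \<Omega>_def by (intro distr_PiM_component prob_space_std_normal) simp
    finally show ?thesis .
  qed
  show "indep_vars (\<lambda>_. borel) (\<lambda>p \<omega>. \<omega> p) UNIV"
  proof (subst indep_vars_iff_distr_eq_PiM)
    have "distr \<Omega> (PiM UNIV (\<lambda>_. borel)) (\<lambda>x. x) = \<Omega>"
      by (rule distr_id2) (unfold \<Omega>_def, intro sets_PiM_cong, auto)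
    then show "distr \<Omega> (PiM UNIV (\<lambda>_. borel)) (\<lambda>x. \<lambda>i\<in>UNIV. x i) = PiM UNIV (\<lambda>i. distr \<Omega> borel (\<lambda>\<omega>. \<omega> i))"
      unfolding d by (simp add: \<Omega>_def restrict_def)
  qed (use m in auto)
qed

text \<open>Both the rows and the scaled column sums of a Gaussian array indexed by \<open>(k, i)\<close> are standard
  Gaussian vectors.\<close>

lemma integral_psum_std_gauss:
  fixes h :: "(nat \<Rightarrow> real) \<Rightarrow> complex"
  assumes n: "n \<ge> 1" and d: "d \<ge> 1"
    and h: "h \<in> borel_measurable (PiM {..<d} (\<lambda>_. borel))"
    and h_cong: "\<And>x y. (\<And>i. i < d \<Longrightarrow> x i = y i) \<Longrightarrow> h x = h y"
  shows "(\<integral>\<xi>. h (\<lambda>i. psum {1..n} \<xi> i / sqrt (real n)) \<partial>PiM {1..n} (\<lambda>_. std_gauss d)) = (\<integral>y. h y \<partial>std_gauss d)"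
proof -
  define \<Omega> where "\<Omega> = PiM (UNIV :: (nat \<times> nat) set) (\<lambda>_. std_normal_distribution)"
  interpret prob_space \<Omega> unfolding \<Omega>_def by (intro prob_space_PiM prob_space_std_normal)
  have ind: "indep_vars (\<lambda>_. borel) (\<lambda>p \<omega>. \<omega> p) UNIV"
    and law: "distr \<Omega> borel (\<lambda>\<omega>. \<omega> p) = std_normal_distribution" for p
    using indep_vars_coordinates_std_normal[where 'i="nat \<times> nat"] by (auto simp: \<Omega>_def)
  have sets_g: "sets (std_gauss d) = sets (PiM {..<d} (\<lambda>_. borel))"
    by (intro sets_PiM_cong) auto
  have rv: "(\<lambda>\<omega>. \<omega> p) \<in> borel_measurable \<Omega>" for p :: "nat \<times> nat"
    using ind unfolding indep_vars_def2 by blast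

  define V where "V k = (\<lambda>\<omega>. \<lambda>i\<in>{..<d}. \<omega> (k, i) :: real)" for k :: nat
  have V_law: "distr \<Omega> (PiM {..<d} (\<lambda>_. borel)) (V k) = std_gauss d" for k
  proof -
    have "distr \<Omega> (PiM {..<d} (\<lambda>_. std_normal_distribution)) (\<lambda>\<omega>. \<lambda>i\<in>{..<d}. \<omega> (k, i)) = std_gauss d"
      unfolding \<Omega>_def by (rule distr_PiM_reindex) (auto intro: prob_space_std_normal simp: inj_on_def)
    moreover have "distr \<Omega> (PiM {..<d} (\<lambda>_. borel)) (V k) = distr \<Omega> (PiM {..<d} (\<lambda>_. std_normal_distribution)) (V k)"
      using sets_g by (intro distr_cong) auto
    ultimately show ?thesis by (simp add: V_def[abs_def])
  qed
  have V_ind: "indep_vars (\<lambda>_. PiM {..<d} (\<lambda>_. borel)) V {1..n}"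
  proof -
    define K where "K k = {k} \<times> {..<d}" for k :: nat
    have "indep_vars (\<lambda>j. PiM (K j) (\<lambda>_. borel)) (\<lambda>j \<omega>. restrict (\<lambda>i. \<omega> i) (K j)) {1..n}"
      by (rule indep_vars_restrict[OF ind]) (auto simp: K_def disjoint_family_on_def)
    then have "indep_vars (\<lambda>_. PiM {..<d} (\<lambda>_. borel))
        (\<lambda>j \<omega>. (\<lambda>x. \<lambda>i\<in>{..<d}. x (j, i)) (restrict (\<lambda>i. \<omega> i) (K j))) {1..n}"
      by (rule indep_vars_compose2) (intro measurable_restrict measurable_component_singleton, auto simp: K_def)
    then show ?thesis
      by (rule indep_vars_cong[THEN iffD1, rotated 3]) (auto simp: K_def V_def restrict_def fun_eq_iff)
  qed
  have V_rv: "V k \<in> measurable \<Omega> (PiM {..<d} (\<lambda>_. borel))" for k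
    unfolding V_def by (intro measurable_restrict rv)
  define G where "G i = (\<lambda>\<omega>. (\<Sum>k=1..n. \<omega> (k, i)) / sqrt (real n))" for i :: nat
  have G_ind: "indep_vars (\<lambda>_. borel) G {..<d}"
  proof -
    define K where "K i = {1..n} \<times> {i}" for i :: nat
    have "indep_vars (\<lambda>j. PiM (K j) (\<lambda>_. borel)) (\<lambda>j \<omega>. restrict (\<lambda>i. \<omega> i) (K j)) {..<d}"
      by (rule indep_vars_restrict[OF ind]) (auto simp: K_def disjoint_family_on_def)
    then have "indep_vars (\<lambda>_. borel)
        (\<lambda>j \<omega>. (\<lambda>x. (\<Sum>k=1..n. x (k, j)) / sqrt (real n)) (restrict (\<lambda>i. \<omega> i) (K j))) {..<d}"
      by (rule indep_vars_compose2)
         (auto simp: K_def intro!: borel_measurable_divide borel_measurable_sum measurable_component_singleton)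
    then show ?thesis
      by (rule indep_vars_cong[THEN iffD1, rotated 3]) (auto simp: K_def G_def)
  qed
  have G_law: "distr \<Omega> borel (G i) = std_normal_distribution" for i
  proof -
    have dist: "distributed \<Omega> lborel (\<lambda>\<omega>. \<omega> (k, i)) (normal_density 0 1)" for k
      unfolding distributed_def using law[of "(k, i)"] rv[of "(k, i)"]
      by (auto simp: distr_cong[OF refl sets_lborel[symmetric] refl])
    have "indep_vars (\<lambda>_. borel) (\<lambda>k \<omega>. \<omega> (k, i)) {1..n}"
    proof -
      have "indep_vars (\<lambda>k. PiM {(k, i)} (\<lambda>_. borel)) (\<lambda>k \<omega>. restrict (\<lambda>p. \<omega> p) {(k, i)}) {1..n}"
        by (rule indep_vars_restrict[OF ind]) (auto simp: disjoint_family_on_def)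
      then have "indep_vars (\<lambda>_. borel) (\<lambda>k \<omega>. (\<lambda>x. x (k, i)) (restrict (\<lambda>p. \<omega> p) {(k, i)})) {1..n}"
        by (rule indep_vars_compose2) (auto intro!: measurable_component_singleton)
      then show ?thesis by simp
    qed
    then have "distributed \<Omega> lborel (\<lambda>\<omega>. \<Sum>k=1..n. \<omega> (k, i))
        (normal_density (\<Sum>k=1..n. 0) (sqrt (\<Sum>k=1..n. 1\<^sup>2)))"
      using n by (intro sum_indep_normal dist) auto
    then have "distributed \<Omega> lborel (\<lambda>\<omega>. 0 + 1 / sqrt (real n) * (\<Sum>k=1..n. \<omega> (k, i)))
        (normal_density (0 + 1 / sqrt (real n) * 0) (\<bar>1 / sqrt (real n)\<bar> * sqrt (real n)))"
      using n by (intro normal_density_affine) auto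
    then have "distributed \<Omega> lborel (G i) std_normal_density"
      using n by (simp add: G_def)
    then have "distr \<Omega> lborel (G i) = std_normal_distribution"
      by (rule distributed_distr_eq_density)
    then show ?thesis by (simp cong: distr_cong)
  qed
  have G_rv: "G i \<in> borel_measurable \<Omega>" for i
    unfolding G_def by (intro borel_measurable_divide borel_measurable_sum rv) simp

  have V_joint: "distr \<Omega> (PiM {1..n} (\<lambda>_. PiM {..<d} (\<lambda>_. borel))) (\<lambda>\<omega>. \<lambda>k\<in>{1..n}. V k \<omega>)
      = PiM {1..n} (\<lambda>_. std_gauss d)"
    using V_ind n V_rv by (subst (asm) indep_vars_iff_distr_eq_PiM') (auto simp: V_law)
  have G_joint: "distr \<Omega> (PiM {..<d} (\<lambda>_. borel)) (\<lambda>\<omega>. \<lambda>i\<in>{..<d}. G i \<omega>) = std_gauss d"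
    using G_ind d G_rv by (subst (asm) indep_vars_iff_distr_eq_PiM') (auto simp: G_law lessThan_empty_iff)
  \<comment> \<open>Points of the product space are extensional, so the argument of \<open>h\<close>
    is restricted to \<open>{..<d}\<close>; \<open>h_cong\<close> makes this harmless.\<close>
  let ?H = "\<lambda>\<xi>. h (\<lambda>i\<in>{..<d}. psum {1..n} \<xi> i / sqrt (real n))"
  have H: "h (\<lambda>i. psum {1..n} \<xi> i / sqrt (real n)) = ?H \<xi>" for \<xi>
    by (rule h_cong) simp
  have H_meas: "?H \<in> borel_measurable (PiM {1..n} (\<lambda>_. PiM {..<d} (\<lambda>_. borel)))"
  proof (rule measurable_compose[OF _ h], rule measurable_restrict)
    fix i assume i: "i \<in> {..<d}"
    have "(\<lambda>\<xi>. \<xi> k i) \<in> borel_measurable (PiM {1..n} (\<lambda>_. PiM {..<d} (\<lambda>_. borel :: real measure)))"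
      if "k \<in> {1..n}" for k
      by (rule measurable_compose[OF measurable_component_singleton[OF that] measurable_component_singleton[OF i]])
    then show "(\<lambda>\<xi>. psum {1..n} \<xi> i / sqrt (real n)) \<in> borel_measurable (PiM {1..n} (\<lambda>_. PiM {..<d} (\<lambda>_. borel)))"
      unfolding psum_def by (intro borel_measurable_divide borel_measurable_sum) auto
  qed
  have "(\<integral>\<xi>. h (\<lambda>i. psum {1..n} \<xi> i / sqrt (real n)) \<partial>PiM {1..n} (\<lambda>_. std_gauss d))
      = (\<integral>\<omega>. ?H (\<lambda>k\<in>{1..n}. V k \<omega>) \<partial>\<Omega>)"
    unfolding H V_joint[symmetric] using V_rv H_meas
    by (intro integral_distr measurable_restrict) auto
  also have "... = (\<integral>\<omega>. h (\<lambda>i\<in>{..<d}. G i \<omega>) \<partial>\<Omega>)"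
    by (intro Bochner_Integration.integral_cong refl h_cong) (simp add: psum_def V_def G_def)
  also have "... = (\<integral>y. h y \<partial>std_gauss d)"
    unfolding G_joint[symmetric] using G_rv h
    by (intro integral_distr[symmetric] measurable_restrict) auto
  finally show ?thesis .
qed

text \<open>The squared norm is a sum of \<open>d\<close> independent squares of normals, each with
  mean 1 and variance 3 - 1 = 2. One infinite product space carries all dimensions, since the
  central limit theorem speaks about a fixed sequence.\<close>

lemma chi_square_char_limit:
  "(\<lambda>d. \<integral>y. iexp (t * (((enorm d y)\<^sup>2 - real d) / sqrt (2 * real d))) \<partial>std_gauss d)
     \<longlonglongrightarrow> complex_of_real (exp (- t\<^sup>2 / 2))"
proof -
  define \<Omega> where "\<Omega> = PiM (UNIV :: nat set) (\<lambda>_. std_normal_distribution)"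
  interpret prob_space \<Omega> unfolding \<Omega>_def by (intro prob_space_PiM prob_space_std_normal)
  interpret N: prob_space std_normal_distribution by (rule prob_space_std_normal)
  have ind: "indep_vars (\<lambda>_. borel) (\<lambda>p \<omega>. \<omega> p) UNIV"
    and law: "distr \<Omega> borel (\<lambda>\<omega>. \<omega> p) = std_normal_distribution" for p
    using indep_vars_coordinates_std_normal[where 'i=nat] by (auto simp: \<Omega>_def)
  have rv[measurable]: "(\<lambda>\<omega>. \<omega> p) \<in> borel_measurable \<Omega>" for p :: nat
    using ind unfolding indep_vars_def2 by blast
  define X where "X i = (\<lambda>\<omega>. (\<omega> i)\<^sup>2 - 1 :: real)" for i :: nat
  have X_rv: "X i \<in> borel_measurable \<Omega>" for i unfolding X_def by measurable
  have int: "integrable std_normal_distribution (\<lambda>x. x ^ k)" for k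
    by (rule integrable_std_normal_distribution_moment)
  have tr: "integrable \<Omega> (\<lambda>\<omega>. f (\<omega> i)) \<longleftrightarrow> integrable std_normal_distribution f"
    "(\<integral>\<omega>. f (\<omega> i) \<partial>\<Omega>) = (\<integral>x. f x \<partial>std_normal_distribution)"
    if "f \<in> borel_measurable borel" for f :: "real \<Rightarrow> real" and i
    unfolding law[of i, symmetric] using that by (auto simp: integrable_distr_eq integral_distr)
  have sq: "(x\<^sup>2 - 1)\<^sup>2 = x ^ 4 - 2 * x\<^sup>2 + 1" for x :: real
    by (simp add: power2_diff)
  have mean: "expectation (X i) = 0" for i
    unfolding X_def using int[of 2]
    by (subst tr(2)) (auto simp: std_normal_even_moments N.prob_space[simplified])
  have X2: "integrable \<Omega> (\<lambda>\<omega>. (X i \<omega>)\<^sup>2)" "(\<integral>\<omega>. (X i \<omega>)\<^sup>2 \<partial>\<Omega>) = 2" for i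
    unfolding X_def sq using int[of 2] int[of 4]
    by (subst tr; auto simp: std_normal_even_moments N.prob_space[simplified])+
  have "weak_conv_m (\<lambda>d. distr \<Omega> borel (\<lambda>\<omega>. (\<Sum>i<d. X i \<omega>) / sqrt (real d * (sqrt 2)\<^sup>2))) std_normal_distribution"
  proof (rule central_limit_theorem_zero_mean[where \<mu>="distr std_normal_distribution borel (\<lambda>x. x\<^sup>2 - 1)"])
    show "indep_vars (\<lambda>_. borel) X UNIV"
      unfolding X_def by (rule indep_vars_compose2[OF ind]) measurable
    show "distr \<Omega> borel (X i) = distr std_normal_distribution borel (\<lambda>x. x\<^sup>2 - 1)" for i
      unfolding law[of i, symmetric] by (subst distr_distr) (auto simp: X_def comp_def)
    show "variance (X i) = (sqrt 2)\<^sup>2" for i using mean X2(2) by simp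
  qed (use mean X2 in auto)
  then have "(\<lambda>d. char (distr \<Omega> borel (\<lambda>\<omega>. (\<Sum>i<d. X i \<omega>) / sqrt (real d * (sqrt 2)\<^sup>2))) t)
      \<longlonglongrightarrow> char std_normal_distribution t"
    by (intro levy_continuity1 real_dist_normal_dist real_distribution_distr)
       (auto intro!: borel_measurable_divide borel_measurable_sum X_rv)
  moreover have "char (distr \<Omega> borel (\<lambda>\<omega>. (\<Sum>i<d. X i \<omega>) / sqrt (real d * (sqrt 2)\<^sup>2))) t
     = (\<integral>y. iexp (t * (((enorm d y)\<^sup>2 - real d) / sqrt (2 * real d))) \<partial>std_gauss d)" for d
  proof -
    have L: "distr \<Omega> (std_gauss d) (\<lambda>\<omega>. \<lambda>i\<in>{..<d}. \<omega> i) = std_gauss d"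
      unfolding \<Omega>_def by (rule distr_PiM_reindex[where f="\<lambda>i. i"]) (auto intro: prob_space_std_normal)
    have m: "(\<lambda>\<omega>. \<lambda>i\<in>{..<d}. \<omega> i) \<in> measurable \<Omega> (std_gauss d)"
      by (rule measurable_restrict) simp
    have [measurable]: "enorm d \<in> borel_measurable (std_gauss d)"
      by (rule isotropic_enorm_measurable[OF isotropic_std_gauss])
    have "(\<integral>y. iexp (t * (((enorm d y)\<^sup>2 - real d) / sqrt (2 * real d))) \<partial>std_gauss d)
      = (\<integral>y. iexp (t * (((enorm d y)\<^sup>2 - real d) / sqrt (2 * real d))) \<partial>distr \<Omega> (std_gauss d) (\<lambda>\<omega>. \<lambda>i\<in>{..<d}. \<omega> i))"
      by (simp only: L)
    also have "... = (\<integral>\<omega>. iexp (t * (((enorm d (\<lambda>i\<in>{..<d}. \<omega> i))\<^sup>2 - real d) / sqrt (2 * real d))) \<partial>\<Omega>)"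
      by (rule integral_distr[OF m]) measurable
    also have "... = (\<integral>\<omega>. iexp (t * ((\<Sum>i<d. X i \<omega>) / sqrt (real d * (sqrt 2)\<^sup>2))) \<partial>\<Omega>)"
      by (intro Bochner_Integration.integral_cong refl)
         (simp add: enorm_sq X_def sum_subtractf mult.commute)
    also have "... = char (distr \<Omega> borel (\<lambda>\<omega>. (\<Sum>i<d. X i \<omega>) / sqrt (real d * (sqrt 2)\<^sup>2))) t"
      unfolding char_def
      by (subst integral_distr) (auto intro!: borel_measurable_divide borel_measurable_sum X_rv)
    finally show ?thesis by simp
  qed
  ultimately show ?thesis by (simp add: char_std_normal_distribution)
qed

lemma iexp_lipschitz: "cmod (iexp a - iexp b) \<le> \<bar>a - b\<bar>" for a b :: real
proof -
  have "iexp a = iexp (b + (a - b))" by simp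
  also have "... = iexp b * iexp (a - b)" by (simp only: of_real_add distrib_left exp_add)
  finally have "iexp a - iexp b = iexp b * (iexp (a - b) - 1)" by (simp add: right_diff_distrib)
  then have "cmod (iexp a - iexp b) = cmod (iexp (a - b) - 1)" by (simp add: norm_mult)
  also have "... \<le> \<bar>a - b\<bar>" using iexp_approx1[of "a - b" 0] by simp
  finally show ?thesis .
qed

text \<open>The off-diagonal form differs from |S|^2 - n d by the centred diagonal sum
  \<open>Z\<close>, whose variance is at most 3 n d^2; the phase is Lipschitz, so E|Z| bounds the
  error. What remains is a function of S / sqrt n, again a standard Gaussian vector.\<close>

lemma char_offdiag_std_gauss:
  assumes n: "n \<ge> 1" and d: "d \<ge> 1"
  shows "cmod ((\<integral>\<xi>. iexp (\<tau> * offdiag d {1..n} \<xi>) \<partial>PiM {1..n} (\<lambda>_. std_gauss d))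
     - (\<integral>y. iexp (\<tau> * real n * ((enorm d y)\<^sup>2 - real d)) \<partial>std_gauss d)) \<le> \<bar>\<tau>\<bar> * (sqrt (3 * real n) * real d)"
proof -
  let ?P = "PiM {1..n} (\<lambda>_. std_gauss d)"
  interpret g: prob_space "std_gauss d" by (rule isotropic_prob_space[OF isotropic_std_gauss])
  interpret P: prob_space ?P by (intro prob_space_PiM g.prob_space_axioms)
  have em[measurable]: "enorm d \<in> borel_measurable (std_gauss d)"
    by (rule isotropic_enorm_measurable[OF isotropic_std_gauss])
  note [measurable] = isotropic_PiM_measurable(2,3)[where \<rho>="\<lambda>_. std_gauss d", OF isotropic_std_gauss]
  define f where "f y = (enorm d y)\<^sup>2 - real d" for y
  define Z where "Z \<xi> = (\<Sum>k=1..n. f (\<xi> k))" for \<xi>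
  define s where "s = sqrt (3 * real n) * real d"
  have s: "s > 0" "s\<^sup>2 = real n * (3 * (real d)\<^sup>2)" using n d by (auto simp: s_def power_mult_distrib)
  have f: "integrable (std_gauss d) f" "(\<integral>y. f y \<partial>std_gauss d) = 0"
    unfolding f_def using isotropic_enorm_sq[OF isotropic_std_gauss] by (auto simp: g.prob_space)
  have fsq: "(f y)\<^sup>2 = enorm d y ^ 4 - 2 * real d * (enorm d y)\<^sup>2 + (real d)\<^sup>2" for y
    by (simp add: f_def power2_diff)
  have f2: "integrable (std_gauss d) (\<lambda>y. (f y)\<^sup>2)"
    unfolding fsq using std_gauss_fourth_moment(1) isotropic_enorm_sq(1)[OF isotropic_std_gauss] by auto
  have "(\<integral>y. (f y)\<^sup>2 \<partial>std_gauss d) = (\<integral>y. enorm d y ^ 4 \<partial>std_gauss d) - 2 * real d * real d + (real d)\<^sup>2"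
    unfolding fsq using std_gauss_fourth_moment(1) isotropic_enorm_sq[OF isotropic_std_gauss]
    by (simp add: g.prob_space)
  also have "... \<le> 3 * (real d)\<^sup>2"
    using std_gauss_fourth_moment(2)[of d] zero_le_square[of "real d"] unfolding power2_eq_square by linarith
  finally have f2': "(\<integral>y. (f y)\<^sup>2 \<partial>std_gauss d) \<le> 3 * (real d)\<^sup>2" .
  have fm: "f \<in> borel_measurable (std_gauss d)" using f(1) by auto
  have Zm: "Z \<in> borel_measurable ?P"
    unfolding Z_def
    by (intro borel_measurable_sum measurable_compose[OF _ fm] measurable_component_singleton)
  have nnZ: "(\<integral>\<^sup>+\<xi>. ennreal ((Z \<xi>)\<^sup>2) \<partial>?P) = ennreal (real n * (\<integral>y. (f y)\<^sup>2 \<partial>std_gauss d))"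
    unfolding Z_def by (subst nn_integral_sum_sq_PiM[OF g.prob_space_axioms f f2]) auto
  have Z2: "integrable ?P (\<lambda>\<xi>. (Z \<xi>)\<^sup>2)"
    by (rule integrableI_nonneg) (use Zm nnZ in auto)
  have Z2': "(\<integral>\<xi>. (Z \<xi>)\<^sup>2 \<partial>?P) \<le> s\<^sup>2"
  proof -
    have "(\<integral>\<xi>. (Z \<xi>)\<^sup>2 \<partial>?P) = real n * (\<integral>y. (f y)\<^sup>2 \<partial>std_gauss d)"
      using nn_integral_eq_integral[OF Z2] nnZ by simp
    also have "... \<le> s\<^sup>2" unfolding s(2) using f2' by (intro mult_left_mono) auto
    finally show ?thesis .
  qed
  have Zi: "integrable ?P (\<lambda>\<xi>. (s + (Z \<xi>)\<^sup>2 / s) / 2)"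
    by (intro integrable_divide Bochner_Integration.integrable_add Z2 P.integrable_const)
  \<comment> \<open>Arithmetic-geometric mean inequality: as the second moment of \<open>Z\<close>
    is at most the square of \<open>s\<close>, it yields E|Z| at most \<open>s\<close>.\<close>
  have Zle: "\<bar>Z \<xi>\<bar> \<le> (s + (Z \<xi>)\<^sup>2 / s) / 2" for \<xi>
  proof -
    have "0 \<le> (s - \<bar>Z \<xi>\<bar>)\<^sup>2 / s" using s by simp
    then show ?thesis using s(1) by (simp add: power2_diff power2_eq_square field_simps)
  qed
  define Y where "Y \<xi> = (enorm d (psum {1..n} \<xi>))\<^sup>2 - real n * real d" for \<xi>
  have off: "offdiag d {1..n} \<xi> = Y \<xi> - Z \<xi>" for \<xi>
    by (simp add: offdiag_def Y_def Z_def f_def sum_subtractf)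
  have Ym[measurable]: "Y \<in> borel_measurable ?P" unfolding Y_def by measurable
  have int: "integrable ?P (\<lambda>\<xi>. iexp (\<tau> * offdiag d {1..n} \<xi>))" "integrable ?P (\<lambda>\<xi>. iexp (\<tau> * Y \<xi>))"
    by (rule P.integrable_const_bound[where B=1], simp, measurable)+
  have "cmod ((\<integral>\<xi>. iexp (\<tau> * offdiag d {1..n} \<xi>) \<partial>?P) - (\<integral>\<xi>. iexp (\<tau> * Y \<xi>) \<partial>?P))
    = cmod (\<integral>\<xi>. iexp (\<tau> * offdiag d {1..n} \<xi>) - iexp (\<tau> * Y \<xi>) \<partial>?P)"
    using int by simp
  also have "... \<le> (\<integral>\<xi>. \<bar>\<tau>\<bar> * ((s + (Z \<xi>)\<^sup>2 / s) / 2) \<partial>?P)"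
  proof (rule order_trans[OF integral_norm_bound integral_mono])
    fix \<xi>
    have "cmod (iexp (\<tau> * offdiag d {1..n} \<xi>) - iexp (\<tau> * Y \<xi>)) \<le> \<bar>\<tau> * offdiag d {1..n} \<xi> - \<tau> * Y \<xi>\<bar>"
      by (rule iexp_lipschitz)
    also have "... = \<bar>\<tau>\<bar> * \<bar>Z \<xi>\<bar>" unfolding off by (simp add: right_diff_distrib abs_mult)
    also have "... \<le> \<bar>\<tau>\<bar> * ((s + (Z \<xi>)\<^sup>2 / s) / 2)" by (intro mult_left_mono Zle) simp
    finally show "cmod (iexp (\<tau> * offdiag d {1..n} \<xi>) - iexp (\<tau> * Y \<xi>)) \<le> \<bar>\<tau>\<bar> * ((s + (Z \<xi>)\<^sup>2 / s) / 2)" .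
  qed (intro integrable_norm Bochner_Integration.integrable_diff int integrable_mult_right Zi)+
  also have "... = \<bar>\<tau>\<bar> * ((s + (\<integral>\<xi>. (Z \<xi>)\<^sup>2 \<partial>?P) / s) / 2)"
    using Bochner_Integration.integral_add[OF P.integrable_const integrable_divide[OF Z2], of s s]
    by (simp add: P.prob_space del: One_nat_def)
  also have "... \<le> \<bar>\<tau>\<bar> * ((s + s\<^sup>2 / s) / 2)"
    using Z2' s(1) by (intro mult_left_mono divide_right_mono add_left_mono) auto
  also have "... = \<bar>\<tau>\<bar> * s" using s(1) by (simp add: power2_eq_square)
  finally have 1: "cmod ((\<integral>\<xi>. iexp (\<tau> * offdiag d {1..n} \<xi>) \<partial>?P) - (\<integral>\<xi>. iexp (\<tau> * Y \<xi>) \<partial>?P)) \<le> \<bar>\<tau>\<bar> * s" .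
  have Y: "\<tau> * Y \<xi> = \<tau> * real n * ((enorm d (\<lambda>i. psum {1..n} \<xi> i / sqrt (real n)))\<^sup>2 - real d)" for \<xi>
  proof -
    have "(enorm d (\<lambda>i. psum {1..n} \<xi> i / sqrt (real n)))\<^sup>2 = (enorm d (psum {1..n} \<xi>))\<^sup>2 / real n"
      unfolding enorm_sq sum_divide_distrib using n by (intro sum.cong) (auto simp: power_divide)
    then show ?thesis using n by (simp add: Y_def field_simps)
  qed
  have "(\<integral>\<xi>. iexp (\<tau> * Y \<xi>) \<partial>?P) = (\<integral>y. iexp (\<tau> * real n * ((enorm d y)\<^sup>2 - real d)) \<partial>std_gauss d)"
    unfolding Y
  proof (rule integral_psum_std_gauss[OF n d])
    have [measurable]: "enorm d \<in> borel_measurable (PiM {..<d} (\<lambda>_. borel))"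
      using enorm_measurable[of d "\<lambda>y. y" "PiM {..<d} (\<lambda>_. borel)"] by simp
    show "(\<lambda>y. iexp (\<tau> * real n * ((enorm d y)\<^sup>2 - real d))) \<in> borel_measurable (PiM {..<d} (\<lambda>_. borel))"
      by measurable
    show "iexp (\<tau> * real n * ((enorm d x)\<^sup>2 - real d)) = iexp (\<tau> * real n * ((enorm d y)\<^sup>2 - real d))"
      if "\<And>i. i < d \<Longrightarrow> x i = y i" for x y
      using enorm_cong[OF that] by simp
  qed
  with 1 show ?thesis by (simp add: s_def)
qed


section \<open>Asymptotic normality of the off-diagonal part\<close>

text \<open>With \<open>\<tau> = t / (n * sqrt (2 * d))\<close> and \<open>s = sqrt (n * d)\<close>,
  the \<open>n\<close> replacements cost \<open>n * \<tau>^q * d^(q/2) * (n * d)^(q/2)\<close> up to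
  constants and powers of \<open>t\<close>, that is \<open>n^(1 - q/2) * d^(q/2)\<close>. The second
  term is the diagonal of the Gaussian sample.\<close>

lemma char_offdiag_isotropic_bound:
  fixes q \<kappa> t :: real
  assumes \<nu>: "isotropic d \<nu>" "integrable \<nu> (\<lambda>y. enorm d y powr q)"
      "(\<integral>y. enorm d y powr q \<partial>\<nu>) \<le> \<kappa> * real d powr (q / 2)"
    and q: "2 < q" "q \<le> 3" and n: "n \<ge> 1" and d: "d \<ge> 1" and \<kappa>: "\<kappa> \<ge> 4"
  shows "cmod ((\<integral>\<xi>. iexp (t * (offdiag d {1..n} \<xi> / (real n * sqrt (2 * real d)))) \<partial>PiM {1..n} (\<lambda>_. \<nu>))
      - (\<integral>y. iexp (t * (((enorm d y)\<^sup>2 - real d) / sqrt (2 * real d))) \<partial>std_gauss d))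
    \<le> 22 * \<kappa> * (2 + \<kappa>) * (sqrt 2 * \<bar>t\<bar>) powr q * (real n powr (1 - q / 2) * real d powr (q / 2))
      + \<bar>t\<bar> * sqrt (3 / 2) * sqrt (real d / real n)"
proof -
  define x y where "x = real n" and "y = real d"
  have xy: "1 \<le> x" "1 \<le> y" using n d by (auto simp: x_def y_def)
  define \<tau> where "\<tau> = t / (x * sqrt (2 * y))"
  define K where "K = \<kappa> * y powr (q / 2)"
  define s where "s = sqrt (x * y)"
  have s: "s > 0" "x * y \<le> s\<^sup>2" "s\<^sup>2 = x * y" using xy by (auto simp: s_def)
  \<comment> \<open>The assumption that \<open>\<kappa>\<close> is at least 4 lets the same
    \<open>K\<close> serve the Gaussian law.\<close>
  have Kg: "(\<integral>y. enorm d y powr q \<partial>std_gauss d) \<le> K"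
    using std_gauss_moment_le(2)[of q d] q d \<kappa>
    by (auto simp: K_def y_def intro: order_trans mult_right_mono)
  have K\<nu>: "(\<integral>y. enorm d y powr q \<partial>\<nu>) \<le> K" using \<nu>(3) by (simp add: K_def y_def)
  have gi: "integrable (std_gauss d) (\<lambda>y. enorm d y powr q)"
    using std_gauss_moment_le(1)[of q d] q d by simp
  define L where "L = x * (11 * (2 * s powr (q - 2) * y + K))"
  let ?\<Phi> = "\<lambda>\<nu>. \<integral>\<xi>. iexp (\<tau> * offdiag d {1..n} \<xi>) \<partial>PiM {1..n} (\<lambda>_. \<nu>)"
  let ?c = "\<integral>y. iexp (\<tau> * real n * ((enorm d y)\<^sup>2 - real d)) \<partial>std_gauss d"
  have 1: "cmod (?\<Phi> \<nu> - ?\<Phi> (std_gauss d)) \<le> x * (2 * ((2 * \<bar>\<tau>\<bar>) powr q * K * L))"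
    unfolding L_def x_def y_def
    by (rule char_offdiag_swap[OF \<nu>(1,2) K\<nu> isotropic_std_gauss gi Kg q s(1)]) (use s in \<open>simp add: x_def y_def\<close>)
  have 2: "cmod (?\<Phi> (std_gauss d) - ?c) \<le> \<bar>\<tau>\<bar> * (sqrt (3 * x) * y)"
    unfolding x_def y_def by (rule char_offdiag_std_gauss[OF n d])
  have "L \<le> 11 * (2 + \<kappa>) * (x powr (q / 2) * y powr (q / 2))"
  proof -
    have "s powr (q - 2) * (x * y) = s powr q" using powr_split_sq[of s q] s q by simp
    also have "... = x powr (q / 2) * y powr (q / 2)"
      using xy by (simp add: s_def powr_half_sqrt[symmetric] powr_powr powr_mult)
    finally have "x * (2 * s powr (q - 2) * y) = 2 * (x powr (q / 2) * y powr (q / 2))"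
      by (simp add: mult_ac)
    moreover have "x * K \<le> \<kappa> * (x powr (q / 2) * y powr (q / 2))"
    proof -
      have "x powr 1 \<le> x powr (q / 2)" using xy q by (intro powr_mono) auto
      then have "x * (\<kappa> * y powr (q / 2)) \<le> x powr (q / 2) * (\<kappa> * y powr (q / 2))"
        using xy \<kappa> by (intro mult_right_mono) auto
      then show ?thesis by (simp add: K_def mult_ac)
    qed
    ultimately show ?thesis by (simp add: L_def distrib_left distrib_right)
  qed
  then have "x * (2 * ((2 * \<bar>\<tau>\<bar>) powr q * K * L))
    \<le> x * (2 * ((2 * \<bar>\<tau>\<bar>) powr q * K * (11 * (2 + \<kappa>) * (x powr (q / 2) * y powr (q / 2)))))"
    using xy \<kappa> by (intro mult_left_mono) (auto simp: K_def)
  also have "... = 22 * \<kappa> * (2 + \<kappa>) * (sqrt 2 * \<bar>t\<bar>) powr q * (x powr (1 - q / 2) * y powr (q / 2))"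
  proof -
    have "2 * \<bar>\<tau>\<bar> = (sqrt 2 * \<bar>t\<bar>) / (x * sqrt y)"
      using xy by (simp add: \<tau>_def abs_mult real_sqrt_mult field_simps)
    then have h1: "(2 * \<bar>\<tau>\<bar>) powr q = (sqrt 2 * \<bar>t\<bar>) powr q / (x powr q * y powr (q / 2))"
      using xy by (simp add: powr_divide powr_mult powr_half_sqrt[symmetric] powr_powr)
    have h2: "x * x powr (q / 2) / x powr q = x powr (1 - q / 2)"
    proof -
      have "1 - q / 2 = 1 + q / 2 - q" by simp
      then have "x powr (1 - q / 2) = x powr (1 + q / 2 - q)" by (simp only:)
      then show ?thesis using xy by (simp only: powr_diff powr_add powr_one_gt_zero_iff) simp
    qed
    have h3: "x * (2 * (A / (X * Y) * (\<kappa> * Y) * (11 * (2 + \<kappa>) * (X' * Y))))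
        = 22 * \<kappa> * (2 + \<kappa>) * A * ((x * X' / X) * Y)"
      if "X \<noteq> 0" "Y \<noteq> 0" for A X Y X' :: real
      using that by (simp add: field_simps)
    have "x powr q \<noteq> 0" "y powr (q / 2) \<noteq> 0" using xy by auto
    from h3[OF this] show ?thesis unfolding K_def h1 h2[symmetric] .
  qed
  finally have 1: "cmod (?\<Phi> \<nu> - ?\<Phi> (std_gauss d))
    \<le> 22 * \<kappa> * (2 + \<kappa>) * (sqrt 2 * \<bar>t\<bar>) powr q * (x powr (1 - q / 2) * y powr (q / 2))"
    using 1 by linarith
  have "\<bar>\<tau>\<bar> * (sqrt (3 * x) * y) = \<bar>t\<bar> * sqrt (3 / 2) * sqrt (y / x)"
  proof -
    have eq: "sqrt (3 * x) * y / (x * sqrt (2 * y)) = sqrt (3 / 2) * sqrt (y / x)"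
      using xy by (simp add: real_sqrt_mult real_sqrt_divide field_simps)
    have "\<bar>\<tau>\<bar> * (sqrt (3 * x) * y) = \<bar>t\<bar> * (sqrt (3 * x) * y / (x * sqrt (2 * y)))"
      using xy by (simp add: \<tau>_def abs_mult)
    then show ?thesis by (simp only: eq mult.assoc)
  qed
  with 2 have 2: "cmod (?\<Phi> (std_gauss d) - ?c) \<le> \<bar>t\<bar> * sqrt (3 / 2) * sqrt (y / x)" by simp
  have e1: "t * (offdiag d {1..n} \<xi> / (real n * sqrt (2 * real d))) = \<tau> * offdiag d {1..n} \<xi>" for \<xi>
    by (simp add: \<tau>_def x_def y_def)
  have e2: "t * (((enorm d z)\<^sup>2 - real d) / sqrt (2 * real d)) = \<tau> * real n * ((enorm d z)\<^sup>2 - real d)" for z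
    using n by (simp add: \<tau>_def x_def y_def)
  have "cmod (?\<Phi> \<nu> - ?c) \<le> cmod (?\<Phi> \<nu> - ?\<Phi> (std_gauss d)) + cmod (?\<Phi> (std_gauss d) - ?c)"
    using norm_triangle_ineq[of "?\<Phi> \<nu> - ?\<Phi> (std_gauss d)" "?\<Phi> (std_gauss d) - ?c"] by simp
  also have "... \<le> 22 * \<kappa> * (2 + \<kappa>) * (sqrt 2 * \<bar>t\<bar>) powr q * (x powr (1 - q / 2) * y powr (q / 2))
      + \<bar>t\<bar> * sqrt (3 / 2) * sqrt (y / x)"
    by (rule add_mono[OF 1 2])
  finally show ?thesis unfolding e1 e2 x_def y_def .
qed

lemma weak_conv_offdiag:
  fixes \<nu> :: "nat \<Rightarrow> (nat \<Rightarrow> real) measure" and d :: "nat \<Rightarrow> nat" and q \<kappa> :: real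
  assumes iso: "\<And>n. isotropic (d n) (\<nu> n)"
    and mom: "\<forall>\<^sub>F n in sequentially. integrable (\<nu> n) (\<lambda>y. enorm (d n) y powr q) \<and>
      (\<integral>y. enorm (d n) y powr q \<partial>\<nu> n) \<le> \<kappa> * real (d n) powr (q / 2)"
    and q: "2 < q" "q \<le> 3" and d: "filterlim d at_top sequentially"
    and lim: "(\<lambda>n. real n powr (1 - q / 2) * real (d n) powr (q / 2)) \<longlonglongrightarrow> 0"
      "(\<lambda>n. real (d n) / real n) \<longlonglongrightarrow> 0"
  shows "weak_conv_m (\<lambda>n. distr (PiM {1..n} (\<lambda>_. \<nu> n)) borel
      (\<lambda>\<xi>. offdiag (d n) {1..n} \<xi> / (real n * sqrt (2 * real (d n))))) std_normal_distribution"
proof (rule levy_continuity[OF _ real_dist_normal_dist])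
  fix n
  interpret prob_space "PiM {1..n} (\<lambda>_. \<nu> n)" by (rule isotropic_prob_space_PiM[OF iso])
  have off: "offdiag (d n) {1..n} \<in> borel_measurable (PiM {1..n} (\<lambda>_. \<nu> n))"
    by (rule isotropic_PiM_measurable(3)[OF iso])
  then show "real_distribution (distr (PiM {1..n} (\<lambda>_. \<nu> n)) borel
      (\<lambda>\<xi>. offdiag (d n) {1..n} \<xi> / (real n * sqrt (2 * real (d n)))))"
    by (intro real_distribution_distr borel_measurable_divide) auto
next
  fix t :: real
  define \<kappa>' where "\<kappa>' = max \<kappa> 4"
  define \<Phi> where "\<Phi> n = (\<integral>\<xi>. iexp (t * (offdiag (d n) {1..n} \<xi> / (real n * sqrt (2 * real (d n))))) \<partial>PiM {1..n} (\<lambda>_. \<nu> n))" for n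
  define \<Psi> where "\<Psi> d = (\<integral>y. iexp (t * (((enorm d y)\<^sup>2 - real d) / sqrt (2 * real d))) \<partial>std_gauss d)" for d
  define E where "E n = 22 * \<kappa>' * (2 + \<kappa>') * (sqrt 2 * \<bar>t\<bar>) powr q * (real n powr (1 - q / 2) * real (d n) powr (q / 2))
      + \<bar>t\<bar> * sqrt (3 / 2) * sqrt (real (d n) / real n)" for n
  have char_eq: "char (distr (PiM {1..n} (\<lambda>_. \<nu> n)) borel
      (\<lambda>\<xi>. offdiag (d n) {1..n} \<xi> / (real n * sqrt (2 * real (d n))))) t = \<Phi> n" for n
  proof -
    have off: "offdiag (d n) {1..n} \<in> borel_measurable (PiM {1..n} (\<lambda>_. \<nu> n))"
      by (rule isotropic_PiM_measurable(3)[OF iso])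
    show ?thesis
      unfolding char_def \<Phi>_def by (rule integral_distr) (intro borel_measurable_divide off, simp_all)
  qed
  have "(\<lambda>n. \<Phi> n - \<Psi> (d n)) \<longlonglongrightarrow> 0"
  proof (rule Lim_null_comparison)
    have "\<forall>\<^sub>F n in sequentially. 1 \<le> d n" using d by (simp add: filterlim_at_top)
    then show "\<forall>\<^sub>F n in sequentially. norm (\<Phi> n - \<Psi> (d n)) \<le> E n"
      using mom eventually_ge_at_top[of 1]
    proof eventually_elim
      case (elim n)
      then have "(\<integral>y. enorm (d n) y powr q \<partial>\<nu> n) \<le> \<kappa>' * real (d n) powr (q / 2)"
        by (auto simp: \<kappa>'_def intro: order_trans mult_right_mono)
      then show ?case
        unfolding \<Phi>_def \<Psi>_def E_def
        using elim by (intro char_offdiag_isotropic_bound iso q) (auto simp: \<kappa>'_def)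
    qed
    have "(\<lambda>n. sqrt (real (d n) / real n)) \<longlonglongrightarrow> sqrt 0" by (intro tendsto_intros lim)
    then have "E \<longlonglongrightarrow> 22 * \<kappa>' * (2 + \<kappa>') * (sqrt 2 * \<bar>t\<bar>) powr q * 0 + \<bar>t\<bar> * sqrt (3 / 2) * sqrt 0"
      unfolding E_def by (intro tendsto_add tendsto_mult lim(1) tendsto_const)
    then show "E \<longlonglongrightarrow> 0" by simp
  qed
  \<comment> \<open>The comparison law still varies with \<open>n\<close>; its own limit is taken
    along the dimension \<open>d n\<close>, which tends to infinity.\<close>
  moreover have "(\<lambda>n. \<Psi> (d n)) \<longlonglongrightarrow> complex_of_real (exp (- t\<^sup>2 / 2))"
    unfolding \<Psi>_def by (rule filterlim_compose[OF chi_square_char_limit d])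
  ultimately have "(\<lambda>n. (\<Phi> n - \<Psi> (d n)) + \<Psi> (d n)) \<longlonglongrightarrow> 0 + complex_of_real (exp (- t\<^sup>2 / 2))"
    by (rule tendsto_add)
  then show "(\<lambda>n. char (distr (PiM {1..n} (\<lambda>_. \<nu> n)) borel
      (\<lambda>\<xi>. offdiag (d n) {1..n} \<xi> / (real n * sqrt (2 * real (d n))))) t) \<longlonglongrightarrow> char std_normal_distribution t"
    unfolding char_eq by (simp add: char_std_normal_distribution)
qed


section \<open>The empirical likelihood on the good event\<close>

text \<open>Truncation gives the entries of the outer product a finite variance although fourth
  moments may be infinite. On the good event no vector exceeds \<open>B\<close>, so the truncation
  is invisible there.\<close>

definition trunc_outer :: "nat \<Rightarrow> real \<Rightarrow> (nat \<Rightarrow> real) \<Rightarrow> nat \<Rightarrow> nat \<Rightarrow> real" where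
  "trunc_outer d B y a b = (if enorm d y \<le> B then y a * y b else 0)"

text \<open>A squared Frobenius norm instead of an operator norm: when \<open>V\<close> is the mean
  of the truncated outer products, its expectation is just \<open>n\<close> times the sum of the
  entrywise variances.\<close>

definition frob_dev ::
  "nat \<Rightarrow> real \<Rightarrow> (nat \<Rightarrow> nat \<Rightarrow> real) \<Rightarrow> nat \<Rightarrow> (nat \<Rightarrow> nat \<Rightarrow> real) \<Rightarrow> real" where
  "frob_dev d B V n \<xi> = (\<Sum>a<d. \<Sum>b<d. (\<Sum>k=1..n. trunc_outer d B (\<xi> k) a b - V a b)\<^sup>2)"

text \<open>Cauchy-Schwarz over pairs of indices; this is the bound of the operator norm by the
  Frobenius norm.\<close>

lemma quad_form_le_frobenius:
  "(\<Sum>a<d. \<Sum>b<d. u a * u b * H a b)\<^sup>2 \<le> ((enorm d u)\<^sup>2)\<^sup>2 * (\<Sum>a<d. \<Sum>b<d. (H a b)\<^sup>2)"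
proof -
  let ?S = "{..<d} \<times> {..<d}"
  have "(\<Sum>p\<in>?S. (u (fst p) * u (snd p)) * H (fst p) (snd p))\<^sup>2
    \<le> (\<Sum>p\<in>?S. (u (fst p) * u (snd p))\<^sup>2) * (\<Sum>p\<in>?S. (H (fst p) (snd p))\<^sup>2)"
    by (rule Cauchy_Schwarz_ineq_sum)
  moreover have "(\<Sum>p\<in>?S. (u (fst p) * u (snd p))\<^sup>2) = ((enorm d u)\<^sup>2)\<^sup>2"
    unfolding enorm_sq power2_eq_square[of "sum _ _"] sum_product sum.cartesian_product
    by (simp add: power_mult_distrib case_prod_beta)
  ultimately show ?thesis by (simp add: sum.cartesian_product case_prod_beta)
qed

lemma trace_le_frobenius:
  "(\<Sum>a<d. H a a)\<^sup>2 \<le> real d * (\<Sum>a<d. \<Sum>b<d. (H a b)\<^sup>2)"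
proof -
  have "(\<Sum>a<d. 1 * H a a)\<^sup>2 \<le> (\<Sum>a<d. 1\<^sup>2) * (\<Sum>a<d. (H a a)\<^sup>2)"
    by (rule Cauchy_Schwarz_ineq_sum)
  also have "... \<le> real d * (\<Sum>a<d. \<Sum>b<d. (H a b)\<^sup>2)"
  proof -
    have "(H a a)\<^sup>2 \<le> (\<Sum>b<d. (H a b)\<^sup>2)" if "a < d" for a
      using that by (intro member_le_sum) auto
    then have "(\<Sum>a<d. (H a a)\<^sup>2) \<le> (\<Sum>a<d. \<Sum>b<d. (H a b)\<^sup>2)" by (intro sum_mono) auto
    then show ?thesis by (simp add: mult_left_mono)
  qed
  finally show ?thesis by simp
qed

text \<open>With \<open>\<eta> = \<epsilon> / sqrt d\<close>, the expansion is applied with relative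
  error \<open>2 * \<eta>\<close>, Young parameter \<open>\<eta>\<close> and fourth-power bound
  \<open>B ^ 4\<close>. Its errors are \<open>10 * \<eta> * K * d\<close> and
  \<open>256 * K^2 * \<epsilon>^4 / \<eta>\<close>, both multiples of \<open>sqrt d\<close>, the
  scale of the final normalisation.\<close>

lemma emp_lik_close_to_offdiag_det:
  fixes \<xi> :: "nat \<Rightarrow> nat \<Rightarrow> real" and B \<epsilon> K :: real
  assumes n: "n \<ge> 1" and d: "d \<ge> 1" and \<epsilon>: "0 < \<epsilon>" "\<epsilon> \<le> 1/16" and K: "0 \<le> K" "sqrt K * \<epsilon> \<le> 1/8"
    and B: "B = \<epsilon> * sqrt (real n / real d)"
    and c: "K * (real d)\<^sup>2 \<le> 2 * \<epsilon> * real n" "K\<^sup>2 * real d ^ 4 \<le> \<epsilon> ^ 4 * real n ^ 3"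
    and V: "\<And>u. \<bar>quad_form d V u - (enorm d u)\<^sup>2\<bar> \<le> \<epsilon> / sqrt (real d) * (enorm d u)\<^sup>2"
      "\<bar>(\<Sum>a<d. V a a) - real d\<bar> \<le> \<epsilon> / sqrt (real d)"
    and A1: "\<And>k. k \<in> {1..n} \<Longrightarrow> enorm d (\<xi> k) \<le> B"
    and A2: "(\<Sum>k=1..n. enorm d (\<xi> k) ^ 4) \<le> B ^ 4"
    and A3: "frob_dev d B V n \<xi> \<le> (real n * \<epsilon>)\<^sup>2 / real d"
    and A4: "(enorm d (psum {1..n} \<xi>))\<^sup>2 \<le> K * (real n * real d)"
  shows "\<exists>v. - 2 * ext_ln (emp_lik n d \<xi>) = ereal v \<and>
    \<bar>(v - real d) / sqrt (2 * real d) - offdiag d {1..n} \<xi> / (real n * sqrt (2 * real d))\<bar>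
      \<le> 10 * K * \<epsilon> + 256 * K\<^sup>2 * \<epsilon> ^ 3 + 2 * \<epsilon>"
proof -
  define x y where "x = real n" and "y = real d"
  have xy: "1 \<le> x" "1 \<le> y" using n d by (auto simp: x_def y_def)
  define \<eta> where "\<eta> = \<epsilon> / sqrt y"
  have \<eta>: "0 < \<eta>" "\<eta> \<le> \<epsilon>" using \<epsilon> xy by (auto simp: \<eta>_def divide_le_eq)
  have \<eta>2: "\<eta>\<^sup>2 = \<epsilon>\<^sup>2 / y" using xy by (simp add: \<eta>_def power_divide)
  have sq_le: "\<bar>s\<bar> \<le> t" if "s\<^sup>2 \<le> t\<^sup>2" "0 \<le> t" for s t :: real
    using that abs_le_square_iff[of s t] by simp
  define H where "H a b = (\<Sum>k=1..n. \<xi> k a * \<xi> k b) - x * V a b" for a b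
  have frob: "(\<Sum>a<d. \<Sum>b<d. (H a b)\<^sup>2) \<le> (x * \<eta>)\<^sup>2"
  proof -
    have "(\<Sum>k=1..n. trunc_outer d B (\<xi> k) a b - V a b) = H a b" for a b
    proof -
      have "(\<Sum>k=1..n. trunc_outer d B (\<xi> k) a b - V a b) = (\<Sum>k=1..n. \<xi> k a * \<xi> k b - V a b)"
        using A1 by (intro sum.cong) (auto simp: trunc_outer_def)
      then show ?thesis by (simp add: H_def sum_subtractf x_def)
    qed
    then show ?thesis
      using A3 unfolding frob_dev_def power_mult_distrib \<eta>2 by (simp add: x_def y_def)
  qed
  have qf: "\<bar>(\<Sum>j=1..n. (dot d u (\<xi> j))\<^sup>2) - real n * (enorm d u)\<^sup>2\<bar> \<le> (2 * \<eta>) * (real n * (enorm d u)\<^sup>2)" for u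
  proof -
    have "(\<Sum>j=1..n. (dot d u (\<xi> j))\<^sup>2) = (\<Sum>j=1..n. \<Sum>a<d. \<Sum>b<d. u a * u b * (\<xi> j a * \<xi> j b))"
      by (simp add: dot_def power2_eq_square sum_product mult_ac)
    also have "... = (\<Sum>a<d. \<Sum>j=1..n. \<Sum>b<d. u a * u b * (\<xi> j a * \<xi> j b))" by (rule sum.swap)
    also have "... = (\<Sum>a<d. \<Sum>b<d. \<Sum>j=1..n. u a * u b * (\<xi> j a * \<xi> j b))"
      by (intro sum.cong refl sum.swap)
    also have "... = (\<Sum>a<d. \<Sum>b<d. u a * u b * H a b) + x * quad_form d V u"
      by (simp add: H_def quad_form_def sum_distrib_left sum.distrib[symmetric] algebra_simps)
    finally have eq: "(\<Sum>j=1..n. (dot d u (\<xi> j))\<^sup>2) - x * (enorm d u)\<^sup>2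
       = (\<Sum>a<d. \<Sum>b<d. u a * u b * H a b) + x * (quad_form d V u - (enorm d u)\<^sup>2)"
      by (simp add: algebra_simps)
    have "(\<Sum>a<d. \<Sum>b<d. u a * u b * H a b)\<^sup>2 \<le> ((enorm d u)\<^sup>2)\<^sup>2 * (x * \<eta>)\<^sup>2"
      by (rule order_trans[OF quad_form_le_frobenius]) (intro mult_left_mono frob, simp)
    then have "(\<Sum>a<d. \<Sum>b<d. u a * u b * H a b)\<^sup>2 \<le> ((enorm d u)\<^sup>2 * (x * \<eta>))\<^sup>2"
      by (simp add: power_mult_distrib)
    then have 1: "\<bar>\<Sum>a<d. \<Sum>b<d. u a * u b * H a b\<bar> \<le> (enorm d u)\<^sup>2 * (x * \<eta>)"
      by (rule sq_le) (use xy \<eta> in simp)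
    have 2: "\<bar>x * (quad_form d V u - (enorm d u)\<^sup>2)\<bar> \<le> x * (\<eta> * (enorm d u)\<^sup>2)"
      using V(1)[of u] xy unfolding abs_mult by (intro mult_mono) (auto simp: \<eta>_def y_def)
    have "\<bar>(\<Sum>j=1..n. (dot d u (\<xi> j))\<^sup>2) - x * (enorm d u)\<^sup>2\<bar>
        \<le> (enorm d u)\<^sup>2 * (x * \<eta>) + x * (\<eta> * (enorm d u)\<^sup>2)"
      unfolding eq by (rule order_trans[OF abs_triangle_ineq add_mono[OF 1 2]])
    also have "... = (2 * \<eta>) * (x * (enorm d u)\<^sup>2)" by (simp add: algebra_simps)
    finally show ?thesis by (simp only: x_def)
  qed
  \<comment> \<open>This exchanges the diagonal sum removed in \<open>offdiag\<close> for the
    centring \<open>d\<close>. The Frobenius bound loses a factor \<open>sqrt d\<close> on the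
    trace, which the \<open>1 / sqrt d\<close> in \<open>\<eta>\<close> makes up for.\<close>
  have tr: "\<bar>(\<Sum>k=1..n. (enorm d (\<xi> k))\<^sup>2) / x - y\<bar> \<le> 2 * \<epsilon>"
  proof -
    have "(\<Sum>k=1..n. (enorm d (\<xi> k))\<^sup>2) = (\<Sum>a<d. \<Sum>k=1..n. \<xi> k a * \<xi> k a)"
      unfolding enorm_sq unfolding power2_eq_square by (rule sum.swap)
    then have eq: "(\<Sum>k=1..n. (enorm d (\<xi> k))\<^sup>2) - x * y = (\<Sum>a<d. H a a) + x * ((\<Sum>a<d. V a a) - y)"
      by (simp add: H_def sum_subtractf sum_distrib_left algebra_simps)
    have "(\<Sum>a<d. H a a)\<^sup>2 \<le> y * (x * \<eta>)\<^sup>2"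
      by (rule order_trans[OF trace_le_frobenius]) (use frob xy in \<open>simp add: y_def mult_left_mono\<close>)
    also have "... = (x * \<epsilon>)\<^sup>2" unfolding power_mult_distrib \<eta>2 using xy by simp
    finally have 1: "\<bar>\<Sum>a<d. H a a\<bar> \<le> x * \<epsilon>" by (rule sq_le) (use xy \<epsilon> in simp)
    have "\<bar>x * ((\<Sum>a<d. V a a) - y)\<bar> \<le> x * \<epsilon>"
      using V(2) \<eta>(2) xy unfolding abs_mult by (intro mult_mono) (auto simp: \<eta>_def y_def)
    then have "\<bar>(\<Sum>k=1..n. (enorm d (\<xi> k))\<^sup>2) - x * y\<bar> \<le> x * (2 * \<epsilon>)" using 1 unfolding eq by linarith
    moreover have "(\<Sum>k=1..n. (enorm d (\<xi> k))\<^sup>2) / x - y = ((\<Sum>k=1..n. (enorm d (\<xi> k))\<^sup>2) - x * y) / x"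
      using xy by (simp add: field_simps)
    ultimately show ?thesis using xy by (simp add: pos_divide_le_eq mult.commute)
  qed

  define xb where "xb = (\<lambda>i. (\<Sum>j=1..n. \<xi> j i) / real n)"
  have xb: "(enorm d xb)\<^sup>2 = (enorm d (psum {1..n} \<xi>))\<^sup>2 / x\<^sup>2"
    by (simp add: enorm_sq xb_def psum_def power_divide x_def flip: sum_divide_distrib)
  then have xb_le: "(enorm d xb)\<^sup>2 \<le> K * y / x"
    using A4 xy by (simp add: divide_le_eq power2_eq_square x_def y_def mult_ac)
  have N2: "real n * (enorm d xb)\<^sup>2 = (enorm d (psum {1..n} \<xi>))\<^sup>2 / x"
    unfolding xb using xy by (simp add: x_def power2_eq_square)
  have N2_le: "real n * (enorm d xb)\<^sup>2 \<le> K * y"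
    unfolding N2 using A4 xy by (simp add: divide_le_eq x_def y_def mult_ac)
  have B4: "B ^ 4 = \<epsilon> ^ 4 * x\<^sup>2 / y\<^sup>2"
  proof -
    have "sqrt (x / y) ^ 4 = (x / y)\<^sup>2"
      using power_mult[of "sqrt (x / y)" 2 2] xy by simp
    then show ?thesis unfolding B by (simp add: power_mult_distrib power_divide x_def y_def)
  qed
  have xb4: "enorm d xb ^ 4 \<le> K\<^sup>2 * y\<^sup>2 / x\<^sup>2"
  proof -
    have "enorm d xb ^ 4 = ((enorm d xb)\<^sup>2)\<^sup>2" by simp
    also have "... \<le> (K * y / x)\<^sup>2" using xb_le by (intro power_mono) auto
    finally show ?thesis by (simp add: power_mult_distrib power_divide)
  qed
  have xb_abs: "enorm d xb \<le> sqrt K * sqrt (y / x)"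
    using real_le_rsqrt[OF xb_le] by (simp add: real_sqrt_mult real_sqrt_divide)
  have F2: "real n * enorm d xb ^ 4 \<le> B ^ 4"
  proof -
    have "real n * enorm d xb ^ 4 \<le> x * (K\<^sup>2 * y\<^sup>2 / x\<^sup>2)"
      unfolding x_def[symmetric] using xb4 xy by (intro mult_left_mono) auto
    also have "... = K\<^sup>2 * y ^ 4 / (x * y\<^sup>2)"
      using xy by (simp add: field_simps eval_nat_numeral)
    also have "... \<le> \<epsilon> ^ 4 * x ^ 3 / (x * y\<^sup>2)"
      using c(2) xy by (intro divide_right_mono) (auto simp: x_def y_def)
    also have "... = B ^ 4" unfolding B4 using xy by (simp add: field_simps eval_nat_numeral)
    finally show ?thesis .
  qed
  \<comment> \<open>The scales of the mean and of the truncation level are reciprocal,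
    \<open>sqrt (y / x)\<close> against \<open>sqrt (x / y)\<close>, so only
    \<open>sqrt K * \<epsilon>\<close> remains.\<close>
  have small1: "enorm d xb * enorm d (\<xi> j) \<le> 1/8" if "j \<in> {1..n}" for j
  proof -
    have "enorm d xb * enorm d (\<xi> j) \<le> (sqrt K * sqrt (y / x)) * B"
      using xb_abs A1[OF that] xy K by (intro mult_mono) auto
    also have "... = sqrt K * \<epsilon> * (sqrt (y / x) * sqrt (x / y))"
      unfolding B by (simp add: x_def y_def)
    also have "sqrt (y / x) * sqrt (x / y) = 1"
      unfolding real_sqrt_mult[symmetric] using xy by simp
    finally show ?thesis using K by simp
  qed
  have small2: "(enorm d xb)\<^sup>2 \<le> 2 * \<eta>"
  proof -
    have "K * y * sqrt y \<le> K * y * y"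
      using xy K by (intro mult_left_mono) (auto intro: real_le_lsqrt simp: power2_eq_square mult_left_mono)
    also have "... \<le> 2 * \<epsilon> * x" using c(1) by (simp add: x_def y_def power2_eq_square)
    finally have "K * y / x \<le> 2 * \<eta>"
      using xy by (simp add: \<eta>_def field_simps)
    then show ?thesis using xb_le by linarith
  qed
  obtain v where v: "- 2 * ext_ln (emp_lik n d \<xi>) = ereal v"
    and "\<bar>v - real n * (enorm d xb)\<^sup>2\<bar> \<le>
      (4 * (2 * \<eta>) + 2 * \<eta>) * (real n * (enorm d xb)\<^sup>2) + 256 * enorm d xb ^ 4 * B ^ 4 / \<eta>"
    using emp_lik_expansion[of n "2 * \<eta>" d \<xi> "B ^ 4" \<eta>, folded xb_def] n \<eta> \<epsilon> qf small1 small2 A2 F2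
    by force
  note this(2)
  also have "(4 * (2 * \<eta>) + 2 * \<eta>) * (real n * (enorm d xb)\<^sup>2) \<le> (4 * (2 * \<eta>) + 2 * \<eta>) * (K * y)"
    using N2_le \<eta> by (intro mult_left_mono) auto
  also have "256 * enorm d xb ^ 4 * B ^ 4 / \<eta> \<le> 256 * (K\<^sup>2 * y\<^sup>2 / x\<^sup>2) * B ^ 4 / \<eta>"
    using xb4 \<eta> by (intro divide_right_mono mult_right_mono mult_left_mono) auto
  also have "256 * (K\<^sup>2 * y\<^sup>2 / x\<^sup>2) * B ^ 4 / \<eta> = 256 * K\<^sup>2 * \<epsilon> ^ 3 * sqrt y"
    unfolding B4 \<eta>_def using xy \<epsilon> by (simp add: field_simps eval_nat_numeral)
  also have "(4 * (2 * \<eta>) + 2 * \<eta>) * (K * y) = 10 * K * \<epsilon> * sqrt y"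
  proof -
    have "y / sqrt y = sqrt y" using xy by (simp add: real_div_sqrt)
    then have "\<eta> * y = \<epsilon> * sqrt y" by (simp add: \<eta>_def times_divide_eq_right[symmetric] del: times_divide_eq_right)
    then have "10 * K * (\<eta> * y) = 10 * K * (\<epsilon> * sqrt y)" by simp
    then show ?thesis by (simp add: mult_ac)
  qed
  finally have vN: "\<bar>v - real n * (enorm d xb)\<^sup>2\<bar> \<le> (10 * K * \<epsilon> + 256 * K\<^sup>2 * \<epsilon> ^ 3) * sqrt y"
    by (simp add: algebra_simps)
  have "\<bar>(v - y) - offdiag d {1..n} \<xi> / x\<bar> \<le> (10 * K * \<epsilon> + 256 * K\<^sup>2 * \<epsilon> ^ 3) * sqrt y + 2 * \<epsilon>"
  proof -
    have "(v - y) - offdiag d {1..n} \<xi> / x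
      = (v - real n * (enorm d xb)\<^sup>2) + ((\<Sum>k=1..n. (enorm d (\<xi> k))\<^sup>2) / x - y)"
      unfolding N2 offdiag_def by (simp add: diff_divide_distrib)
    then show ?thesis using vN tr by linarith
  qed
  also have "... \<le> (10 * K * \<epsilon> + 256 * K\<^sup>2 * \<epsilon> ^ 3) * sqrt y + 2 * \<epsilon> * sqrt y"
    using \<epsilon> xy by simp
  also have "... \<le> (10 * K * \<epsilon> + 256 * K\<^sup>2 * \<epsilon> ^ 3 + 2 * \<epsilon>) * sqrt (2 * y)"
    unfolding distrib_right[symmetric] using \<epsilon> K xy by (intro mult_left_mono) auto
  finally have "\<bar>(v - y) - offdiag d {1..n} \<xi> / x\<bar> / sqrt (2 * y) \<le> 10 * K * \<epsilon> + 256 * K\<^sup>2 * \<epsilon> ^ 3 + 2 * \<epsilon>"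
    using xy by (simp add: divide_le_eq)
  moreover have "\<bar>(v - y) - offdiag d {1..n} \<xi> / x\<bar> / sqrt (2 * y)
     = \<bar>(v - y) / sqrt (2 * y) - offdiag d {1..n} \<xi> / (x * sqrt (2 * y))\<bar>"
  proof -
    have "(v - y) / sqrt (2 * y) - offdiag d {1..n} \<xi> / (x * sqrt (2 * y))
      = ((v - y) - offdiag d {1..n} \<xi> / x) / sqrt (2 * y)"
      by (simp add: diff_divide_distrib)
    then show ?thesis using xy by (simp add: abs_divide)
  qed
  ultimately show ?thesis using v by (auto simp: x_def y_def)
qed


section \<open>Probability of the good event\<close>

lemma (in prob_space) prob_gt_le_nn_integral:
  fixes f :: "'a \<Rightarrow> real"
  assumes f: "f \<in> borel_measurable M" "\<And>x. 0 \<le> f x"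
    and v: "(\<integral>\<^sup>+x. ennreal (f x) \<partial>M) \<le> ennreal v" "0 \<le> v" and c: "0 < c"
  shows "prob {x \<in> space M. c < f x} \<le> v / c"
proof -
  have int: "integrable M f"
    by (rule integrableI_nonneg) (use f v in \<open>auto intro: le_less_trans\<close>)
  have "prob {x \<in> space M. c < f x} \<le> prob {x \<in> space M. c \<le> f x}"
    using f(1) by (intro finite_measure_mono) auto
  also have "... \<le> (\<integral>x. f x \<partial>M) / c"
    by (rule integral_Markov_inequality_measure[OF int sets.empty_sets]) (use f c in auto)
  also have "... \<le> v / c"
    using nn_integral_eq_integral[OF int] f v c by (intro divide_right_mono) auto
  finally show ?thesis .
qed

text \<open>A negative power decreases. The inequality controls the bias caused by truncating at
  \<open>B\<close>.\<close>

lemma sq_le_powr_tail: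
  fixes e B r :: real
  assumes "0 < B" "B < e" "2 < r"
  shows "e\<^sup>2 \<le> B powr (2 - r) * e powr r"
proof -
  have "e\<^sup>2 = e powr (2 - r) * e powr r" using assms by (simp add: powr_add[symmetric])
  also have "... \<le> B powr (2 - r) * e powr r"
    using assms by (intro mult_right_mono powr_mono2') auto
  finally show ?thesis .
qed

text \<open>The counterpart below the truncation level: it controls fourth powers, and so the
  variance left after truncating.\<close>

lemma power4_le_powr:
  fixes e B r :: real
  assumes "0 \<le> e" "e \<le> B" "r < 4"
  shows "e ^ 4 \<le> B powr (4 - r) * e powr r"
proof (cases "e = 0")
  case False
  then have "e ^ 4 = e powr (4 - r) * e powr r" using assms by (simp add: powr_add[symmetric])
  also have "... \<le> B powr (4 - r) * e powr r"
    using assms by (intro mult_right_mono powr_mono2) auto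
  finally show ?thesis .
qed simp

section \<open>Bias and fluctuation of the truncated second moment matrix\<close>

context
  fixes d :: nat and \<nu> :: "(nat \<Rightarrow> real) measure" and r Kr B :: real
  assumes iso: "isotropic d \<nu>" and r: "2 < r" "r < 4"
    and mom: "integrable \<nu> (\<lambda>y. enorm d y powr r)" "(\<integral>y. enorm d y powr r \<partial>\<nu>) \<le> Kr"
    and B: "0 < B"
begin

definition trunc_cov :: "nat \<Rightarrow> nat \<Rightarrow> real" where
  "trunc_cov a b = (\<integral>y. trunc_outer d B y a b \<partial>\<nu>)"

lemma trunc_outer_measurable:
  assumes "a < d" "b < d"
  shows "(\<lambda>y. trunc_outer d B y a b) \<in> borel_measurable \<nu>"
proof -
  note [measurable] = isotropic_coord_measurable[OF iso assms(1)] isotropic_coord_measurable[OF iso assms(2)]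
    isotropic_enorm_measurable[OF iso]
  show ?thesis unfolding trunc_outer_def by measurable
qed

lemma trunc_outer_integrable:
  assumes "a < d" "b < d"
  shows "integrable \<nu> (\<lambda>y. trunc_outer d B y a b)"
proof (rule Bochner_Integration.integrable_bound)
  show "integrable \<nu> (\<lambda>y. y a * y b)" using iso assms by (simp add: isotropic_def)
qed (use trunc_outer_measurable[OF assms] in \<open>auto simp: trunc_outer_def\<close>)

lemma trunc_quad:
  "(\<Sum>a<d. \<Sum>b<d. u a * u b * trunc_outer d B y a b) = (if enorm d y \<le> B then (dot d u y)\<^sup>2 else 0)"
  by (simp add: trunc_outer_def dot_def power2_eq_square sum_product mult_ac)

text \<open>Truncation changes the integrand only where |y| > B, and there the squared linear form
  is at most |u|^2 |y|^2, which the r-th moment bounds.\<close>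

lemma trunc_cov_quad_form:
  "\<bar>quad_form d trunc_cov u - (enorm d u)\<^sup>2\<bar> \<le> B powr (2 - r) * Kr * (enorm d u)\<^sup>2"
proof -
  interpret prob_space \<nu> using iso by (rule isotropic_prob_space)
  let ?g = "\<lambda>y. \<Sum>a<d. \<Sum>b<d. u a * u b * trunc_outer d B y a b"
  have int: "integrable \<nu> (\<lambda>y. u a * u b * trunc_outer d B y a b)" if "a < d" "b < d" for a b
    by (intro integrable_mult_right trunc_outer_integrable that)
  have gi: "integrable \<nu> ?g" by (rule integral_double_sum(1)[OF int])
  have "(\<integral>y. ?g y \<partial>\<nu>) = (\<Sum>a<d. \<Sum>b<d. \<integral>y. u a * u b * trunc_outer d B y a b \<partial>\<nu>)"
    by (rule integral_double_sum(2)[OF int])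
  also have "... = quad_form d trunc_cov u"
    by (simp add: quad_form_def trunc_cov_def mult_ac)
  finally have q: "quad_form d trunc_cov u = (\<integral>y. ?g y \<partial>\<nu>)" by simp
  note d2 = isotropic_dot_sq[OF iso, of u]
  have "quad_form d trunc_cov u - (enorm d u)\<^sup>2 = (\<integral>y. ?g y - (dot d u y)\<^sup>2 \<partial>\<nu>)"
    unfolding q d2(2)[symmetric] using gi d2(1) by simp
  also have "\<bar>...\<bar> \<le> (\<integral>y. (enorm d u)\<^sup>2 * (B powr (2 - r) * enorm d y powr r) \<partial>\<nu>)"
  proof (rule order_trans[OF integral_abs_bound integral_mono])
    fix y
    show "\<bar>?g y - (dot d u y)\<^sup>2\<bar> \<le> (enorm d u)\<^sup>2 * (B powr (2 - r) * enorm d y powr r)"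
    proof (cases "enorm d y \<le> B")
      case False
      have "(dot d u y)\<^sup>2 \<le> (enorm d u * enorm d y)\<^sup>2"
        using abs_dot_le[of d u y] by (simp add: abs_le_square_iff[symmetric])
      also have "... \<le> (enorm d u)\<^sup>2 * (B powr (2 - r) * enorm d y powr r)"
        unfolding power_mult_distrib using False B r by (intro mult_left_mono sq_le_powr_tail) auto
      finally show ?thesis using False by (simp add: trunc_quad)
    qed (simp add: trunc_quad)
  qed (use gi d2(1) mom(1) in auto)
  also have "... = B powr (2 - r) * (\<integral>y. enorm d y powr r \<partial>\<nu>) * (enorm d u)\<^sup>2" by simp
  also have "... \<le> B powr (2 - r) * Kr * (enorm d u)\<^sup>2"
    using mom(2) by (intro mult_right_mono mult_left_mono) auto
  finally show ?thesis .
qed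

text \<open>The trace is taken inside the integral; summing \<open>trunc_cov_quad_form\<close> over
  the unit vectors would cost another factor \<open>d\<close>.\<close>

lemma trunc_cov_trace: "\<bar>(\<Sum>a<d. trunc_cov a a) - real d\<bar> \<le> B powr (2 - r) * Kr"
proof -
  interpret prob_space \<nu> using iso by (rule isotropic_prob_space)
  let ?g = "\<lambda>y. \<Sum>a<d. trunc_outer d B y a a"
  have g: "?g y = (if enorm d y \<le> B then (enorm d y)\<^sup>2 else 0)" for y
    unfolding enorm_sq by (simp add: trunc_outer_def power2_eq_square)
  have gi: "integrable \<nu> ?g" by (intro Bochner_Integration.integrable_sum trunc_outer_integrable) auto
  note e2 = isotropic_enorm_sq[OF iso]
  have "(\<Sum>a<d. trunc_cov a a) = (\<integral>y. ?g y \<partial>\<nu>)"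
    unfolding trunc_cov_def
    by (intro Bochner_Integration.integral_sum[symmetric] trunc_outer_integrable) auto
  then have "(\<Sum>a<d. trunc_cov a a) - real d = (\<integral>y. ?g y - (enorm d y)\<^sup>2 \<partial>\<nu>)"
    using gi e2 by simp
  also have "\<bar>...\<bar> \<le> (\<integral>y. B powr (2 - r) * enorm d y powr r \<partial>\<nu>)"
  proof (rule order_trans[OF integral_abs_bound integral_mono])
    fix y
    show "\<bar>?g y - (enorm d y)\<^sup>2\<bar> \<le> B powr (2 - r) * enorm d y powr r"
      unfolding g using sq_le_powr_tail[of B "enorm d y" r] B r by auto
  qed (use gi e2(1) mom(1) in auto)
  also have "... \<le> B powr (2 - r) * Kr"
    using mom(2) by (simp add: mult_left_mono)
  finally show ?thesis .
qed

text \<open>The squared Frobenius norm of the outer product of \<open>y\<close> with itself is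
  |y|^4, and truncation lowers the fourth power to an r-th one.\<close>

lemma trunc_outer_sq_sum_le:
  "(\<Sum>a<d. \<Sum>b<d. (trunc_outer d B y a b)\<^sup>2) \<le> B powr (4 - r) * enorm d y powr r"
proof (cases "enorm d y \<le> B")
  case True
  then have "(\<Sum>a<d. \<Sum>b<d. (trunc_outer d B y a b)\<^sup>2) = (\<Sum>a<d. \<Sum>b<d. (y a)\<^sup>2 * (y b)\<^sup>2)"
    by (simp add: trunc_outer_def power_mult_distrib)
  also have "... = ((enorm d y)\<^sup>2)\<^sup>2"
    unfolding enorm_sq by (simp only: power2_eq_square[of "sum _ _"] sum_product)
  also have "... = enorm d y ^ 4" by simp
  finally show ?thesis using power4_le_powr[OF enorm_nonneg True r(2)] by simp
qed (simp add: trunc_outer_def)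

lemma trunc_outer_variance:
  assumes "a < d" "b < d"
  shows "integrable \<nu> (\<lambda>y. (trunc_outer d B y a b)\<^sup>2)"
    and "integrable \<nu> (\<lambda>y. (trunc_outer d B y a b - trunc_cov a b)\<^sup>2)"
    and "(\<integral>y. (trunc_outer d B y a b - trunc_cov a b)\<^sup>2 \<partial>\<nu>) \<le> (\<integral>y. (trunc_outer d B y a b)\<^sup>2 \<partial>\<nu>)"
proof -
  interpret prob_space \<nu> using iso by (rule isotropic_prob_space)
  note [measurable] = trunc_outer_measurable[OF assms]
  have le: "(trunc_outer d B y a b)\<^sup>2 \<le> B powr (4 - r) * enorm d y powr r" for y
  proof -
    have "(trunc_outer d B y a b)\<^sup>2 \<le> (\<Sum>b<d. (trunc_outer d B y a b)\<^sup>2)"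
      using assms by (intro member_le_sum) auto
    also have "... \<le> (\<Sum>a<d. \<Sum>b<d. (trunc_outer d B y a b)\<^sup>2)"
      using assms by (intro member_le_sum[of a _ "\<lambda>a. \<Sum>b<d. (trunc_outer d B y a b)\<^sup>2"]) (auto intro: sum_nonneg)
    also have "... \<le> B powr (4 - r) * enorm d y powr r" by (rule trunc_outer_sq_sum_le)
    finally show ?thesis .
  qed
  show sq: "integrable \<nu> (\<lambda>y. (trunc_outer d B y a b)\<^sup>2)"
    by (rule Bochner_Integration.integrable_bound[where f="\<lambda>y. B powr (4 - r) * enorm d y powr r"])
       (use mom(1) le in auto)
  note i1 = trunc_outer_integrable[OF assms]
  show "integrable \<nu> (\<lambda>y. (trunc_outer d B y a b - trunc_cov a b)\<^sup>2)"
    unfolding power2_diff using i1 sq by auto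
  have "(\<integral>y. (trunc_outer d B y a b - trunc_cov a b)\<^sup>2 \<partial>\<nu>)
     = (\<integral>y. (trunc_outer d B y a b)\<^sup>2 \<partial>\<nu>) - (trunc_cov a b)\<^sup>2"
    unfolding power2_diff using i1 sq
    by (simp add: prob_space trunc_cov_def[symmetric] power2_eq_square)
  then show "(\<integral>y. (trunc_outer d B y a b - trunc_cov a b)\<^sup>2 \<partial>\<nu>) \<le> (\<integral>y. (trunc_outer d B y a b)\<^sup>2 \<partial>\<nu>)"
    by simp
qed

lemma frob_dev_measurable: "frob_dev d B V n \<in> borel_measurable (PiM {1..n} (\<lambda>_. \<nu>))"
  unfolding frob_dev_def[abs_def]
  by (intro borel_measurable_sum borel_measurable_power borel_measurable_diff
      measurable_compose[OF _ trunc_outer_measurable] measurable_component_singleton) auto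

text \<open>The entrywise variances are replaced by second moments and summed before being
  estimated, so the whole matrix costs a single truncated moment of |y|^4 and no factor of the
  dimension appears.\<close>

lemma nn_integral_frob_dev_le:
  "(\<integral>\<^sup>+\<xi>. ennreal (frob_dev d B trunc_cov n \<xi>) \<partial>PiM {1..n} (\<lambda>_. \<nu>))
     \<le> ennreal (real n * (B powr (4 - r) * Kr))"
proof -
  interpret prob_space \<nu> using iso by (rule isotropic_prob_space)
  let ?f = "\<lambda>a b y. trunc_outer d B y a b - trunc_cov a b"
  let ?P = "PiM {1..n} (\<lambda>_. \<nu>)"
  have meas: "(\<lambda>\<xi>. (\<Sum>k=1..n. ?f a b (\<xi> k))\<^sup>2) \<in> borel_measurable ?P" if "a < d" "b < d" for a b
    by (intro borel_measurable_sum borel_measurable_power borel_measurable_diff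
      measurable_compose[OF _ trunc_outer_measurable] measurable_component_singleton that) auto
  have "(\<integral>\<^sup>+\<xi>. ennreal (frob_dev d B trunc_cov n \<xi>) \<partial>?P)
     = (\<integral>\<^sup>+\<xi>. (\<Sum>a<d. \<Sum>b<d. ennreal ((\<Sum>k=1..n. ?f a b (\<xi> k))\<^sup>2)) \<partial>?P)"
    unfolding frob_dev_def by (simp add: sum_ennreal sum_nonneg)
  also have "... = (\<Sum>a<d. \<integral>\<^sup>+\<xi>. (\<Sum>b<d. ennreal ((\<Sum>k=1..n. ?f a b (\<xi> k))\<^sup>2)) \<partial>?P)"
    by (intro nn_integral_sum borel_measurable_sum measurable_compose[OF meas measurable_ennreal]) simp_all
  also have "... = (\<Sum>a<d. \<Sum>b<d. \<integral>\<^sup>+\<xi>. ennreal ((\<Sum>k=1..n. ?f a b (\<xi> k))\<^sup>2) \<partial>?P)"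
    by (intro sum.cong refl nn_integral_sum measurable_compose[OF meas measurable_ennreal]) simp_all
  also have "... \<le> (\<Sum>a<d. \<Sum>b<d. ennreal (real n * (\<integral>y. (trunc_outer d B y a b)\<^sup>2 \<partial>\<nu>)))"
  proof (intro sum_mono)
    fix a b assume "a \<in> {..<d}" "b \<in> {..<d}"
    then have ab: "a < d" "b < d" by auto
    have "(\<integral>\<^sup>+\<xi>. ennreal ((\<Sum>k=1..n. ?f a b (\<xi> k))\<^sup>2) \<partial>?P)
      = ennreal (real (card {1..n}) * (\<integral>y. (?f a b y)\<^sup>2 \<partial>\<nu>))"
      by (rule nn_integral_sum_sq_PiM)
         (use trunc_outer_integrable[OF ab] trunc_outer_variance[OF ab] prob_space_axioms
          in \<open>auto simp: prob_space trunc_cov_def\<close>)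
    also have "... \<le> ennreal (real n * (\<integral>y. (trunc_outer d B y a b)\<^sup>2 \<partial>\<nu>))"
      using trunc_outer_variance(3)[OF ab] by (intro ennreal_leI) (simp add: mult_left_mono)
    finally show "(\<integral>\<^sup>+\<xi>. ennreal ((\<Sum>k=1..n. ?f a b (\<xi> k))\<^sup>2) \<partial>?P)
       \<le> ennreal (real n * (\<integral>y. (trunc_outer d B y a b)\<^sup>2 \<partial>\<nu>))" .
  qed
  also have "... = ennreal (real n * (\<Sum>a<d. \<Sum>b<d. \<integral>y. (trunc_outer d B y a b)\<^sup>2 \<partial>\<nu>))"
    by (simp add: sum_ennreal sum_nonneg sum_distrib_left)
  also have "... \<le> ennreal (real n * (B powr (4 - r) * Kr))"
  proof (intro ennreal_leI mult_left_mono)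
    let ?g = "\<lambda>y. \<Sum>a<d. \<Sum>b<d. (trunc_outer d B y a b)\<^sup>2"
    have gi: "integrable \<nu> ?g"
      by (rule integral_double_sum(1)[OF trunc_outer_variance(1)])
    have "(\<Sum>a<d. \<Sum>b<d. \<integral>y. (trunc_outer d B y a b)\<^sup>2 \<partial>\<nu>) = (\<integral>y. ?g y \<partial>\<nu>)"
      by (rule integral_double_sum(2)[OF trunc_outer_variance(1), symmetric])
    also have "... \<le> (\<integral>y. B powr (4 - r) * enorm d y powr r \<partial>\<nu>)"
      using gi mom(1) by (intro integral_mono trunc_outer_sq_sum_le) auto
    also have "... \<le> B powr (4 - r) * Kr" using mom(2) by (simp add: mult_left_mono)
    finally show "(\<Sum>a<d. \<Sum>b<d. \<integral>y. (trunc_outer d B y a b)\<^sup>2 \<partial>\<nu>) \<le> B powr (4 - r) * Kr" .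
  qed simp
  finally show ?thesis .
qed

lemma powr_sum_measurable:
  "(\<lambda>\<xi>. \<Sum>k=1..n. enorm d (\<xi> k) powr r) \<in> borel_measurable (PiM {1..n} (\<lambda>_. \<nu>))"
  by (intro borel_measurable_sum measurable_compose[OF _ borel_measurable_integrable[OF mom(1)]]
      measurable_component_singleton)

lemma nn_integral_powr_sum_le:
  "(\<integral>\<^sup>+\<xi>. ennreal (\<Sum>k=1..n. enorm d (\<xi> k) powr r) \<partial>PiM {1..n} (\<lambda>_. \<nu>)) \<le> ennreal (real n * Kr)"
proof -
  let ?P = "PiM {1..n} (\<lambda>_. \<nu>)"
  have p: "prob_space \<nu>" using iso by (rule isotropic_prob_space)
  have K0: "0 \<le> Kr" by (rule order_trans[OF _ mom(2)]) simp
  have em: "(\<lambda>y. ennreal (enorm d y powr r)) \<in> borel_measurable \<nu>"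
    using mom(1) by auto
  have "(\<integral>\<^sup>+\<xi>. ennreal (\<Sum>k=1..n. enorm d (\<xi> k) powr r) \<partial>?P)
      = (\<integral>\<^sup>+\<xi>. (\<Sum>k=1..n. ennreal (enorm d (\<xi> k) powr r)) \<partial>?P)"
    by (simp add: sum_ennreal)
  also have "... = (\<Sum>k=1..n. \<integral>\<^sup>+\<xi>. ennreal (enorm d (\<xi> k) powr r) \<partial>?P)"
    by (intro nn_integral_sum measurable_compose[OF _ em] measurable_component_singleton)
  also have "... \<le> (\<Sum>k=1..n. ennreal Kr)"
  proof (rule sum_mono)
    fix k assume k: "k \<in> {1..n}"
    have "(\<integral>\<^sup>+\<xi>. ennreal (enorm d (\<xi> k) powr r) \<partial>?P)
       = (\<integral>\<^sup>+y. ennreal (enorm d y powr r) \<partial>distr ?P \<nu> (\<lambda>\<xi>. \<xi> k))"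
      using k by (intro nn_integral_distr[symmetric] measurable_component_singleton) (use em in auto)
    also have "distr ?P \<nu> (\<lambda>\<xi>. \<xi> k) = \<nu>" using k p by (intro distr_PiM_component) auto
    also have "(\<integral>\<^sup>+y. ennreal (enorm d y powr r) \<partial>\<nu>) \<le> ennreal Kr"
      using nn_integral_eq_integral[OF mom(1)] mom(2) by (simp add: ennreal_leI)
    finally show "(\<integral>\<^sup>+\<xi>. ennreal (enorm d (\<xi> k) powr r) \<partial>?P) \<le> ennreal Kr" .
  qed
  also have "... = ennreal (real n * Kr)"
    using K0 by (simp add: ennreal_mult ennreal_of_nat_eq_real_of_nat)
  finally show ?thesis .
qed

end

text \<open>The number \<open>A\<close> bounds two of the three bad events and, through
  \<open>Kr = A * B^r / n\<close>, also the truncation bias. The third event, a large squared norm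
  of the sum, has probability at most \<open>1 / K\<close> by Markov's inequality.\<close>

lemma emp_lik_close_to_offdiag:
  fixes r C \<epsilon> K B A :: real
  assumes iso: "isotropic d \<nu>" and r: "2 < r" "r < 4"
    and mom: "integrable \<nu> (\<lambda>y. enorm d y powr r)" "(\<integral>y. enorm d y powr r \<partial>\<nu>) \<le> Kr"
    and n: "n \<ge> 1" and d: "d \<ge> 1" and \<epsilon>: "0 < \<epsilon>" "\<epsilon> \<le> 1/16" and K: "0 < K" "sqrt K * \<epsilon> \<le> 1/8"
    and B: "B = \<epsilon> * sqrt (real n / real d)"
    and c: "K * (real d)\<^sup>2 \<le> 2 * \<epsilon> * real n" "K\<^sup>2 * real d ^ 4 \<le> \<epsilon> ^ 4 * real n ^ 3"
    and A: "A = real n * Kr / B powr r" "A \<le> 1"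
  shows "\<exists>G\<in>sets (PiM {1..n} (\<lambda>_. \<nu>)).
    measure (PiM {1..n} (\<lambda>_. \<nu>)) (space (PiM {1..n} (\<lambda>_. \<nu>)) - G) \<le> 2 * A + 1 / K \<and>
    (\<forall>\<xi>\<in>G. \<exists>v. - 2 * ext_ln (emp_lik n d \<xi>) = ereal v \<and>
    \<bar>(v - real d) / sqrt (2 * real d) - offdiag d {1..n} \<xi> / (real n * sqrt (2 * real d))\<bar>
      \<le> 10 * K * \<epsilon> + 256 * K\<^sup>2 * \<epsilon> ^ 3 + 2 * \<epsilon>)"
proof -
  let ?P = "PiM {1..n} (\<lambda>_. \<nu>)"
  interpret P: prob_space ?P by (rule isotropic_prob_space_PiM) (rule iso)
  define x y where "x = real n" and "y = real d"
  have xy: "1 \<le> x" "1 \<le> y" using n d by (auto simp: x_def y_def)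
  have B0: "0 < B" using \<epsilon> n d by (simp add: B)
  have K0: "0 \<le> Kr" by (rule order_trans[OF _ mom(2)]) simp
  have A0: "0 \<le> A" using K0 by (simp add: A)
  have B2: "B\<^sup>2 = \<epsilon>\<^sup>2 * x / y" using xy by (simp add: B power_mult_distrib x_def y_def)
  have KrA: "Kr = A * B powr r / x" using xy B0 by (simp add: A x_def)
  define V where "V = trunc_cov d \<nu> B"
  let ?W = "\<lambda>\<xi>. \<Sum>k=1..n. enorm d (\<xi> k) powr r"
  let ?D = "frob_dev d B V n"
  let ?T = "\<lambda>\<xi>. (enorm d (psum {1..n} \<xi>))\<^sup>2"
  have Wm: "?W \<in> borel_measurable ?P" by (rule powr_sum_measurable[OF iso r mom B0])
  have Dm: "?D \<in> borel_measurable ?P" by (rule frob_dev_measurable[OF iso r mom B0])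
  have Tm: "?T \<in> borel_measurable ?P"
    by (intro borel_measurable_power isotropic_PiM_measurable(2)) (rule iso)
  \<comment> \<open>One event controls both the largest norm and the sum of fourth powers: off it,
    the whole sum of r-th powers is at most \<open>B powr r\<close>.\<close>
  define G1 where "G1 = {\<xi> \<in> space ?P. B powr r < ?W \<xi>}"
  define G2 where "G2 = {\<xi> \<in> space ?P. (x * \<epsilon>)\<^sup>2 / y < ?D \<xi>}"
  define G3 where "G3 = {\<xi> \<in> space ?P. K * (x * y) < ?T \<xi>}"
  have sets: "G1 \<in> sets ?P" "G2 \<in> sets ?P" "G3 \<in> sets ?P"
    unfolding G1_def G2_def G3_def using Wm Dm Tm by simp_all
  define G where "G = space ?P - (G1 \<union> G2 \<union> G3)"
  have "P.prob G1 \<le> (x * Kr) / B powr r"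
    unfolding G1_def x_def using B0 K0 nn_integral_powr_sum_le[OF iso r mom B0, of n]
    by (intro P.prob_gt_le_nn_integral Wm) (auto intro: sum_nonneg)
  then have p1: "P.prob G1 \<le> A" by (simp add: A x_def)
  have "P.prob G2 \<le> (x * (B powr (4 - r) * Kr)) / ((x * \<epsilon>)\<^sup>2 / y)"
    unfolding G2_def V_def using B0 K0 \<epsilon> xy nn_integral_frob_dev_le[OF iso r mom B0, of n]
    by (intro P.prob_gt_le_nn_integral Dm[unfolded V_def]) (auto intro!: sum_nonneg simp: frob_dev_def x_def)
  also have "x * (B powr (4 - r) * Kr) = B ^ 4 * A"
  proof -
    have "B powr (4 - r) * B powr r = B ^ 4" using B0 by (simp add: powr_add[symmetric])
    then show ?thesis unfolding KrA using xy by (simp add: field_simps)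
  qed
  also have "B ^ 4 * A / ((x * \<epsilon>)\<^sup>2 / y) = \<epsilon>\<^sup>2 / y * A"
  proof -
    have "B ^ 4 = (\<epsilon>\<^sup>2 * x / y)\<^sup>2" unfolding B2[symmetric] by simp
    then show ?thesis using xy \<epsilon> by (simp add: field_simps power2_eq_square)
  qed
  also have "... \<le> 1 * A"
  proof (rule mult_right_mono)
    have "\<epsilon>\<^sup>2 \<le> 1" using \<epsilon> by (simp add: power_le_one)
    then show "\<epsilon>\<^sup>2 / y \<le> 1" using xy by simp
  qed (rule A0)
  finally have p2: "P.prob G2 \<le> A" by simp
  have "P.prob G3 \<le> (real (card {1..n}) * real d) / (K * (x * y))"
    unfolding G3_def using K xy nn_integral_psum_sq[where \<rho>="\<lambda>_. \<nu>", OF iso, of "{1..n}"]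
    by (intro P.prob_gt_le_nn_integral Tm) auto
  then have p3: "P.prob G3 \<le> 1 / K" using xy by (simp add: x_def y_def)
  have "space ?P - G = G1 \<union> G2 \<union> G3"
    using sets by (auto simp: G_def dest: sets.sets_into_space)
  then have "P.prob (space ?P - G) \<le> P.prob G1 + P.prob G2 + P.prob G3"
    using measure_Un_le[of "G1 \<union> G2" ?P G3] measure_Un_le[of G1 ?P G2] sets by simp
  then have prob: "P.prob (space ?P - G) \<le> 2 * A + 1 / K" using p1 p2 p3 by linarith
  \<comment> \<open>The left side is \<open>B^2 * A / n\<close>, that is
    \<open>\<epsilon>^2 * A / d\<close>, so \<open>A \<le> 1\<close> is enough.\<close>
  have bias: "B powr (2 - r) * Kr \<le> \<epsilon> / sqrt y"
  proof -
    have "B powr (2 - r) * B powr r = B\<^sup>2" using B0 by (simp add: powr_add[symmetric])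
    then have "B powr (2 - r) * Kr = B\<^sup>2 * A / x" unfolding KrA by simp
    also have "... = \<epsilon> * (\<epsilon> * A) / y" unfolding B2 using xy by (simp add: power2_eq_square)
    also have "... \<le> \<epsilon> * 1 / y"
      using \<epsilon> A A0 xy by (intro divide_right_mono mult_left_mono mult_le_one) auto
    also have "... \<le> \<epsilon> / sqrt y"
    proof -
      have "sqrt y \<le> y" using xy by (intro real_le_lsqrt) (auto simp: power2_eq_square)
      then show ?thesis using \<epsilon> xy by (simp add: frac_le)
    qed
    finally show ?thesis .
  qed
  have "\<exists>v. - 2 * ext_ln (emp_lik n d \<xi>) = ereal v \<and>
    \<bar>(v - real d) / sqrt (2 * real d) - offdiag d {1..n} \<xi> / (real n * sqrt (2 * real d))\<bar>
      \<le> 10 * K * \<epsilon> + 256 * K\<^sup>2 * \<epsilon> ^ 3 + 2 * \<epsilon>" if "\<xi> \<in> G" for \<xi>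
  proof (rule emp_lik_close_to_offdiag_det[OF n d \<epsilon> _ K(2) B c])
    have W: "?W \<xi> \<le> B powr r" and D: "?D \<xi> \<le> (x * \<epsilon>)\<^sup>2 / y" and T: "?T \<xi> \<le> K * (x * y)"
      using that by (auto simp: G_def G1_def G2_def G3_def not_less)
    show "0 \<le> K" using K by simp
    fix u
    show "\<bar>quad_form d V u - (enorm d u)\<^sup>2\<bar> \<le> \<epsilon> / sqrt (real d) * (enorm d u)\<^sup>2"
      using trunc_cov_quad_form[OF iso r mom B0, of u] mult_right_mono[OF bias, of "(enorm d u)\<^sup>2"]
      by (simp add: V_def y_def)
  next
    show "\<bar>(\<Sum>a<d. V a a) - real d\<bar> \<le> \<epsilon> / sqrt (real d)"
      using trunc_cov_trace[OF iso r mom B0] bias by (simp add: V_def y_def)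
  next
    have W: "?W \<xi> \<le> B powr r"
      using that by (auto simp: G_def G1_def not_less)
    show le: "enorm d (\<xi> k) \<le> B" if "k \<in> {1..n}" for k
    proof (rule ccontr)
      assume "\<not> enorm d (\<xi> k) \<le> B"
      then have "B powr r < enorm d (\<xi> k) powr r" using B0 r by (intro powr_less_mono2) auto
      also have "... \<le> ?W \<xi>" using that by (intro member_le_sum) auto
      finally show False using W by simp
    qed
    have "(\<Sum>k=1..n. enorm d (\<xi> k) ^ 4) \<le> (\<Sum>k=1..n. B powr (4 - r) * enorm d (\<xi> k) powr r)"
      using le r by (intro sum_mono power4_le_powr) auto
    also have "... \<le> B powr (4 - r) * B powr r"
      unfolding sum_distrib_left[symmetric] using W by (intro mult_left_mono) auto
    also have "... = B ^ 4" using B0 by (simp add: powr_add[symmetric])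
    finally show "(\<Sum>k=1..n. enorm d (\<xi> k) ^ 4) \<le> B ^ 4" .
  next
    show "frob_dev d B V n \<xi> \<le> (real n * \<epsilon>)\<^sup>2 / real d"
      using that by (auto simp: G_def G2_def x_def y_def not_less)
  next
    show "(enorm d (psum {1..n} \<xi>))\<^sup>2 \<le> K * (real n * real d)"
      using that by (auto simp: G_def G3_def x_def y_def not_less)
  qed
  moreover have "G \<in> sets ?P" unfolding G_def using sets by auto
  ultimately show ?thesis using prob by blast
qed


section \<open>Convergence of distribution functions\<close>

text \<open>The distribution function of \<open>X\<close> at \<open>x\<close> lies, up to the
  exceptional probability, between those of \<open>V\<close> at \<open>x - \<delta>\<close> and
  \<open>x + \<delta>\<close>. Off \<open>G\<close> nothing is asked of \<open>X\<close>, which may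
  be infinite there; continuity of the limit then lets \<open>\<delta>\<close> shrink.\<close>

lemma cdf_tendsto_of_close:
  fixes X :: "nat \<Rightarrow> 'b \<Rightarrow> ereal" and V :: "nat \<Rightarrow> 'b \<Rightarrow> real" and N :: "real measure"
  assumes P: "\<And>n. prob_space (P n)"
    and X: "\<And>n. X n \<in> borel_measurable (P n)" and V: "\<And>n. V n \<in> borel_measurable (P n)"
    and conv: "weak_conv_m (\<lambda>n. distr (P n) borel (V n)) N"
    and cont: "\<And>x. isCont (cdf N) x"
    and close: "\<And>\<delta> \<eta>. 0 < \<delta> \<Longrightarrow> 0 < \<eta> \<Longrightarrow> \<forall>\<^sub>F n in sequentially. \<exists>G\<in>sets (P n).
      measure (P n) (space (P n) - G) \<le> \<eta> \<and> (\<forall>\<xi>\<in>G. \<exists>v. X n \<xi> = ereal v \<and> \<bar>v - V n \<xi>\<bar> \<le> \<delta>)"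
  shows "(\<lambda>n. measure (P n) {\<xi> \<in> space (P n). X n \<xi> \<le> ereal x}) \<longlonglongrightarrow> cdf N x"
proof -
  let ?p = "\<lambda>n. measure (P n) {\<xi> \<in> space (P n). X n \<xi> \<le> ereal x}"
  let ?q = "\<lambda>n z. measure (P n) {\<xi> \<in> space (P n). V n \<xi> \<le> z}"
  have sX: "{\<xi> \<in> space (P n). X n \<xi> \<le> ereal x} \<in> sets (P n)" for n
    using X[of n] by measurable
  have sV: "{\<xi> \<in> space (P n). V n \<xi> \<le> z} \<in> sets (P n)" for n z
    using V[of n] by measurable
  have q: "(\<lambda>n. ?q n z) \<longlonglongrightarrow> cdf N z" for z
  proof -
    have eq: "cdf (distr (P n) borel (V n)) z = ?q n z" for n
      unfolding cdf_def using V[of n]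
      by (subst measure_distr) (auto intro!: arg_cong[where f="measure (P n)"])
    have "(\<lambda>n. cdf (distr (P n) borel (V n)) z) \<longlonglongrightarrow> cdf N z"
      using conv cont by (simp add: weak_conv_m_def weak_conv_def)
    then show ?thesis by (simp only: eq)
  qed
  have upper: "?p n \<le> ?q n (x + \<delta>) + \<eta>" and lower: "?q n (x - \<delta>) \<le> ?p n + \<eta>"
    if G: "G \<in> sets (P n)" "measure (P n) (space (P n) - G) \<le> \<eta>"
      "\<forall>\<xi>\<in>G. \<exists>v. X n \<xi> = ereal v \<and> \<bar>v - V n \<xi>\<bar> \<le> \<delta>" for n G \<delta> \<eta>
  proof -
    interpret prob_space "P n" by (rule P)
    have c: "space (P n) - G \<in> sets (P n)" using G(1) by auto
    have "?p n \<le> measure (P n) ({\<xi> \<in> space (P n). V n \<xi> \<le> x + \<delta>} \<union> (space (P n) - G))"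
      using G(3) c sV[of n "x + \<delta>"] by (intro finite_measure_mono sets.Un) fastforce+
    also have "... \<le> ?q n (x + \<delta>) + measure (P n) (space (P n) - G)"
      by (intro measure_Un_le sV c)
    finally show "?p n \<le> ?q n (x + \<delta>) + \<eta>" using G(2) by linarith
    have "?q n (x - \<delta>) \<le> measure (P n) ({\<xi> \<in> space (P n). X n \<xi> \<le> ereal x} \<union> (space (P n) - G))"
      using G(3) c sX[of n] by (intro finite_measure_mono sets.Un) fastforce+
    also have "... \<le> ?p n + measure (P n) (space (P n) - G)"
      by (intro measure_Un_le sX c)
    finally show "?q n (x - \<delta>) \<le> ?p n + \<eta>" using G(2) by linarith
  qed
  show ?thesis
  proof (rule order_tendstoI)
    fix a assume a: "a < cdf N x"
    have "((\<lambda>\<delta>. cdf N (x - \<delta>)) \<longlongrightarrow> cdf N (x - 0)) (at_right 0)"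
      using cont[of "x - 0"] by (intro isCont_tendsto_compose[of _ "cdf N"] tendsto_intros) auto
    then have "\<forall>\<^sub>F \<delta> in at_right 0. a < cdf N (x - \<delta>)"
      using a by (simp add: order_tendstoD(1))
    then obtain \<delta> where \<delta>: "0 < \<delta>" "a < cdf N (x - \<delta>)"
      using eventually_happens'[OF trivial_limit_at_right_real eventually_conj[OF _ eventually_at_right_less]]
      by blast
    \<comment> \<open>Half of the gap pays for the exceptional set, the other half for the
      convergence of \<open>?q\<close>.\<close>
    define \<eta> where "\<eta> = (cdf N (x - \<delta>) - a) / 2"
    have "a + \<eta> < cdf N (x - \<delta>)" "0 < \<eta>" using \<delta> by (auto simp: \<eta>_def field_simps)
    then have "\<forall>\<^sub>F n in sequentially. a + \<eta> < ?q n (x - \<delta>)" using order_tendstoD(1)[OF q] by blast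
    then show "\<forall>\<^sub>F n in sequentially. a < ?p n"
      using close[OF \<delta>(1) \<open>0 < \<eta>\<close>]
    proof eventually_elim
      case (elim n)
      then obtain G where "G \<in> sets (P n)" "measure (P n) (space (P n) - G) \<le> \<eta>"
        "\<forall>\<xi>\<in>G. \<exists>v. X n \<xi> = ereal v \<and> \<bar>v - V n \<xi>\<bar> \<le> \<delta>" by blast
      from lower[OF this] elim(1) show ?case by linarith
    qed
  next
    fix a assume a: "cdf N x < a"
    have "((\<lambda>\<delta>. cdf N (x + \<delta>)) \<longlongrightarrow> cdf N (x + 0)) (at_right 0)"
      using cont[of "x + 0"] by (intro isCont_tendsto_compose[of _ "cdf N"] tendsto_intros) auto
    then have "\<forall>\<^sub>F \<delta> in at_right 0. cdf N (x + \<delta>) < a"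
      using a by (simp add: order_tendstoD(2))
    then obtain \<delta> where \<delta>: "0 < \<delta>" "cdf N (x + \<delta>) < a"
      using eventually_happens'[OF trivial_limit_at_right_real eventually_conj[OF _ eventually_at_right_less]]
      by blast
    define \<eta> where "\<eta> = (a - cdf N (x + \<delta>)) / 2"
    have "cdf N (x + \<delta>) < a - \<eta>" "0 < \<eta>" using \<delta> by (auto simp: \<eta>_def field_simps)
    then have "\<forall>\<^sub>F n in sequentially. ?q n (x + \<delta>) < a - \<eta>" using order_tendstoD(2)[OF q] by blast
    then show "\<forall>\<^sub>F n in sequentially. ?p n < a"
      using close[OF \<delta>(1) \<open>0 < \<eta>\<close>]
    proof eventually_elim
      case (elim n)
      then obtain G where "G \<in> sets (P n)" "measure (P n) (space (P n) - G) \<le> \<eta>"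
        "\<forall>\<xi>\<in>G. \<exists>v. X n \<xi> = ereal v \<and> \<bar>v - V n \<xi>\<bar> \<le> \<delta>" by blast
      from upper[OF this] elim(1) show ?case by linarith
    qed
  qed
qed

lemma isCont_cdf_std_normal: "isCont (cdf std_normal_distribution) x"
proof -
  interpret real_distribution std_normal_distribution by (rule real_dist_normal_dist)
  have "emeasure std_normal_distribution {x} = 0"
    by (subst emeasure_density) (auto simp: nn_integral_cmult_indicator)
  then show ?thesis by (simp add: isCont_cdf measure_def)
qed

section \<open>Moment interpolation and growth rates\<close>

lemma isotropic_moment_lower:
  assumes iso: "isotropic d \<nu>" and d: "d \<ge> 1" and q: "0 < q" "q \<le> r"
    and mom: "integrable \<nu> (\<lambda>y. enorm d y powr r)" "(\<integral>y. enorm d y powr r \<partial>\<nu>) \<le> C * real d powr (r / 2)"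
  shows "integrable \<nu> (\<lambda>y. enorm d y powr q) \<and> (\<integral>y. enorm d y powr q \<partial>\<nu>) \<le> (1 + C) * real d powr (q / 2)"
proof -
  interpret prob_space \<nu> using iso by (rule isotropic_prob_space)
  have [measurable]: "enorm d \<in> borel_measurable \<nu>" by (rule isotropic_enorm_measurable[OF iso])
  define s where "s = sqrt (real d)"
  have s: "0 < s" using d by (simp add: s_def)
  have sp: "s powr p = real d powr (p / 2)" for p
    using d by (simp add: s_def powr_half_sqrt[symmetric] powr_powr)
  \<comment> \<open>Comparison at the scale \<open>s = sqrt d\<close> of a typical norm: the
    constant covers norms up to \<open>s\<close>, the r-th power the larger ones.\<close>
  define g where "g y = s powr q * (1 + enorm d y powr r / s powr r)" for y
  have le: "enorm d y powr q \<le> g y" for y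
  proof (cases "enorm d y \<le> s")
    case True
    then have "enorm d y powr q \<le> s powr q * 1" using q by (simp add: powr_mono2)
    also have "... \<le> g y" unfolding g_def by (intro mult_left_mono) auto
    finally show ?thesis .
  next
    case False
    have "enorm d y powr q = (s * (enorm d y / s)) powr q" using s by simp
    also have "... = s powr q * (enorm d y / s) powr q" using s by (intro powr_mult)
    also have "... \<le> s powr q * (enorm d y / s) powr r"
      using False s q by (intro mult_left_mono powr_mono) auto
    also have "(enorm d y / s) powr r = enorm d y powr r / s powr r" using s by (simp add: powr_divide)
    also have "s powr q * (enorm d y powr r / s powr r) \<le> g y"
      unfolding g_def by (intro mult_left_mono) auto
    finally show ?thesis .
  qed
  have g: "integrable \<nu> g" unfolding g_def using mom(1) by auto
  have int: "integrable \<nu> (\<lambda>y. enorm d y powr q)"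
    by (rule Bochner_Integration.integrable_bound[OF g]) (auto intro!: AE_I2 order_trans[OF le abs_ge_self])
  have "(\<integral>y. enorm d y powr q \<partial>\<nu>) \<le> (\<integral>y. g y \<partial>\<nu>)" by (intro integral_mono int g le)
  also have "... = s powr q * (1 + (\<integral>y. enorm d y powr r \<partial>\<nu>) / s powr r)"
    unfolding g_def using mom(1) by (simp add: prob_space)
  also have "... \<le> s powr q * (1 + C)"
    using mom(2) s unfolding sp[of r, symmetric]
    by (intro mult_left_mono add_left_mono) (auto simp: divide_le_eq)
  finally show ?thesis using int by (simp add: sp mult.commute)
qed

text \<open>The first limit is the growth hypothesis raised to the power \<open>(r - 2) / 2\<close>.
  The second holds because \<open>2 * r / (r - 2)\<close> is at least 4 for \<open>r < 4\<close>.
  The third, the replacement error for \<open>q = min r 3\<close>, follows from the first if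
  \<open>r \<le> 3\<close> and otherwise from the square root of the second.\<close>

lemma dimension_growth_limits:
  fixes d :: "nat \<Rightarrow> nat" and r :: real
  assumes r: "2 < r" "r < 4" and d: "\<forall>\<^sub>F n in sequentially. 1 \<le> d n"
    and lim: "(\<lambda>n. real (d n) powr (2 * r / (r - 2)) / real n) \<longlonglongrightarrow> 0"
  shows "(\<lambda>n. real (d n) powr r * real n powr (1 - r / 2)) \<longlonglongrightarrow> 0"
    and "(\<lambda>n. real (d n) ^ 4 / real n) \<longlonglongrightarrow> 0"
    and "(\<lambda>n. real n powr (1 - min r 3 / 2) * real (d n) powr (min r 3 / 2)) \<longlonglongrightarrow> 0"
proof -
  let ?\<rho> = "\<lambda>n. real (d n) powr (2 * r / (r - 2)) / real n"
  have "(\<lambda>n. ?\<rho> n powr ((r - 2) / 2)) \<longlonglongrightarrow> 0"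
    by (rule tendsto_zero_powrI[OF lim tendsto_const]) (use r in auto)
  moreover have "\<forall>\<^sub>F n in sequentially. ?\<rho> n powr ((r - 2) / 2) = real (d n) powr r * real n powr (1 - r / 2)"
    using d eventually_ge_at_top[of 1]
  proof eventually_elim
    case (elim n)
    have "?\<rho> n powr ((r - 2) / 2) = real (d n) powr (2 * r / (r - 2) * ((r - 2) / 2)) / real n powr ((r - 2) / 2)"
      by (simp add: powr_divide powr_powr)
    also have "2 * r / (r - 2) * ((r - 2) / 2) = r" using r by simp
    also have "real (d n) powr r / real n powr ((r - 2) / 2) = real (d n) powr r * real n powr (- ((r - 2) / 2))"
      by (simp only: powr_minus divide_inverse)
    also have "- ((r - 2) / 2) = 1 - r / 2" by (simp add: field_simps)
    finally show ?case .
  qed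
  ultimately show a: "(\<lambda>n. real (d n) powr r * real n powr (1 - r / 2)) \<longlonglongrightarrow> 0"
    by (rule Lim_transform_eventually)
  have e4: "4 \<le> 2 * r / (r - 2)" using r by (simp add: field_simps)
  show b: "(\<lambda>n. real (d n) ^ 4 / real n) \<longlonglongrightarrow> 0"
  proof (rule Lim_null_comparison[OF _ lim])
    show "\<forall>\<^sub>F n in sequentially. norm (real (d n) ^ 4 / real n) \<le> ?\<rho> n"
      using d
    proof eventually_elim
      case (elim n)
      then have "real (d n) ^ 4 = real (d n) powr 4" by simp
      also have "... \<le> real (d n) powr (2 * r / (r - 2))" using elim e4 by (intro powr_mono) auto
      finally show ?case by (simp add: divide_right_mono)
    qed
  qed
  show "(\<lambda>n. real n powr (1 - min r 3 / 2) * real (d n) powr (min r 3 / 2)) \<longlonglongrightarrow> 0"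
  proof (cases "r \<le> 3")
    case True
    then have m: "min r 3 = r" by simp
    show ?thesis unfolding m
    proof (rule Lim_null_comparison[OF _ a])
      show "\<forall>\<^sub>F n in sequentially. norm (real n powr (1 - r / 2) * real (d n) powr (r / 2)) \<le> real (d n) powr r * real n powr (1 - r / 2)"
        using d
      proof eventually_elim
        case (elim n)
        have "real (d n) powr (r / 2) \<le> real (d n) powr r" using elim r by (intro powr_mono) auto
        then show ?case by (simp add: mult.commute mult_right_mono)
      qed
    qed
  next
    case False
    then have m: "min r 3 = 3" by simp
    have s: "(\<lambda>n. (real (d n) ^ 4 / real n) powr (1 / 2)) \<longlonglongrightarrow> 0"
      by (rule tendsto_zero_powrI[OF b tendsto_const]) auto
    show ?thesis unfolding m
    proof (rule Lim_null_comparison[OF _ s])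
      show "\<forall>\<^sub>F n in sequentially. norm (real n powr (1 - 3 / 2) * real (d n) powr (3 / 2)) \<le> (real (d n) ^ 4 / real n) powr (1 / 2)"
        using d eventually_ge_at_top[of 1]
      proof eventually_elim
        case (elim n)
        have "(real (d n) ^ 4 / real n) powr (1 / 2) = (real (d n) powr 4) powr (1 / 2) / real n powr (1 / 2)"
          using elim by (simp add: powr_divide)
        also have "... = real (d n) powr 2 * real n powr (- (1 / 2))"
          by (simp only: powr_powr powr_minus divide_inverse) simp
        finally have eq: "(real (d n) ^ 4 / real n) powr (1 / 2) = real n powr (- (1 / 2)) * real (d n) powr 2"
          by simp
        have e: "1 - 3 / 2 = (- (1 / 2) :: real)" by simp
        have "real (d n) powr (3 / 2) \<le> real (d n) powr 2" using elim by (intro powr_mono) auto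
        then have "real n powr (- (1 / 2)) * real (d n) powr (3 / 2) \<le> real n powr (- (1 / 2)) * real (d n) powr 2"
          by (intro mult_left_mono) auto
        then show ?case unfolding eq e by simp
      qed
    qed
  qed
qed

text \<open>The order of choices matters: \<open>K\<close> comes from the admissible exceptional
  probability, then \<open>\<epsilon>\<close> from \<open>K\<close> and the admissible distance, and
  \<open>n\<close> is taken large last.\<close>

lemma emp_lik_isotropic_cdf_tendsto:
  fixes \<nu> :: "nat \<Rightarrow> (nat \<Rightarrow> real) measure" and d :: "nat \<Rightarrow> nat" and r C :: real
  assumes iso: "\<And>n. isotropic (d n) (\<nu> n)" and r: "2 < r" "r < 4"
    and mom: "\<forall>\<^sub>F n in sequentially. integrable (\<nu> n) (\<lambda>y. enorm (d n) y powr r) \<and>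
      (\<integral>y. enorm (d n) y powr r \<partial>\<nu> n) \<le> C * real (d n) powr (r / 2)"
    and d: "filterlim d at_top sequentially"
    and lim: "(\<lambda>n. real (d n) powr (2 * r / (r - 2)) / real n) \<longlonglongrightarrow> 0"
  shows "(\<lambda>n. measure (PiM {1..n} (\<lambda>_. \<nu> n)) {\<xi> \<in> space (PiM {1..n} (\<lambda>_. \<nu> n)).
      (- 2 * ext_ln (emp_lik n (d n) \<xi>) - ereal (real (d n))) / ereal (sqrt (2 * real (d n))) \<le> ereal x})
    \<longlonglongrightarrow> cdf std_normal_distribution x"
proof -
  let ?P = "\<lambda>n. PiM {1..n} (\<lambda>_. \<nu> n)"
  have d1: "\<forall>\<^sub>F n in sequentially. 1 \<le> d n" using d by (simp add: filterlim_at_top)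
  note lims = dimension_growth_limits[OF r d1 lim]
  define X where "X n \<xi> = (- 2 * ext_ln (emp_lik n (d n) \<xi>) - ereal (real (d n))) / ereal (sqrt (2 * real (d n)))"
    for n \<xi>
  define V where "V n \<xi> = offdiag (d n) {1..n} \<xi> / (real n * sqrt (2 * real (d n)))" for n \<xi>
  show ?thesis unfolding X_def[symmetric]
  proof (rule cdf_tendsto_of_close[where V=V, OF _ _ _ _ isCont_cdf_std_normal])
    show "prob_space (?P n)" for n
      by (rule isotropic_prob_space_PiM) (rule iso)
    show "X n \<in> borel_measurable (?P n)" for n
    proof -
      have "(\<lambda>\<xi>. emp_lik n (d n) \<xi>) \<in> borel_measurable (?P n)"
        by (rule emp_lik_measurable) (rule isotropic_PiM_coord_measurable[OF iso])
      then show ?thesis unfolding X_def[abs_def] by measurable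
    qed
    show "V n \<in> borel_measurable (?P n)" for n
      unfolding V_def[abs_def]
      by (intro borel_measurable_divide isotropic_PiM_measurable(3) iso borel_measurable_const)
    have d4: "(\<lambda>n. real (d n) / real n) \<longlonglongrightarrow> 0"
    proof (rule Lim_null_comparison[OF _ lims(2)])
      show "\<forall>\<^sub>F n in sequentially. norm (real (d n) / real n) \<le> real (d n) ^ 4 / real n"
        using d1 by eventually_elim (simp add: divide_right_mono self_le_power)
    qed
    \<comment> \<open>The replacement estimates hold for exponents up to 3, hence the passage from
      \<open>r\<close> to \<open>min r 3\<close>.\<close>
    have momq: "\<forall>\<^sub>F n in sequentially. integrable (\<nu> n) (\<lambda>y. enorm (d n) y powr (min r 3)) \<and>
      (\<integral>y. enorm (d n) y powr (min r 3) \<partial>\<nu> n) \<le> (1 + C) * real (d n) powr (min r 3 / 2)"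
      using mom d1
    proof eventually_elim
      case (elim n)
      then show ?case using isotropic_moment_lower[OF iso, of n "min r 3" r C] r by auto
    qed
    show "weak_conv_m (\<lambda>n. distr (?P n) borel (V n)) std_normal_distribution"
      unfolding V_def[abs_def]
      by (rule weak_conv_offdiag[OF iso momq _ _ d lims(3) d4]) (use r in auto)
    fix \<delta> \<eta> :: real assume \<delta>: "0 < \<delta>" and \<eta>: "0 < \<eta>"
    define K where "K = 2 / \<eta>"
    have K: "0 < K" using \<eta> by (simp add: K_def)
    define E where "E = 10 * K + 256 * K\<^sup>2 + 2"
    have E: "0 < E" unfolding E_def using K by (intro add_pos_pos) auto
    \<comment> \<open>The three bounds provide, in turn, a relative error of at most 1/8 in the
      expansion, \<open>sqrt K * \<epsilon> \<le> 1/8\<close>, and a final error of at most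
      \<open>\<delta>\<close>; \<open>E\<close> collects the coefficients of that error after
      bounding the cube of \<open>\<epsilon>\<close> by \<open>\<epsilon>\<close>.\<close>
    define \<epsilon> where "\<epsilon> = min (1/16) (min (1 / (8 * sqrt K)) (\<delta> / E))"
    have "0 < \<epsilon>" using K \<delta> E by (simp add: \<epsilon>_def)
    moreover have "\<epsilon> \<le> 1/16" unfolding \<epsilon>_def by (rule min.cobounded1)
    moreover have "\<epsilon> \<le> 1 / (8 * sqrt K)"
      unfolding \<epsilon>_def by (rule min.coboundedI2[OF min.cobounded1])
    moreover have "\<epsilon> \<le> \<delta> / E" unfolding \<epsilon>_def by (rule min.coboundedI2[OF min.cobounded2])
    ultimately have \<epsilon>: "0 < \<epsilon>" "\<epsilon> \<le> 1/16" "\<epsilon> \<le> 1 / (8 * sqrt K)" "\<epsilon> \<le> \<delta> / E"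
      by blast+
    have K\<epsilon>: "sqrt K * \<epsilon> \<le> 1/8"
      using mult_left_mono[OF \<epsilon>(3), of "sqrt K"] K by simp
    have err: "10 * K * \<epsilon> + 256 * K\<^sup>2 * \<epsilon> ^ 3 + 2 * \<epsilon> \<le> \<delta>"
    proof -
      have "\<epsilon> ^ 3 \<le> \<epsilon> ^ 1" using \<epsilon> by (intro power_decreasing) auto
      then have "256 * K\<^sup>2 * \<epsilon> ^ 3 \<le> 256 * K\<^sup>2 * \<epsilon>" by (intro mult_left_mono) auto
      then have "10 * K * \<epsilon> + 256 * K\<^sup>2 * \<epsilon> ^ 3 + 2 * \<epsilon> \<le> \<epsilon> * E" by (simp add: E_def algebra_simps)
      also have "... \<le> \<delta>" using \<epsilon>(4) E by (simp add: pos_le_divide_eq)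
      finally show ?thesis .
    qed
    define B where "B n = \<epsilon> * sqrt (real n / real (d n))" for n
    define A where "A n = real n * (C * real (d n) powr (r / 2)) / B n powr r" for n
    \<comment> \<open>After cancellation \<open>A n\<close> is a constant times
      \<open>d^r * n^(1 - r/2)\<close>, which the growth hypothesis sends to 0.\<close>
    have A_eq: "\<forall>\<^sub>F n in sequentially. C * \<epsilon> powr (- r) * (real (d n) powr r * real n powr (1 - r / 2)) = A n"
      using d1 eventually_ge_at_top[of 1]
    proof eventually_elim
      case (elim n)
      define x y where "x = real n" and "y = real (d n)"
      have xy: "1 \<le> x" "1 \<le> y" using elim by (auto simp: x_def y_def)
      have h1: "B n powr r = \<epsilon> powr r * (x powr (r / 2) / y powr (r / 2))"
        using xy \<epsilon> by (simp add: B_def x_def y_def powr_mult powr_half_sqrt[symmetric] powr_powr powr_divide)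
      have h2: "x powr (1 - r / 2) = x / x powr (r / 2)" using xy by (simp add: powr_diff)
      have h3: "y powr r = y powr (r / 2) * y powr (r / 2)" by (simp add: powr_add[symmetric])
      have h4: "\<epsilon> powr (- r) = 1 / \<epsilon> powr r" by (simp add: powr_minus divide_inverse)
      have "x powr (r / 2) \<noteq> 0" "y powr (r / 2) \<noteq> 0" "\<epsilon> powr r \<noteq> 0" using xy \<epsilon>(1) by auto
      then show ?case
        unfolding A_def x_def[symmetric] y_def[symmetric] h1 h2 h3 h4 by (simp add: divide_simps)
    qed
    have "(\<lambda>n. C * \<epsilon> powr (- r) * (real (d n) powr r * real n powr (1 - r / 2))) \<longlonglongrightarrow> C * \<epsilon> powr (- r) * 0"
      by (intro tendsto_mult tendsto_const lims(1))
    then have A0: "A \<longlonglongrightarrow> 0" using Lim_transform_eventually[OF _ A_eq] by simp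
    have A1: "\<forall>\<^sub>F n in sequentially. A n < min 1 (\<eta> / 4)"
      using \<eta> by (intro order_tendstoD(2)[OF A0]) simp
    \<comment> \<open>One threshold on \<open>d^4 / n\<close> yields both size conditions of
      \<open>emp_lik_close_to_offdiag\<close>.\<close>
    define c0 where "c0 = min (2 * \<epsilon> / K) (\<epsilon> ^ 4 / K\<^sup>2)"
    have c0: "\<forall>\<^sub>F n in sequentially. real (d n) ^ 4 / real n < c0"
      using K \<epsilon> by (intro order_tendstoD(2)[OF lims(2)]) (simp add: c0_def)
    show "\<forall>\<^sub>F n in sequentially. \<exists>G\<in>sets (?P n).
        measure (?P n) (space (?P n) - G) \<le> \<eta> \<and>
        (\<forall>\<xi>\<in>G. \<exists>v. X n \<xi> = ereal v \<and> \<bar>v - V n \<xi>\<bar> \<le> \<delta>)"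
      using d1 eventually_ge_at_top[of 1] A1 c0 mom
    proof eventually_elim
      case (elim n)
      define x y where "x = real n" and "y = real (d n)"
      have xy: "1 \<le> x" "1 \<le> y" using elim by (auto simp: x_def y_def)
      have y4: "y ^ 4 \<le> 2 * \<epsilon> / K * x" "y ^ 4 \<le> \<epsilon> ^ 4 / K\<^sup>2 * x"
        using elim(4) xy by (auto simp: c0_def x_def[symmetric] y_def[symmetric] divide_less_eq)
      have c1: "K * y\<^sup>2 \<le> 2 * \<epsilon> * x"
      proof -
        have "y\<^sup>2 \<le> y ^ 4" using xy by (intro power_increasing) auto
        then have "y\<^sup>2 \<le> 2 * \<epsilon> / K * x" using y4 by linarith
        then show ?thesis using K by (simp add: field_simps)
      qed
      have c2: "K\<^sup>2 * y ^ 4 \<le> \<epsilon> ^ 4 * x ^ 3"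
      proof -
        have "K\<^sup>2 * y ^ 4 \<le> \<epsilon> ^ 4 * x ^ 1" using y4(2) K by (simp add: field_simps)
        also have "... \<le> \<epsilon> ^ 4 * x ^ 3" using xy \<epsilon> by (intro mult_left_mono power_increasing) auto
        finally show ?thesis .
      qed
      from elim(5) have mm: "integrable (\<nu> n) (\<lambda>y. enorm (d n) y powr r)"
        "(\<integral>y. enorm (d n) y powr r \<partial>\<nu> n) \<le> C * real (d n) powr (r / 2)" by auto
      obtain G where G: "G \<in> sets (?P n)"
        "measure (?P n) (space (?P n) - G) \<le> 2 * A n + 1 / K"
        "\<And>\<xi>. \<xi> \<in> G \<Longrightarrow> \<exists>v. - 2 * ext_ln (emp_lik n (d n) \<xi>) = ereal v \<and>
          \<bar>(v - real (d n)) / sqrt (2 * real (d n)) - offdiag (d n) {1..n} \<xi> / (real n * sqrt (2 * real (d n)))\<bar>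
            \<le> 10 * K * \<epsilon> + 256 * K\<^sup>2 * \<epsilon> ^ 3 + 2 * \<epsilon>"
        using emp_lik_close_to_offdiag[OF iso r mm elim(2,1) \<epsilon>(1,2) K K\<epsilon> B_def c1[unfolded x_def y_def]
            c2[unfolded x_def y_def] A_def] elim(3) by fastforce
      \<comment> \<open>\<open>1 / K\<close> is half of \<open>\<eta>\<close>, and
        \<open>A n < \<eta> / 4\<close> keeps the rest within the other half.\<close>
      have "2 * A n + 1 / K \<le> \<eta>" using elim(3) \<eta> by (simp add: K_def)
      moreover have "\<exists>v. X n \<xi> = ereal v \<and> \<bar>v - V n \<xi>\<bar> \<le> \<delta>" if \<xi>: "\<xi> \<in> G" for \<xi>
      proof -
        obtain v where v: "- 2 * ext_ln (emp_lik n (d n) \<xi>) = ereal v"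
          "\<bar>(v - real (d n)) / sqrt (2 * real (d n)) - V n \<xi>\<bar> \<le> 10 * K * \<epsilon> + 256 * K\<^sup>2 * \<epsilon> ^ 3 + 2 * \<epsilon>"
          using G(3)[OF \<xi>] unfolding V_def by blast
        have "X n \<xi> = ereal ((v - real (d n)) / sqrt (2 * real (d n)))"
          unfolding X_def v(1) using elim(1) by simp
        then show ?thesis using v(2) err by (intro exI[of _ "(v - real (d n)) / sqrt (2 * real (d n))"]) auto
      qed
      ultimately show ?case using G(1,2) by (intro bexI[of _ G]) auto
    qed
  qed
qed


section \<open>Reduction to the isotropic case\<close>

lemma emp_lik_cong:
  assumes "\<And>j i. j \<in> {1..n} \<Longrightarrow> i < d \<Longrightarrow> x j i = x' j i"
  shows "emp_lik n d x = emp_lik n d x'"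
proof -
  have "(\<Sum>j=1..n. \<pi> j * x j i) = (\<Sum>j=1..n. \<pi> j * x' j i)" if "i < d" for \<pi> :: "nat \<Rightarrow> real" and i
    using assms that by (intro sum.cong) auto
  then show ?thesis by (simp add: emp_lik_def cong: conj_cong)
qed

text \<open>\<open>y\<close> is \<open>A f\<close> for the Gram-Schmidt matrix \<open>A\<close> of
  the moment matrix \<open>W\<close>, so its covariance is \<open>A W A^T = I\<close>. As
  \<open>A\<close> is injective, \<open>f\<close> and \<open>y\<close> impose the same constraint on
  the weights, and the likelihoods agree.\<close>

lemma whitening:
  fixes f :: "'z \<Rightarrow> nat \<Rightarrow> real"
  assumes Q: "prob_space Q"
    and meas: "\<And>i. i < d \<Longrightarrow> (\<lambda>z. f z i) \<in> borel_measurable Q"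
    and mean: "\<And>i. i < d \<Longrightarrow> (\<integral>z. f z i \<partial>Q) = 0"
    and sq: "integrable Q (\<lambda>z. (enorm d (f z))\<^sup>2)"
    and c: "0 < c" and pos: "\<And>u. c * (enorm d u)\<^sup>2 \<le> quad_form d (moment_matrix Q f) u"
  obtains y where "y \<in> measurable Q (PiM {..<d} (\<lambda>_. borel))"
    and "isotropic d (distr Q (PiM {..<d} (\<lambda>_. borel)) y)"
    and "\<And>z. enorm d (y z) \<le> enorm d (f z) / sqrt c"
    and "\<And>n x. emp_lik n d (\<lambda>j. y (x j)) = emp_lik n d (\<lambda>j. f (x j))"
proof -
  interpret prob_space Q by fact
  let ?W = "moment_matrix Q f"
  have sym: "?W i j = ?W j i" for i j by (simp add: moment_matrix_def mult.commute)
  obtain A where A: "\<And>i. i < d \<Longrightarrow> A i i \<noteq> 0" "\<And>i k. i < d \<Longrightarrow> i < k \<Longrightarrow> A i k = 0"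
    "\<And>i j. i < d \<Longrightarrow> j < d \<Longrightarrow> (\<Sum>k<d. \<Sum>l<d. A i k * ?W k l * A j l) = (if i = j then 1 else 0)"
    using gram_schmidt[of d ?W, OF sym c pos] by blast
  have f_le: "\<bar>f z i\<bar> \<le> enorm d (f z)" if "i < d" for z i
  proof -
    have "(f z i)\<^sup>2 \<le> (enorm d (f z))\<^sup>2"
      unfolding enorm_sq using that by (intro member_le_sum) auto
    then show ?thesis using abs_le_square_iff[of "f z i" "enorm d (f z)"] by simp
  qed
  have int2: "integrable Q (\<lambda>z. f z i * f z j)" if "i < d" "j < d" for i j
  proof (rule Bochner_Integration.integrable_bound[OF sq])
    have "\<bar>f z i * f z j\<bar> \<le> (enorm d (f z))\<^sup>2" for z
      unfolding abs_mult power2_eq_square using f_le that by (intro mult_mono) auto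
    then show "AE z in Q. norm (f z i * f z j) \<le> norm ((enorm d (f z))\<^sup>2)" by simp
  qed (use meas that in \<open>auto intro!: borel_measurable_times\<close>)
  have int1: "integrable Q (\<lambda>z. f z i)" if "i < d" for i
    by (rule square_integrable_imp_integrable[OF meas[OF that]])
       (use int2[OF that that] in \<open>simp add: power2_eq_square\<close>)
  \<comment> \<open>Restricted to \<open>{..<d}\<close> because points of the product space are
    extensional.\<close>
  define y where "y z = (\<lambda>i\<in>{..<d}. dot d (A i) (f z))" for z
  have dm: "(\<lambda>z. dot d (A i) (f z)) \<in> borel_measurable Q" for i
    unfolding dot_def using meas by (intro borel_measurable_sum borel_measurable_times) auto
  have ym: "y \<in> measurable Q (PiM {..<d} (\<lambda>_. borel))"
    unfolding y_def by (intro measurable_restrict dm)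
  have coord: "(\<lambda>y. y i) \<in> borel_measurable (PiM {..<d} (\<lambda>_. borel :: real measure))" if "i < d" for i
    using that by (intro measurable_component_singleton) auto
  have "isotropic d (distr Q (PiM {..<d} (\<lambda>_. borel)) y)"
    unfolding isotropic_def
  proof (intro conjI allI impI)
    show "prob_space (distr Q (PiM {..<d} (\<lambda>_. borel)) y)" by (rule prob_space_distr[OF ym])
    fix i assume i: "i < d"
    have I1: "integrable Q (\<lambda>z. dot d (A i) (f z))"
      unfolding dot_def using int1 by (intro Bochner_Integration.integrable_sum integrable_mult_right) auto
    have "(\<integral>z. dot d (A i) (f z) \<partial>Q) = 0"
      unfolding dot_def using int1 mean by (subst Bochner_Integration.integral_sum) auto
    then show "integrable (distr Q (PiM {..<d} (\<lambda>_. borel)) y) (\<lambda>y. y i)"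
      "(\<integral>y. y i \<partial>distr Q (PiM {..<d} (\<lambda>_. borel)) y) = 0"
      using I1 i by (simp_all add: integrable_distr_eq[OF ym coord[OF i]] integral_distr[OF ym coord[OF i]] y_def)
    fix j assume j: "j < d"
    have cm: "(\<lambda>y. y i * y j) \<in> borel_measurable (PiM {..<d} (\<lambda>_. borel :: real measure))"
      using coord[OF i] coord[OF j] by (rule borel_measurable_times)
    have eq: "dot d (A i) (f z) * dot d (A j) (f z) = (\<Sum>k<d. \<Sum>l<d. (A i k * A j l) * (f z k * f z l))" for z
      by (simp add: dot_def sum_product mult_ac)
    have I: "integrable Q (\<lambda>z. (A i k * A j l) * (f z k * f z l))" if "k < d" "l < d" for k l
      by (intro integrable_mult_right int2 that)
    have I2: "integrable Q (\<lambda>z. dot d (A i) (f z) * dot d (A j) (f z))"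
      unfolding eq by (rule integral_double_sum(1)[OF I])
    have "(\<integral>z. dot d (A i) (f z) * dot d (A j) (f z) \<partial>Q)
       = (\<Sum>k<d. \<Sum>l<d. \<integral>z. (A i k * A j l) * (f z k * f z l) \<partial>Q)"
      unfolding eq by (rule integral_double_sum(2)[OF I])
    also have "... = (\<Sum>k<d. \<Sum>l<d. A i k * ?W k l * A j l)"
      by (simp add: moment_matrix_def mult_ac)
    also have "... = (if i = j then 1 else 0)" by (rule A(3)[OF i j])
    finally show "integrable (distr Q (PiM {..<d} (\<lambda>_. borel)) y) (\<lambda>y. y i * y j)"
      "(\<integral>y. y i * y j \<partial>distr Q (PiM {..<d} (\<lambda>_. borel)) y) = (if i = j then 1 else 0)"
      using I2 i j by (simp_all add: integrable_distr_eq[OF ym cm] integral_distr[OF ym cm] y_def)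
  qed simp
  moreover have "enorm d (y z) \<le> enorm d (f z) / sqrt c" for z
  proof -
    have "enorm d (y z) = enorm d (\<lambda>i. dot d (A i) (f z))" by (rule enorm_cong) (simp add: y_def)
    then show ?thesis using whitening_norm_le[OF c pos A(3), of "f z"] by simp
  qed
  moreover have "emp_lik n d (\<lambda>j. y (x j)) = emp_lik n d (\<lambda>j. f (x j))" for n x
  proof -
    have "(\<forall>i<d. (\<Sum>j=1..n. \<pi> j * y (x j) i) = 0) \<longleftrightarrow> (\<forall>i<d. (\<Sum>j=1..n. \<pi> j * f (x j) i) = 0)"
      for \<pi> :: "nat \<Rightarrow> real"
    proof -
      define v where "v i = (\<Sum>j=1..n. \<pi> j * f (x j) i)" for i
      have "(\<Sum>j=1..n. \<pi> j * y (x j) i) = dot d (A i) v" if "i < d" for i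
      proof -
        have "(\<Sum>j=1..n. \<pi> j * y (x j) i) = (\<Sum>j=1..n. dot d (A i) (\<lambda>k. \<pi> j * f (x j) k))"
          using that by (simp add: y_def dot_scale_right)
        also have "... = dot d (A i) v" unfolding v_def by (rule dot_sum_right[symmetric])
        finally show ?thesis .
      qed
      moreover have "(\<forall>i<d. dot d (A i) v = 0) \<longleftrightarrow> (\<forall>i<d. v i = 0)"
        using lower_triangular_injective[of d A v] A(1,2) by (auto simp: dot_def)
      ultimately show ?thesis by (simp add: v_def)
    qed
    then show ?thesis by (simp add: emp_lik_def)
  qed
  ultimately show thesis using that[of y] ym by blast
qed

text \<open>Quadratic forms are homogeneous, so a bound on the unit sphere extends to all vectors;
  norm zero cannot be rescaled and is treated directly. The infimum is an extended real, hence a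
  positive real \<open>c\<close> is picked strictly below it.\<close>

lemma regular_matrices_lower_bound:
  assumes "regular_matrices m W"
  obtains c where "0 < c" "\<And>n u. n \<ge> 1 \<Longrightarrow> c * (enorm (m n) u)\<^sup>2 \<le> quad_form (m n) (W n) u"
proof -
  let ?I = "INF n\<in>{1..}. INF u\<in>{u. enorm (m n) u = 1}. ereal (quad_form (m n) (W n) u)"
  have "0 < ?I" using assms by (simp add: regular_matrices_def)
  then obtain c where c: "0 < ereal c" "ereal c < ?I" using ereal_dense2 by blast
  have unit: "c \<le> quad_form (m n) (W n) u" if "n \<ge> 1" "enorm (m n) u = 1" for n u
  proof -
    have "?I \<le> ereal (quad_form (m n) (W n) u)"
      using that by (intro INF_lower2[of n] INF_lower2[of u]) auto
    then have "ereal c \<le> ereal (quad_form (m n) (W n) u)" using c(2) by (meson less_imp_le order_trans)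
    then show ?thesis by simp
  qed
  have "c * (enorm (m n) u)\<^sup>2 \<le> quad_form (m n) (W n) u" if n: "n \<ge> 1" for n u
  proof (cases "enorm (m n) u = 0")
    case True
    then have "(\<Sum>i<m n. (u i)\<^sup>2) = 0" using enorm_sq[of "m n" u] by simp
    then have "u i = 0" if "i < m n" for i using that by (simp add: sum_nonneg_eq_0_iff)
    then have "quad_form (m n) (W n) u = 0" by (simp add: quad_form_def)
    then show ?thesis using True by simp
  next
    case False
    define s where "s = enorm (m n) u"
    have s: "0 < s" using False enorm_nonneg[of "m n" u] by (simp add: s_def less_le)
    have "enorm (m n) (\<lambda>i. (1 / s) * u i) = 1"
      unfolding enorm_scale s_def[symmetric] using s by simp
    then have "c \<le> quad_form (m n) (W n) (\<lambda>i. (1 / s) * u i)" by (rule unit[OF n])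
    also have "... = quad_form (m n) (W n) u / s\<^sup>2"
      by (simp add: quad_form_def sum_divide_distrib power2_eq_square)
    finally show ?thesis using s by (simp add: s_def[symmetric] field_simps)
  qed
  with c(1) show thesis using that by simp
qed

theorem theorem7p3:
  fixes M :: "'a measure" and Q :: "'z measure"
    and Z :: "nat \<Rightarrow> 'a \<Rightarrow> 'z"
    and m :: "nat \<Rightarrow> nat"
    and w :: "nat \<Rightarrow> 'z \<Rightarrow> nat \<Rightarrow> real"
    and r :: real
  assumes "prob_space M" and "prob_space Q"
    and "prob_space.indep_vars M (\<lambda>_. Q) Z {1..}"
    and "\<And>j. j \<ge> 1 \<Longrightarrow> distr M Q (Z j) = Q"
    and "\<And>n. n \<ge> 1 \<Longrightarrow> m n > 0"
    and "filterlim m at_top sequentially"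
    and "\<And>n i. n \<ge> 1 \<Longrightarrow> i < m n \<Longrightarrow> (\<lambda>z. w n z i) \<in> borel_measurable Q"
    and "\<And>n i. n \<ge> 1 \<Longrightarrow> i < m n \<Longrightarrow> (\<integral>z. w n z i \<partial>Q) = 0"
    and "\<And>n. n \<ge> 1 \<Longrightarrow> integrable Q (\<lambda>z. (enorm (m n) (w n z))\<^sup>2)"
    and "regular_matrices m (\<lambda>n. moment_matrix Q (w n))"
    and "2 < r" and "r < 4"
    and "\<forall>\<^sub>F n in sequentially. integrable Q (\<lambda>z. enorm (m n) (w n z) powr r)"
    and "(\<lambda>n. \<integral>z. enorm (m n) (w n z) powr r \<partial>Q) \<in> O(\<lambda>n. real (m n) powr (r / 2))"
    and "(\<lambda>n. real (m n) powr (2 * r / (r - 2))) \<in> o(\<lambda>n. real n)"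
  shows "conv_in_distr M
           (\<lambda>n \<omega>. (- 2 * ext_ln (emp_lik n (m n) (\<lambda>j. w n (Z j \<omega>))) - ereal (real (m n)))
                     / ereal (sqrt (2 * real (m n))))
           std_normal_distribution"
proof -
  interpret M: prob_space M by fact
  interpret Q: prob_space Q by fact
  note indep = assms(3) and law = assms(4) and meas = assms(7) and mean = assms(8) and sq = assms(9)
  have Zm: "Z j \<in> measurable M Q" if "j \<ge> 1" for j
    using indep that by (auto simp: M.indep_vars_def)
  obtain c where c: "0 < c"
    "\<And>n u. n \<ge> 1 \<Longrightarrow> c * (enorm (m n) u)\<^sup>2 \<le> quad_form (m n) (moment_matrix Q (w n)) u"
    using regular_matrices_lower_bound[OF assms(10)] by metis
  have "\<exists>y. y \<in> measurable Q (PiM {..<m n} (\<lambda>_. borel)) \<and>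
      isotropic (m n) (distr Q (PiM {..<m n} (\<lambda>_. borel)) y) \<and>
      (\<forall>z. enorm (m n) (y z) \<le> enorm (m n) (w n z) / sqrt c) \<and>
      (\<forall>x. emp_lik n (m n) (\<lambda>j. y (x j)) = emp_lik n (m n) (\<lambda>j. w n (x j)))" if "n \<ge> 1" for n
    using whitening[OF Q.prob_space_axioms meas[OF that] mean[OF that] sq[OF that] c(1) c(2)[OF that]] by metis
  then obtain y where y: "\<And>n. n \<ge> 1 \<Longrightarrow> y n \<in> measurable Q (PiM {..<m n} (\<lambda>_. borel))"
      "\<And>n. n \<ge> 1 \<Longrightarrow> isotropic (m n) (distr Q (PiM {..<m n} (\<lambda>_. borel)) (y n))"
      "\<And>n z. n \<ge> 1 \<Longrightarrow> enorm (m n) (y n z) \<le> enorm (m n) (w n z) / sqrt c"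
      "\<And>n x. n \<ge> 1 \<Longrightarrow> emp_lik n (m n) (\<lambda>j. y n (x j)) = emp_lik n (m n) (\<lambda>j. w n (x j))"
    by metis
  \<comment> \<open>The hypotheses speak about \<open>n \<ge> 1\<close>; the value at 0 is a default
    that makes every \<open>\<nu> n\<close> isotropic.\<close>
  define \<nu> where "\<nu> n = (if n \<ge> 1 then distr Q (PiM {..<m n} (\<lambda>_. borel)) (y n) else std_gauss (m n))" for n
  have iso: "isotropic (m n) (\<nu> n)" for n
    using y(2) isotropic_std_gauss by (simp add: \<nu>_def)
  define X where "X n \<xi> = (- 2 * ext_ln (emp_lik n (m n) \<xi>) - ereal (real (m n))) / ereal (sqrt (2 * real (m n)))"
    for n \<xi>
  have m1: "\<forall>\<^sub>F n in sequentially. 1 \<le> m n" using assms(6) by (simp add: filterlim_at_top)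

  obtain C where C: "\<forall>\<^sub>F n in sequentially.
      norm (\<integral>z. enorm (m n) (w n z) powr r \<partial>Q) \<le> C * norm (real (m n) powr (r / 2))"
    using landau_o.bigE[OF assms(14)] by blast
  have mom: "\<forall>\<^sub>F n in sequentially. integrable (\<nu> n) (\<lambda>y. enorm (m n) y powr r) \<and>
      (\<integral>y. enorm (m n) y powr r \<partial>\<nu> n) \<le> (C / sqrt c powr r) * real (m n) powr (r / 2)"
    using C assms(13) eventually_ge_at_top[of 1]
  proof eventually_elim
    case (elim n)
    note ym = y(1)[OF elim(3)]
    have em: "(\<lambda>y. enorm (m n) y powr r) \<in> borel_measurable (PiM {..<m n} (\<lambda>_. borel))"
    proof -
      have [measurable]: "(\<lambda>y. enorm (m n) y) \<in> borel_measurable (PiM {..<m n} (\<lambda>_. borel))"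
        by (rule enorm_measurable) (simp add: measurable_component_singleton)
      show ?thesis by measurable
    qed
    have le: "enorm (m n) (y n z) powr r \<le> enorm (m n) (w n z) powr r / sqrt c powr r" for z
    proof -
      have "enorm (m n) (y n z) powr r \<le> (enorm (m n) (w n z) / sqrt c) powr r"
        using y(3)[OF elim(3)] assms(11) by (intro powr_mono2) auto
      then show ?thesis using c(1) by (simp add: powr_divide)
    qed
    have int: "integrable Q (\<lambda>z. enorm (m n) (w n z) powr r / sqrt c powr r)" using elim(2) by simp
    have int_y: "integrable Q (\<lambda>z. enorm (m n) (y n z) powr r)"
      by (rule Bochner_Integration.integrable_bound[OF int measurable_compose[OF ym em]])
         (use le in simp)
    have "(\<integral>z. enorm (m n) (y n z) powr r \<partial>Q) \<le> (\<integral>z. enorm (m n) (w n z) powr r / sqrt c powr r \<partial>Q)"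
      by (intro integral_mono int int_y le)
    also have "... = (\<integral>z. enorm (m n) (w n z) powr r \<partial>Q) / sqrt c powr r" by simp
    also have "... \<le> C * real (m n) powr (r / 2) / sqrt c powr r"
      using elim(1) by (intro divide_right_mono) auto
    finally have "(\<integral>z. enorm (m n) (y n z) powr r \<partial>Q) \<le> (C / sqrt c powr r) * real (m n) powr (r / 2)" by simp
    then show ?case
      using elim(3) int_y
      by (simp add: \<nu>_def integrable_distr_eq[OF ym em] integral_distr[OF ym em])
  qed
  have lim: "(\<lambda>n. real (m n) powr (2 * r / (r - 2)) / real n) \<longlonglongrightarrow> 0"
    by (rule smalloD_tendsto[OF assms(15)])
  have main: "(\<lambda>n. measure (PiM {1..n} (\<lambda>_. \<nu> n)) {\<xi> \<in> space (PiM {1..n} (\<lambda>_. \<nu> n)). X n \<xi> \<le> ereal x})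
      \<longlonglongrightarrow> cdf std_normal_distribution x" for x
    unfolding X_def by (rule emp_lik_isotropic_cdf_tendsto[OF iso assms(11,12) mom assms(6) lim])

  \<comment> \<open>Convergence in distribution asks for measurability at every \<open>n\<close>. At
    \<open>n = 0\<close> no observation enters, since \<open>{1..n}\<close> is empty.\<close>
  have X_meas: "(\<lambda>\<omega>. X n (\<lambda>j. w n (Z j \<omega>))) \<in> borel_measurable M" for n
  proof -
    have [measurable]: "(\<lambda>\<omega>. emp_lik n (m n) (\<lambda>j. w n (Z j \<omega>))) \<in> borel_measurable M"
    proof (rule emp_lik_measurable)
      fix j i assume "j \<in> {1..n}" "i < m n"
      then show "(\<lambda>\<omega>. w n (Z j \<omega>) i) \<in> borel_measurable M"
        by (intro measurable_compose[OF Zm meas]) auto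
    qed
    show ?thesis unfolding X_def by measurable
  qed
  \<comment> \<open>The whitened observations \<open>y n (Z j \<omega>)\<close> for \<open>j\<close>
    in \<open>{1..n}\<close> have as joint law the product of copies of \<open>\<nu> n\<close>, so
    the probability can be computed on the product space.\<close>
  have transfer: "measure (distr M borel (\<lambda>\<omega>. X n (\<lambda>j. w n (Z j \<omega>)))) {..ereal x}
      = measure (PiM {1..n} (\<lambda>_. \<nu> n)) {\<xi> \<in> space (PiM {1..n} (\<lambda>_. \<nu> n)). X n \<xi> \<le> ereal x}"
    if n: "n \<ge> 1" for n x
  proof -
    let ?S = "PiM {..<m n} (\<lambda>_. borel :: real measure)"
    let ?T = "PiM {1..n} (\<lambda>_. ?S)"
    let ?Y = "\<lambda>j \<omega>. y n (Z j \<omega>)"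
    have Ym: "?Y j \<in> measurable M ?S" if "j \<in> {1..n}" for j
      using that by (intro measurable_compose[OF Zm y(1)[OF n]]) auto
    have "M.indep_vars (\<lambda>_. ?S) ?Y {1..n}"
      by (rule M.indep_vars_compose2[OF M.indep_vars_subset[OF indep]]) (use y(1)[OF n] in auto)
    then have "distr M ?T (\<lambda>\<omega>. \<lambda>j\<in>{1..n}. ?Y j \<omega>) = PiM {1..n} (\<lambda>j. distr M ?S (?Y j))"
      using n Ym by (subst (asm) M.indep_vars_iff_distr_eq_PiM') auto
    also have "... = PiM {1..n} (\<lambda>_. \<nu> n)"
    proof (rule PiM_cong[OF refl])
      fix j assume j: "j \<in> {1..n}"
      then have "distr M ?S (?Y j) = distr (distr M Q (Z j)) ?S (y n)"
        by (subst distr_distr[OF y(1)[OF n] Zm]) (auto simp: comp_def)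
      then show "distr M ?S (?Y j) = \<nu> n" using law j n by (simp add: \<nu>_def)
    qed
    finally have D: "distr M ?T (\<lambda>\<omega>. \<lambda>j\<in>{1..n}. ?Y j \<omega>) = PiM {1..n} (\<lambda>_. \<nu> n)" .
    have Tm: "(\<lambda>\<omega>. \<lambda>j\<in>{1..n}. ?Y j \<omega>) \<in> measurable M ?T"
      by (intro measurable_restrict Ym)
    have "X n \<in> borel_measurable ?T"
    proof -
      have [measurable]: "(\<lambda>\<xi>. emp_lik n (m n) \<xi>) \<in> borel_measurable ?T"
      proof (rule emp_lik_measurable)
        fix j i assume ji: "j \<in> {1..n}" "i < m n"
        then have "i \<in> {..<m n}" by simp
        then show "(\<lambda>\<xi>. \<xi> j i) \<in> borel_measurable ?T"
          by (rule measurable_compose[OF measurable_component_singleton[OF ji(1)] measurable_component_singleton])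
      qed
      show ?thesis unfolding X_def[abs_def] by measurable
    qed
    then have sT: "{\<xi> \<in> space ?T. X n \<xi> \<le> ereal x} \<in> sets ?T" by measurable
    have X_eq: "X n (\<lambda>j. w n (Z j \<omega>)) = X n (\<lambda>j\<in>{1..n}. ?Y j \<omega>)" for \<omega>
    proof -
      have "emp_lik n (m n) (\<lambda>j. w n (Z j \<omega>)) = emp_lik n (m n) (\<lambda>j. ?Y j \<omega>)"
        by (rule y(4)[OF n, symmetric])
      also have "... = emp_lik n (m n) (\<lambda>j\<in>{1..n}. ?Y j \<omega>)" by (rule emp_lik_cong) simp
      finally show ?thesis by (simp add: X_def)
    qed
    have "measure (distr M borel (\<lambda>\<omega>. X n (\<lambda>j. w n (Z j \<omega>)))) {..ereal x}
      = measure M ((\<lambda>\<omega>. X n (\<lambda>j. w n (Z j \<omega>))) -` {..ereal x} \<inter> space M)"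
      by (rule measure_distr[OF X_meas]) simp
    also have "... = measure M ((\<lambda>\<omega>. \<lambda>j\<in>{1..n}. ?Y j \<omega>) -` {\<xi> \<in> space ?T. X n \<xi> \<le> ereal x} \<inter> space M)"
      using measurable_space[OF Tm] unfolding X_eq by (intro arg_cong[where f="measure M"]) auto
    also have "... = measure (PiM {1..n} (\<lambda>_. \<nu> n)) {\<xi> \<in> space ?T. X n \<xi> \<le> ereal x}"
      unfolding D[symmetric] by (rule measure_distr[OF Tm sT, symmetric])
    also have "space ?T = space (PiM {1..n} (\<lambda>_. \<nu> n))" unfolding D[symmetric] by simp
    finally show ?thesis .
  qed
  have "(\<lambda>n. measure (distr M borel (\<lambda>\<omega>. X n (\<lambda>j. w n (Z j \<omega>)))) {..ereal x})
      \<longlonglongrightarrow> cdf std_normal_distribution x" for x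
    by (rule Lim_transform_eventually[OF main])
       (use eventually_ge_at_top[of 1] in \<open>eventually_elim, simp add: transfer\<close>)
  then show ?thesis
    using X_meas unfolding conv_in_distr_def weak_conv_def X_def by blast
qed

end
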